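(* Let $d\ge2$, let $\Omega\subset\mathbb{R}^d$ be a bounded and simply connected domain of class $C^2$ with outward unit normal $n$, and let $T>0$. Let $u\in C^0(\overline\Omega\times(0,T);\mathbb{R}^d)$ be (weakly) divergence-free in space with $u\cdot n=0$ on $\partial\Omega\times(0,T)$, and let $p\in C^0(\overline\Omega\times(0,T))$. Suppose that $$\int_0^T\!\!\int_\Omega u\cdot\partial_t\tilde\psi+u\otimes u:\nabla\tilde\psi+p\operatorname{div}\tilde\psi=0\qquad\forall\,\tilde\psi\in C^1_c(\Omega\times(0,T);\mathbb{R}^d).$$ Then $$\int_0^T\!\!\int_\Omega u\cdot\partial_t\psi+u\otimes u:\nabla\psi+p\operatorname{div}\psi=\int_0^T\!\!\int_{\partial\Omega}p\,\psi\cdot n\qquad\forall\,\psi\in C^1_c(\overline\Omega\times(0,T);\mathbb{R}^d),$$ and, for every $t\in(0,T)$, the pair $(u(t),p(t))=(u(\cdot,t),p(\cdot,t))$ satisfies $$-\int_\Omega p(t)\,\Delta\varphi+\int_{\partial\Omega}p(t)\,\partial_n\varphi=\int_\Omega u(t)\otimes u(t):H\varphi\qquad\forall\,\varphi\in C^2(\overline\Omega).$$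
   Context: Test fields in $C^1_c(\overline\Omega\times(0,T))$ have support compact in $\overline\Omega\times(0,T)$, so they need not vanish on $\partial\Omega$. $u\otimes u:\nabla\psi=\sum_{i,j}u^iu^j\partial_i\psi^j$, $H\varphi$ is the Hessian matrix of $\varphi$, and $\partial_n\varphi=\nabla\varphi\cdot n$. *)

theory Defs
  imports "HOL-Analysis.Analysis"
begin

text \<open>
  \<open>C1_on U S f\<close>: \<open>f\<close> is of class \<open>C\<^sup>1\<close> on the open set \<open>U\<close>, and \<open>f\<close> and its derivative extend
  continuously to \<open>S\<close>, where \<open>U \<subseteq> S \<subseteq> closure U\<close>. With \<open>S = closure U\<close> this is \<open>C\<^sup>1\<close> up to the
  boundary, with \<open>S = U\<close> it is \<open>C\<^sup>1\<close> on \<open>U\<close>. Values of \<open>f\<close> outside \<open>S\<close> are irrelevant.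
\<close>

definition C1_on :: "'a::real_normed_vector set \<Rightarrow> 'a set \<Rightarrow> ('a \<Rightarrow> 'b::real_normed_vector) \<Rightarrow> bool"
  where "C1_on U S f \<longleftrightarrow> continuous_on S f \<and>
    (\<exists>D :: 'a \<Rightarrow> 'a \<Rightarrow>\<^sub>L 'b. continuous_on S D \<and>
      (\<forall>x\<in>U. (f has_derivative blinfun_apply (D x)) (at x)))"

definition C2_on :: "'a::real_normed_vector set \<Rightarrow> 'a set \<Rightarrow> ('a \<Rightarrow> 'b::real_normed_vector) \<Rightarrow> bool"
  where "C2_on U S f \<longleftrightarrow> continuous_on S f \<and>
    (\<exists>D :: 'a \<Rightarrow> 'a \<Rightarrow>\<^sub>L 'b. C1_on U S D \<and>
      (\<forall>x\<in>U. (f has_derivative blinfun_apply (D x)) (at x)))"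

definition C1c_on :: "'a::real_normed_vector set \<Rightarrow> 'a set \<Rightarrow> ('a \<Rightarrow> 'b::real_normed_vector) \<Rightarrow> bool"
  where "C1c_on U S f \<longleftrightarrow> C1_on U S f \<and>
    compact (closure {x\<in>S. f x \<noteq> 0}) \<and> closure {x\<in>S. f x \<noteq> 0} \<subseteq> S"

definition pderiv_at :: "'n::finite \<Rightarrow> (real^'n \<Rightarrow> 'b::real_normed_vector) \<Rightarrow> real^'n \<Rightarrow> 'b"
  where "pderiv_at i f x = frechet_derivative f (at x) (axis i 1)"

definition grad :: "(real^'n::finite \<Rightarrow> real) \<Rightarrow> real^'n \<Rightarrow> real^'n"
  where "grad f x = (\<chi> i. pderiv_at i f x)"

definition divergence :: "(real^'n::finite \<Rightarrow> real^'n) \<Rightarrow> real^'n \<Rightarrow> real"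
  where "divergence f x = (\<Sum>i\<in>UNIV. pderiv_at i f x $ i)"

definition grad_vec :: "(real^'n::finite \<Rightarrow> real^'n) \<Rightarrow> real^'n \<Rightarrow> real^'n^'n"
  where "grad_vec f x = (\<chi> i j. pderiv_at i f x $ j)"

definition hessian :: "(real^'n::finite \<Rightarrow> real) \<Rightarrow> real^'n \<Rightarrow> real^'n^'n"
  where "hessian f x = (\<chi> i j. pderiv_at i (pderiv_at j f) x)"

definition laplacian :: "(real^'n::finite \<Rightarrow> real) \<Rightarrow> real^'n \<Rightarrow> real"
  where "laplacian f x = (\<Sum>i\<in>UNIV. pderiv_at i (pderiv_at i f) x)"

definition tensor :: "real^'n::finite \<Rightarrow> real^'n \<Rightarrow> real^'n^'n"
  where "tensor v w = (\<chi> i j. v $ i * w $ j)"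

definition frob :: "real^'n::finite^'n \<Rightarrow> real^'n^'n \<Rightarrow> real"
  where "frob A B = (\<Sum>i\<in>UNIV. \<Sum>j\<in>UNIV. A $ i $ j * B $ i $ j)"

text \<open>
  A \<open>C\<^sup>2\<close> graph representation of \<open>\<Omega>\<close> in the open set \<open>W\<close>, over the coordinate hyperplane
  \<open>x $ k = 0\<close>: inside \<open>W\<close>, \<open>\<Omega>\<close> is the part strictly above (\<open>s = 1\<close>) or strictly below (\<open>s = -1\<close>)
  the graph \<open>x $ k = \<gamma> x\<close>. A function on the hyperplane is encoded as a function on the
  whole space that does not depend on the \<open>k\<close>-th coordinate.
\<close>

definition C2_graph_chart ::
    "(real^'n::finite) set \<Rightarrow> 'n \<Rightarrow> real \<Rightarrow> (real^'n \<Rightarrow> real) \<Rightarrow> (real^'n) set \<Rightarrow> bool"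
  where "C2_graph_chart \<Omega> k s \<gamma> W \<longleftrightarrow> open W \<and> (s = 1 \<or> s = -1) \<and> C2_on UNIV UNIV \<gamma> \<and>
    (\<forall>x y. (\<forall>i. i \<noteq> k \<longrightarrow> x $ i = y $ i) \<longrightarrow> \<gamma> x = \<gamma> y) \<and>
    (\<forall>x\<in>W. x \<in> \<Omega> \<longleftrightarrow> s * (x $ k - \<gamma> x) > 0)"

definition C2_boundary :: "(real^'n::finite) set \<Rightarrow> bool"
  where "C2_boundary \<Omega> \<longleftrightarrow> (\<forall>x\<in>frontier \<Omega>. \<exists>k s \<gamma> W. C2_graph_chart \<Omega> k s \<gamma> W \<and> x \<in> W)"

text \<open>
  Near a boundary point \<open>\<Omega>\<close> is the set where \<open>s * (x $ k - \<gamma> x)\<close> is positive, so the outward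
  unit normal is minus the normalized gradient of this function; note that the \<open>k\<close>-th
  component of \<open>grad \<gamma>\<close> vanishes. The vector does not depend on the chart.
\<close>

definition outward_unit_normal :: "(real^'n::finite) set \<Rightarrow> real^'n \<Rightarrow> real^'n"
  where "outward_unit_normal \<Omega> x = (THE \<nu>. \<exists>k s \<gamma> W. C2_graph_chart \<Omega> k s \<gamma> W \<and> x \<in> W \<and>
    \<nu> = - (s / sqrt (1 + (norm (grad \<gamma> x))\<^sup>2)) *\<^sub>R (axis k 1 - grad \<gamma> x))"

text \<open>Lebesgue measure of the hyperplane \<open>x $ k = 0\<close>, regarded as a Borel measure on the whole space.\<close>

definition hyperplane_lborel :: "'n::finite \<Rightarrow> (real^'n) measure"
  where "hyperplane_lborel k =
    distr (Pi\<^sub>M (UNIV - {k}) (\<lambda>_. lborel :: real measure)) borel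
      (\<lambda>f. \<chi> i. if i = k then 0 else f i)"

text \<open>
  The surface measure of \<open>frontier \<Omega>\<close>: the Borel measure concentrated on \<open>frontier \<Omega>\<close> with area
  element \<open>sqrt (1 + \<bar>\<nabla>\<gamma>\<bar>\<^sup>2)\<close> in every graph representation. Existence and uniqueness for a \<open>C\<^sup>2\<close>
  boundary are the usual independence of the surface integral from the charts.
\<close>

definition surface_measure :: "(real^'n::finite) set \<Rightarrow> (real^'n) measure"
  where "surface_measure \<Omega> = (THE \<sigma>. sets \<sigma> = sets borel \<and> emeasure \<sigma> (- frontier \<Omega>) = 0 \<and>
    (\<forall>k s \<gamma> W A. C2_graph_chart \<Omega> k s \<gamma> W \<and> A \<in> sets borel \<and> A \<subseteq> frontier \<Omega> \<inter> W \<longrightarrow>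
      emeasure \<sigma> A =
        (\<integral>\<^sup>+ z. indicator A (z + \<gamma> z *\<^sub>R axis k 1) * ennreal (sqrt (1 + (norm (grad \<gamma> z))\<^sup>2))
          \<partial>hyperplane_lborel k)))"

text \<open>
  The gradient at a boundary point is that of the continuous extension, i.e. its limit
  from inside \<open>\<Omega>\<close>.
\<close>

definition normal_deriv :: "(real^'n::finite) set \<Rightarrow> (real^'n \<Rightarrow> real) \<Rightarrow> real^'n \<Rightarrow> real"
  where "normal_deriv \<Omega> f x = Lim (at x within \<Omega>) (grad f) \<bullet> outward_unit_normal \<Omega> x"

text \<open>
  For \<open>v\<close> continuous on \<open>closure \<Omega>\<close>, \<open>\<Omega>\<close> bounded, testing with compactly supported \<open>C\<^sup>1\<close> or
  smooth functions is the same, by density.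
\<close>

definition weakly_div_free :: "(real^'n::finite) set \<Rightarrow> (real^'n \<Rightarrow> real^'n) \<Rightarrow> bool"
  where "weakly_div_free \<Omega> v \<longleftrightarrow>
    (\<forall>\<eta> :: real^'n \<Rightarrow> real. C1c_on \<Omega> \<Omega> \<eta> \<longrightarrow> (LINT x:\<Omega>|lborel. v x \<bullet> grad \<eta> x) = 0)"

definition euler_integral ::
    "(real^'n::finite) set \<Rightarrow> real \<Rightarrow> ((real^'n) \<times> real \<Rightarrow> real^'n) \<Rightarrow> ((real^'n) \<times> real \<Rightarrow> real) \<Rightarrow>
     ((real^'n) \<times> real \<Rightarrow> real^'n) \<Rightarrow> real"
  where "euler_integral \<Omega> T u p \<psi> =
    (LINT t:{0<..<T}|lborel. LINT x:\<Omega>|lborel.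
        u (x, t) \<bullet> vector_derivative (\<lambda>s. \<psi> (x, s)) (at t)
        + frob (tensor (u (x, t)) (u (x, t))) (grad_vec (\<lambda>y. \<psi> (y, t)) x)
        + p (x, t) * divergence (\<lambda>y. \<psi> (y, t)) x)"

end

theory Submission
  imports Defs
begin

text \<open>
  Let \<open>X m\<close> be cutoff functions with compact support in \<open>\<Omega>\<close> that increase to \<open>1\<close> in a boundary layer of
  width \<open>1 / m\<close>. Testing the equation with \<open>X m \<psi>\<close> produces, besides the integrand for \<open>\<psi>\<close> times \<open>X m\<close>,
  the term \<open>\<nabla>(X m) \<bullet> V\<close> with \<open>V = (u \<bullet> \<psi>) u + p \<psi>\<close>. In a graph chart \<open>X m\<close> is a fixed profile of
  \<open>m\<close> times the height above the graph, so by Fubini and dominated convergence \<open>\<nabla>(X m)\<close> tends to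
  \<open>- n\<close> times surface measure, and \<open>V \<bullet> n = p \<psi> \<bullet> n\<close> because \<open>u\<close> is tangential. The same cutoffs show
  that \<open>u(t)\<close> is orthogonal to gradients; with \<open>\<psi> = a(t) \<nabla>\<phi>\<close> the term with the time derivative then
  vanishes, and varying \<open>a\<close> gives the identity at each time.

  The surface measure exists because the same limit expresses a chart integral of \<open>f n\<close> as the
  integral of \<open>\<nabla>f\<close> over \<open>\<Omega>\<close>, which does not depend on the chart.
\<close>

section \<open>Functions of class C1\<close>

text \<open>The fields \<open>u\<close> and \<open>p\<close> have no derivatives, so the boundary
  term cannot come from integrating the equation by parts; it has to be extracted from the gradient
  of a cutoff. Measuring depth by chart height, not by distance to the boundary, makes the layer
  explicit on vertical lines. It also puts the unnormalised conormal in place of the normal and flat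
  measure in place of surface measure; both errors are the same area element, and they cancel. A
  partition of unity joins the charts, and since its gradients sum to zero it leaves nothing behind
  in the limit. Convergence holds at each fixed time, so integrating in time needs a bound on the
  layer integrals that is uniform in \<open>m\<close> and linear in the supremum of
  \<open>V\<close>; it is carried along from the single chart to the final cutoffs. The two
  conclusions come in a forced order: \<open>a(t) \<nabla>\<phi>\<close> does not vanish at the
  boundary and becomes admissible only through the first. Finally, normal and surface measure are
  definite descriptions, about which nothing is known before existence and uniqueness are
  proved.\<close>

lemma C1_onI:
  assumes "continuous_on S f" "continuous_on S D" "\<And>x. x \<in> U \<Longrightarrow> (f has_derivative blinfun_apply (D x)) (at x)"
  shows "C1_on U S f"
  using assms unfolding C1_on_def by blast

lemma C1_onE:
  assumes "C1_on U S f"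
  obtains D where "continuous_on S f" "continuous_on S D"
    "\<And>x. x \<in> U \<Longrightarrow> (f has_derivative blinfun_apply (D x)) (at x)"
  using assms unfolding C1_on_def by blast

lemma C1_on_continuous: "C1_on U S f \<Longrightarrow> continuous_on S f"
  by (simp add: C1_on_def)

lemma C1_on_subset: "C1_on U S f \<Longrightarrow> U' \<subseteq> U \<Longrightarrow> S' \<subseteq> S \<Longrightarrow> C1_on U' S' f"
  unfolding C1_on_def by (meson continuous_on_subset subsetD)

lemma C1_on_bounded_linear:
  assumes "bounded_linear f" shows "C1_on U S f"
proof (rule C1_onI[where D = "\<lambda>_. Blinfun f"])
  show "continuous_on S f" using assms by (simp add: linear_continuous_on)
  show "continuous_on S (\<lambda>_. Blinfun f)" by (rule continuous_on_const)
  show "(f has_derivative blinfun_apply (Blinfun f)) (at x)" for x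
    using assms by (simp add: bounded_linear_Blinfun_apply bounded_linear_imp_has_derivative)
qed

lemma C1_on_const: "C1_on U S (\<lambda>_. c)"
  by (rule C1_onI[where D = "\<lambda>_. 0"]) (auto intro!: derivative_eq_intros continuous_intros)

lemma C1_on_add:
  assumes "C1_on U S f" "C1_on U S g" shows "C1_on U S (\<lambda>x. f x + g x)"
proof -
  obtain D where D: "continuous_on S f" "continuous_on S D"
    "\<And>x. x \<in> U \<Longrightarrow> (f has_derivative blinfun_apply (D x)) (at x)" using assms(1) by (rule C1_onE) blast
  obtain E where E: "continuous_on S g" "continuous_on S E"
    "\<And>x. x \<in> U \<Longrightarrow> (g has_derivative blinfun_apply (E x)) (at x)" using assms(2) by (rule C1_onE) blast
  show ?thesis
    by (rule C1_onI[where D = "\<lambda>x. D x + E x"])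
      (auto intro!: continuous_intros derivative_eq_intros D E simp: blinfun.add_left)
qed

lemma C1_on_sum:
  assumes "\<And>i. i \<in> I \<Longrightarrow> C1_on U S (f i)" shows "C1_on U S (\<lambda>x. \<Sum>i\<in>I. f i x)"
  using assms by (induction I rule: infinite_finite_induct) (auto intro: C1_on_const C1_on_add)

lemma C1_on_scaleR:
  fixes f :: "'a::real_normed_vector \<Rightarrow> real" and g :: "'a \<Rightarrow> 'b::real_normed_vector"
  assumes "C1_on U S f" "C1_on U S g" shows "C1_on U S (\<lambda>x. f x *\<^sub>R g x)"
proof -
  obtain D where D: "continuous_on S f" "continuous_on S D"
    "\<And>x. x \<in> U \<Longrightarrow> (f has_derivative blinfun_apply (D x)) (at x)" using assms(1) by (rule C1_onE) blast
  obtain E where E: "continuous_on S g" "continuous_on S E"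
    "\<And>x. x \<in> U \<Longrightarrow> (g has_derivative blinfun_apply (E x)) (at x)" using assms(2) by (rule C1_onE) blast
  show ?thesis
  proof (rule C1_onI[where D = "\<lambda>x. f x *\<^sub>R E x + (blinfun_scaleR_left (g x) o\<^sub>L D x)"])
    show "continuous_on S (\<lambda>x. f x *\<^sub>R g x)" by (intro continuous_intros D E)
    show "continuous_on S (\<lambda>x. f x *\<^sub>R E x + (blinfun_scaleR_left (g x) o\<^sub>L D x))"
      by (intro continuous_intros D E
          bounded_bilinear.continuous_on[OF bounded_bilinear_blinfun_compose]
          bounded_linear.continuous_on[OF bounded_linear_blinfun_scaleR_left])
    show "((\<lambda>x. f x *\<^sub>R g x) has_derivative blinfun_apply (f x *\<^sub>R E x + (blinfun_scaleR_left (g x) o\<^sub>L D x))) (at x)"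
      if "x \<in> U" for x
      by (rule has_derivative_eq_rhs[OF has_derivative_scaleR[OF D(3)[OF that] E(3)[OF that]]])
        (simp add: fun_eq_iff blinfun.add_left blinfun.scaleR_left)
  qed
qed

lemma C1_on_mult:
  fixes f :: "'a::real_normed_vector \<Rightarrow> real"
  assumes "C1_on U S f" "C1_on U S g" shows "C1_on U S (\<lambda>x. f x * g x)"
  using C1_on_scaleR[OF assms] by simp

lemma C1_on_prod:
  fixes f :: "'i \<Rightarrow> 'a::real_normed_vector \<Rightarrow> real"
  assumes "\<And>i. i \<in> I \<Longrightarrow> C1_on U S (f i)" shows "C1_on U S (\<lambda>x. \<Prod>i\<in>I. f i x)"
  using assms by (induction I rule: infinite_finite_induct) (auto intro: C1_on_const C1_on_mult)

lemma C1_on_compose: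
  assumes f: "C1_on U S f" and g: "C1_on U' S' g" and "f ` U \<subseteq> U'" "f ` S \<subseteq> S'"
  shows "C1_on U S (\<lambda>x. g (f x))"
proof -
  obtain D where D: "continuous_on S f" "continuous_on S D"
    "\<And>x. x \<in> U \<Longrightarrow> (f has_derivative blinfun_apply (D x)) (at x)" using f by (rule C1_onE) blast
  obtain E where E: "continuous_on S' g" "continuous_on S' E"
    "\<And>x. x \<in> U' \<Longrightarrow> (g has_derivative blinfun_apply (E x)) (at x)" using g by (rule C1_onE) blast
  show ?thesis
  proof (rule C1_onI[where D = "\<lambda>x. E (f x) o\<^sub>L D x"])
    show "continuous_on S (\<lambda>x. g (f x))" using continuous_on_compose2[OF E(1) D(1) assms(4)] .
    show "continuous_on S (\<lambda>x. E (f x) o\<^sub>L D x)"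
      by (intro bounded_bilinear.continuous_on[OF bounded_bilinear_blinfun_compose] D
          continuous_on_compose2[OF E(2) D(1) assms(4)])
    show "((\<lambda>x. g (f x)) has_derivative blinfun_apply (E (f x) o\<^sub>L D x)) (at x)" if "x \<in> U" for x
      using has_derivative_compose[OF D(3)[OF that] E(3)[of "f x"]] that assms(3)
      by (auto simp: o_def blinfun_compose.rep_eq)
  qed
qed

lemma C1_on_real:
  fixes h h' :: "real \<Rightarrow> real"
  assumes "\<And>y. y \<in> U \<Longrightarrow> (h has_real_derivative h' y) (at y)" "continuous_on S h" "continuous_on S h'"
  shows "C1_on U S h"
proof (rule C1_onI[where D = "\<lambda>y. blinfun_scaleR_left (h' y)"])
  show "continuous_on S h" by fact
  show "continuous_on S (\<lambda>y. blinfun_scaleR_left (h' y))"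
    by (intro bounded_linear.continuous_on[OF bounded_linear_blinfun_scaleR_left] assms)
  show "(h has_derivative blinfun_apply (blinfun_scaleR_left (h' y))) (at y)" if "y \<in> U" for y
    using assms(1)[OF that] by (simp add: has_field_derivative_def mult.commute[of _ "h' y"])
qed

lemma C1_on_inverse:
  fixes f :: "'a::real_normed_vector \<Rightarrow> real"
  assumes "C1_on U S f" "\<And>x. x \<in> S \<Longrightarrow> f x \<noteq> 0" "U \<subseteq> S" shows "C1_on U S (\<lambda>x. inverse (f x))"
proof (rule C1_on_compose[OF assms(1)])
  show "C1_on (-{0}) (-{0}) (inverse :: real \<Rightarrow> real)"
    by (rule C1_on_real[where h' = "\<lambda>y. - (inverse y ^ Suc (Suc 0))"])
      (auto simp del: power_Suc intro!: continuous_intros DERIV_inverse)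
qed (use assms in auto)

section \<open>A C1 step profile and its derivative\<close>

definition pos_sq :: "real \<Rightarrow> real" where "pos_sq y = (max 0 y)\<^sup>2"

lemma pos_sq_nonneg [simp]: "0 \<le> pos_sq y"
  and pos_sq_pos_iff: "0 < pos_sq y \<longleftrightarrow> 0 < y"
  and pos_sq_eq_0_iff: "pos_sq y = 0 \<longleftrightarrow> y \<le> 0"
  by (auto simp: pos_sq_def max_def)

text \<open>The two branches fit at 0 because the difference quotient there is bounded by
  \<open>\<bar>h\<bar>\<close>. Test functions are C1 throughout, so this square takes the place of
  the usual smooth exponential.\<close>

lemma pos_sq_has_derivative: "(pos_sq has_real_derivative 2 * max 0 y) (at y)"
proof (cases y "0::real" rule: linorder_cases)
  case less
  have "((\<lambda>_. 0) has_real_derivative 0) (at y)" by simp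
  then have "(pos_sq has_real_derivative 0) (at y)"
    by (rule has_field_derivative_transform_within_open[where S = "{..<0}"])
      (use less in \<open>auto simp: pos_sq_def max_def\<close>)
  then show ?thesis using less by simp
next
  case equal
  have "((\<lambda>h. (pos_sq (0 + h) - pos_sq 0) / h) \<longlongrightarrow> 0) (at 0)"
  proof (rule Lim_null_comparison)
    show "\<forall>\<^sub>F h in at (0::real). norm ((pos_sq (0 + h) - pos_sq 0) / h) \<le> \<bar>h\<bar>"
      by (rule always_eventually) (auto simp: pos_sq_def max_def power2_eq_square abs_mult)
    show "((\<lambda>h::real. \<bar>h\<bar>) \<longlongrightarrow> 0) (at 0)" by (rule tendsto_eq_intros | simp)+
  qed
  then show ?thesis using equal by (simp add: DERIV_def)
next
  case greater
  have "((\<lambda>y. y\<^sup>2) has_real_derivative 2 * y) (at y)" by (auto intro!: derivative_eq_intros)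
  then have "(pos_sq has_real_derivative 2 * y) (at y)"
    by (rule has_field_derivative_transform_within_open[where S = "{0<..}"])
      (use greater in \<open>auto simp: pos_sq_def max_def\<close>)
  then show ?thesis using greater by simp
qed

lemma continuous_on_pos_sq [continuous_intros]:
  "continuous_on S f \<Longrightarrow> continuous_on S (\<lambda>x. pos_sq (f x))"
  unfolding pos_sq_def by (intro continuous_intros)

lemma C1_on_pos_sq:
  assumes "C1_on U S f" shows "C1_on U S (\<lambda>x. pos_sq (f x))"
proof (rule C1_on_compose[OF assms])
  show "C1_on UNIV UNIV pos_sq"
    by (rule C1_on_real[OF pos_sq_has_derivative])
      (auto intro!: continuous_intros continuous_on_pos_sq[of _ "\<lambda>x. x"])
qed auto

text \<open>The two summands of the denominator never vanish together, since
  \<open>y \<le> 1\<close> and \<open>2 \<le> y\<close> exclude each other. The rise starts at 1 and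
  not at 0, which keeps the rescaled cutoffs at a positive height above the boundary and so gives
  them compact support in the domain.\<close>

definition step_fun :: "real \<Rightarrow> real"
  where "step_fun y = pos_sq (y - 1) / (pos_sq (y - 1) + pos_sq (2 - y))"

text \<open>The quotient rule after the products of \<open>max 0 (y - 1)\<close> with
  \<open>pos_sq (y - 1)\<close> have cancelled; in this form the sign and the support can be read
  off.\<close>

definition step_deriv :: "real \<Rightarrow> real"
  where "step_deriv y = 2 * (max 0 (y - 1) * pos_sq (2 - y) + pos_sq (y - 1) * max 0 (2 - y)) /
    (pos_sq (y - 1) + pos_sq (2 - y))\<^sup>2"

lemma step_denom_pos: "0 < pos_sq (y - 1) + pos_sq (2 - y)"
proof (cases "y > 1")
  case True
  then have "0 < pos_sq (y - 1)" by (simp add: pos_sq_pos_iff)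
  then show ?thesis by (simp add: add_pos_nonneg)
next
  case False
  then have "0 < pos_sq (2 - y)" by (simp add: pos_sq_pos_iff)
  then show ?thesis by (simp add: add_nonneg_pos)
qed

lemma step_denom_nz [simp]: "pos_sq (y - 1) + pos_sq (2 - y) \<noteq> 0"
  using step_denom_pos[of y] by simp

lemma step_fun_bounds: "0 \<le> step_fun y" "step_fun y \<le> 1"
  using step_denom_pos[of y] by (auto simp: step_fun_def)

lemma step_fun_eq_0: "y \<le> 1 \<Longrightarrow> step_fun y = 0"
  and step_fun_eq_1: "2 \<le> y \<Longrightarrow> step_fun y = 1"
  and step_deriv_eq_0: "y \<notin> {1..2} \<Longrightarrow> step_deriv y = 0"
  and step_deriv_nonneg: "0 \<le> step_deriv y"
proof -
  have a: "pos_sq (y - 1) = 0" if "y \<le> 1" for y using that by (simp add: pos_sq_eq_0_iff)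
  have b: "pos_sq (2 - y) = 0" if "2 \<le> y" for y using that by (simp add: pos_sq_eq_0_iff)
  show "y \<le> 1 \<Longrightarrow> step_fun y = 0" by (simp add: step_fun_def a)
  show "2 \<le> y \<Longrightarrow> step_fun y = 1" using step_denom_nz[of y] by (simp add: step_fun_def b)
  show "y \<notin> {1..2} \<Longrightarrow> step_deriv y = 0" by (auto simp: step_deriv_def a b not_le)
  show "0 \<le> step_deriv y" by (simp add: step_deriv_def)
qed

lemma step_fun_has_derivative: "(step_fun has_real_derivative step_deriv y) (at y)"
proof -
  have "((\<lambda>y. y - 1) has_real_derivative 1) (at y)" by (auto intro!: derivative_eq_intros)
  from DERIV_chain2[OF pos_sq_has_derivative this]
  have 1: "((\<lambda>y. pos_sq (y - 1)) has_real_derivative 2 * max 0 (y - 1)) (at y)" by simp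
  have "((\<lambda>y. 2 - y) has_real_derivative - 1) (at y)" by (auto intro!: derivative_eq_intros)
  from DERIV_chain2[OF pos_sq_has_derivative this]
  have 2: "((\<lambda>y. pos_sq (2 - y)) has_real_derivative - (2 * max 0 (2 - y))) (at y)" by simp
  have "((\<lambda>y. pos_sq (y - 1) / (pos_sq (y - 1) + pos_sq (2 - y))) has_real_derivative
     ((2 * max 0 (y - 1)) * (pos_sq (y - 1) + pos_sq (2 - y)) -
       pos_sq (y - 1) * (2 * max 0 (y - 1) + - (2 * max 0 (2 - y)))) /
      ((pos_sq (y - 1) + pos_sq (2 - y)) * (pos_sq (y - 1) + pos_sq (2 - y)))) (at y)"
    by (intro DERIV_divide DERIV_add 1 2) simp
  then show ?thesis
    unfolding step_fun_def[abs_def] step_deriv_def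
    by (simp add: power2_eq_square algebra_simps)
qed

lemma continuous_on_step_deriv [continuous_intros]:
  assumes "continuous_on S f" shows "continuous_on S (\<lambda>x. step_deriv (f x))"
  unfolding step_deriv_def by (intro continuous_intros assms) auto

lemma continuous_on_step_fun [continuous_intros]:
  assumes "continuous_on S f" shows "continuous_on S (\<lambda>x. step_fun (f x))"
  unfolding step_fun_def by (intro continuous_intros assms) auto

lemma C1_on_step_fun:
  assumes "C1_on U S f" shows "C1_on U S (\<lambda>x. step_fun (f x))"
proof (rule C1_on_compose[OF assms])
  show "C1_on UNIV UNIV step_fun"
    by (rule C1_on_real[OF step_fun_has_derivative]) (auto intro!: continuous_intros)
qed auto

lemma step_deriv_measurable [measurable]: "step_deriv \<in> borel_measurable borel"
  by (intro borel_measurable_continuous_onI continuous_on_step_deriv continuous_on_id)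

lemma step_deriv_bounded: "\<exists>B\<ge>0. \<forall>y. step_deriv y \<le> B"
proof -
  have "compact (step_deriv ` {1..2})"
    by (intro compact_continuous_image continuous_on_step_deriv continuous_on_id compact_Icc)
  then have "bounded (step_deriv ` {1..2})" by (rule compact_imp_bounded)
  then obtain B where B: "\<And>y. y \<in> {1..2} \<Longrightarrow> norm (step_deriv y) \<le> B"
    unfolding bounded_iff by blast
  show ?thesis
  proof (intro exI[of _ "max 0 B"] conjI allI)
    show "step_deriv y \<le> max 0 B" for y
      using B[of y] step_deriv_eq_0[of y] by (cases "y \<in> {1..2}") auto
  qed simp
qed

text \<open>The rise from 0 to 1 gives total mass one. This normalisation is why the layer limits
  below carry no extra constant.\<close>

lemma step_deriv_integral:
  "integrable lborel step_deriv" "(LINT y|lborel. step_deriv y) = 1"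
proof -
  have c: "isCont step_deriv x" for x
    using continuous_on_step_deriv[OF continuous_on_id, of UNIV] by (simp add: continuous_on_eq_continuous_at)
  have *: "has_bochner_integral lborel (\<lambda>x. step_deriv x * indicator {1..2} x) (step_fun 2 - step_fun 1)"
    by (rule has_bochner_integral_FTC_Icc_real)
      (auto intro!: step_fun_has_derivative c)
  have "(\<lambda>x. step_deriv x * indicator {1..2} x) = step_deriv"
    using step_deriv_eq_0 by (auto simp: fun_eq_iff indicator_def)
  then have "has_bochner_integral lborel step_deriv 1"
    using * by (simp add: step_fun_eq_0 step_fun_eq_1)
  then show "integrable lborel step_deriv" "(LINT y|lborel. step_deriv y) = 1"
    by (auto simp: has_bochner_integral_iff)
qed

section \<open>Slicing Lebesgue measure by lines\<close>

lemma hyperplane_embed_measurable [measurable]: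
  "(\<lambda>f. \<chi> i. if i = k then 0 else f i) \<in> Pi\<^sub>M (UNIV - {k}) (\<lambda>_. lborel :: real measure) \<rightarrow>\<^sub>M (borel :: (real^'n::finite) measure)"
proof -
  \<comment> \<open>As a finite sum over the coordinates other than \<open>k\<close>, the embedding
    only evaluates \<open>f\<close> where the product measure has a factor.\<close>
  have *: "(\<chi> i. if i = k then 0 else f i) = (\<Sum>i\<in>UNIV - {k}. f i *\<^sub>R axis i (1::real))" for f :: "'n \<Rightarrow> real"
    by (auto simp: vec_eq_iff axis_def if_distrib[of "\<lambda>x. _ * x"] sum.If_cases cong: if_cong)
  show ?thesis unfolding * by measurable
qed

lemma sets_hyperplane_lborel [simp, measurable_cong]: "sets (hyperplane_lborel k) = sets borel"
  by (simp add: hyperplane_lborel_def)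

lemma space_hyperplane_lborel [simp]: "space (hyperplane_lborel k) = UNIV"
  by (simp add: hyperplane_lborel_def)

interpretation lborel_product: product_sigma_finite "\<lambda>_::'n. lborel :: real measure"
  by standard

lemma hyperplane_lborel_AE: "AE z in hyperplane_lborel k. z $ k = 0"
  unfolding hyperplane_lborel_def by (subst AE_distr_iff) auto

text \<open>All coordinates of a vector of norm at most \<open>R\<close> lie between
  \<open>-R\<close> and \<open>R\<close>, so the preimage of the ball sits in a cube. Besides
  sigma-finiteness this supplies the integrable majorants on the hyperplane.\<close>

lemma hyperplane_lborel_cball_finite: "emeasure (hyperplane_lborel k) (cball 0 R) < \<infinity>"
proof -
  let ?P = "Pi\<^sub>M (UNIV - {k}) (\<lambda>_. lborel :: real measure)"
  let ?\<phi> = "\<lambda>f. (\<chi> i. if i = k then 0 else f i) :: real^'a"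
  have "emeasure (hyperplane_lborel k) (cball 0 R) = emeasure ?P (?\<phi> -` cball 0 R \<inter> space ?P)"
    unfolding hyperplane_lborel_def by (rule emeasure_distr) auto
  also have "\<dots> \<le> emeasure ?P (Pi\<^sub>E (UNIV - {k}) (\<lambda>_. {-R..R}))"
  proof (rule emeasure_mono)
    show "?\<phi> -` cball 0 R \<inter> space ?P \<subseteq> Pi\<^sub>E (UNIV - {k}) (\<lambda>_. {-R..R})"
    proof (rule subsetI, rule PiE_I)
      fix f i assume f: "f \<in> ?\<phi> -` cball 0 R \<inter> space ?P" and i: "i \<in> UNIV - {k}"
      have "\<bar>?\<phi> f $ i\<bar> \<le> R" using component_le_norm_cart[of "?\<phi> f" i] f by simp
      then show "f i \<in> {-R..R}" using i by auto
    qed (auto simp: space_PiM PiE_def extensional_def)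
  qed (auto intro!: sets_PiM_I_finite)
  also have "\<dots> = (\<Prod>i\<in>UNIV - {k}. emeasure lborel {-R..R})"
    by (subst lborel_product.emeasure_PiM) auto
  also have "\<dots> < \<infinity>"
    by (auto simp: emeasure_lborel_Icc_eq power_less_top_ennreal)
  finally show ?thesis .
qed

lemma sigma_finite_hyperplane_lborel: "sigma_finite_measure (hyperplane_lborel k)"
proof
  show "\<exists>A. countable A \<and> A \<subseteq> sets (hyperplane_lborel k) \<and> \<Union> A = space (hyperplane_lborel k) \<and>
    (\<forall>a\<in>A. emeasure (hyperplane_lborel k) a \<noteq> \<infinity>)"
  proof (intro exI[of _ "range (\<lambda>n::nat. cball 0 (real n))"] conjI ballI)
    show "\<Union> (range (\<lambda>n::nat. cball (0::real^'a) (real n))) = space (hyperplane_lborel k)"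
      by (auto simp: real_arch_simple)
  qed (use hyperplane_lborel_cball_finite in \<open>auto simp: less_top\<close>)
qed

text \<open>Lebesgue measure is determined by its values on boxes, and under this map a box is the
  product of a box in the remaining coordinates and an interval in direction
  \<open>k\<close>.\<close>

lemma lborel_eq_distr_hyperplane:
  "(lborel :: (real^'n::finite) measure) =
    distr (hyperplane_lborel k \<Otimes>\<^sub>M lborel) borel (\<lambda>(z, y). z + y *\<^sub>R axis k 1)"
proof (rule lborel_eqI)
  fix l u :: "real^'n" assume lu: "\<And>b. b \<in> Basis \<Longrightarrow> l \<bullet> b \<le> u \<bullet> b"
  have lu': "l $ i \<le> u $ i" for i using lu[of "axis i 1"] by (simp add: inner_axis axis_in_Basis_iff)
  let ?P = "Pi\<^sub>M (UNIV - {k}) (\<lambda>_. lborel :: real measure)"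
  let ?\<phi> = "\<lambda>f. (\<chi> i. if i = k then 0 else f i) :: real^'n"
  let ?B = "Pi\<^sub>E (UNIV - {k}) (\<lambda>i. {l $ i<..<u $ i})"
  have Bm: "?B \<in> sets ?P" by (auto intro!: sets_PiM_I_finite)
  have ind: "indicator (box l u) (?\<phi> f + y *\<^sub>R axis k 1) = (indicator ?B f * indicator {l $ k<..<u $ k} y :: ennreal)"
    if "f \<in> space ?P" for f y
  proof -
    have "?\<phi> f + y *\<^sub>R axis k 1 \<in> box l u \<longleftrightarrow> f \<in> ?B \<and> y \<in> {l $ k<..<u $ k}"
      using that unfolding mem_box_cart by (auto simp: space_PiM PiE_iff axis_def)
    then show ?thesis by (auto simp: indicator_def)
  qed
  have "emeasure (distr (hyperplane_lborel k \<Otimes>\<^sub>M lborel) borel (\<lambda>(z, y). z + y *\<^sub>R axis k 1)) (box l u)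
     = (\<integral>\<^sup>+x. indicator (box l u) x \<partial>distr (hyperplane_lborel k \<Otimes>\<^sub>M lborel) borel (\<lambda>(z, y). z + y *\<^sub>R axis k 1))"
    by simp
  also have "\<dots> = (\<integral>\<^sup>+p. indicator (box l u) (fst p + snd p *\<^sub>R axis k 1) \<partial>(hyperplane_lborel k \<Otimes>\<^sub>M lborel))"
    by (subst nn_integral_distr) (auto simp: case_prod_beta)
  also have "\<dots> = (\<integral>\<^sup>+z. \<integral>\<^sup>+y. indicator (box l u) (z + y *\<^sub>R axis k 1) \<partial>lborel \<partial>hyperplane_lborel k)"
    by (subst lborel.nn_integral_fst[symmetric]) auto
  also have "\<dots> = (\<integral>\<^sup>+f. \<integral>\<^sup>+y. indicator (box l u) (?\<phi> f + y *\<^sub>R axis k 1) \<partial>lborel \<partial>?P)"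
    unfolding hyperplane_lborel_def by (subst nn_integral_distr) auto
  also have "\<dots> = (\<integral>\<^sup>+f. \<integral>\<^sup>+y. indicator ?B f * indicator {l $ k<..<u $ k} y \<partial>lborel \<partial>?P)"
    by (intro nn_integral_cong) (simp only: ind)
  also have "\<dots> = (\<integral>\<^sup>+f. indicator ?B f * ennreal (u $ k - l $ k) \<partial>?P)"
    using lu' by (subst nn_integral_cmult) auto
  also have "\<dots> = emeasure ?P ?B * ennreal (u $ k - l $ k)"
    using Bm by (subst nn_integral_multc) auto
  also have "\<dots> = ennreal (\<Prod>i\<in>UNIV. u $ i - l $ i)"
    using lu' by (subst lborel_product.emeasure_PiM)
      (auto simp: prod_ennreal ennreal_mult[symmetric] prod_nonneg prod.remove[of UNIV k] mult.commute)
  \<comment> \<open>Only a change of index set, from coordinates to the basis vectors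
    \<open>axis i 1\<close> in which \<open>lborel_eqI\<close> is phrased.\<close>
  also have "(\<Prod>i\<in>UNIV. u $ i - l $ i) = (\<Prod>b\<in>Basis. (u - l) \<bullet> b)"
  proof (rule prod.reindex_bij_witness[of _ "\<lambda>b. THE i. b = axis i 1" "\<lambda>i. axis i 1"])
    fix b :: "real^'n" assume "b \<in> Basis"
    then obtain i where b: "b = axis i 1" by (auto simp: Basis_vec_def)
    have "(THE i. b = axis i 1) = i" unfolding b by (rule the_equality) (auto simp: axis_eq_axis)
    then show "axis (THE i. b = axis i 1) 1 = b" "(THE i. b = axis i 1) \<in> UNIV" using b by auto
  qed (auto simp: axis_eq_axis inner_axis axis_in_Basis_iff)
  finally show "emeasure (distr (hyperplane_lborel k \<Otimes>\<^sub>M lborel) borel (\<lambda>(z, y). z + y *\<^sub>R axis k 1)) (box l u)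
     = (\<Prod>b\<in>Basis. (u - l) \<bullet> b)" .
qed simp

lemma integral_hyperplane_fubini:
  fixes F :: "real^'n::finite \<Rightarrow> real"
  assumes F: "integrable lborel F"
  shows "integrable (hyperplane_lborel k) (\<lambda>z. LINT y|lborel. F (z + y *\<^sub>R axis k 1))"
    and "(LINT x|lborel. F x) = (LINT z|hyperplane_lborel k. LINT y|lborel. F (z + y *\<^sub>R axis k 1))"
proof -
  interpret H: sigma_finite_measure "hyperplane_lborel k" by (rule sigma_finite_hyperplane_lborel)
  interpret pair_sigma_finite "hyperplane_lborel k" lborel ..
  have [measurable]: "F \<in> borel_measurable borel" using F by (simp add: integrable_iff_bounded)
  have *: "(\<lambda>(z, y). z + y *\<^sub>R axis k 1) \<in> hyperplane_lborel k \<Otimes>\<^sub>M lborel \<rightarrow>\<^sub>M borel" by measurable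
  have "integrable (distr (hyperplane_lborel k \<Otimes>\<^sub>M lborel) borel (\<lambda>(z, y). z + y *\<^sub>R axis k 1)) F"
    using F by (subst (asm) lborel_eq_distr_hyperplane[of k])
  then have int: "integrable (hyperplane_lborel k \<Otimes>\<^sub>M lborel) (\<lambda>(z, y). F (z + y *\<^sub>R axis k 1))"
    by (subst (asm) integrable_distr_eq) (auto simp: case_prod_unfold)
  show "integrable (hyperplane_lborel k) (\<lambda>z. LINT y|lborel. F (z + y *\<^sub>R axis k 1))"
    using integrable_fst[OF int] .
  have "(LINT x|lborel. F x) = (LINT p|(hyperplane_lborel k \<Otimes>\<^sub>M lborel). F (case p of (z, y) \<Rightarrow> z + y *\<^sub>R axis k 1))"
    by (subst lborel_eq_distr_hyperplane[of k]) (rule integral_distr, auto)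
  also have "\<dots> = (LINT z|hyperplane_lborel k. LINT y|lborel. F (z + y *\<^sub>R axis k 1))"
    using integral_fst[OF int] by (simp add: case_prod_unfold)
  finally show "(LINT x|lborel. F x) = (LINT z|hyperplane_lborel k. LINT y|lborel. F (z + y *\<^sub>R axis k 1))" .
qed

lemma integrable_continuous_compact_support:
  fixes f :: "'a::euclidean_space \<Rightarrow> real"
  assumes "continuous_on UNIV f" "compact K" "\<And>x. x \<notin> K \<Longrightarrow> f x = 0"
  shows "integrable lborel f"
proof -
  have "integrable lborel (\<lambda>x. indicator K x *\<^sub>R f x)"
    by (rule borel_integrable_compact) (use assms continuous_on_subset in blast)+
  also have "(\<lambda>x. indicator K x *\<^sub>R f x) = f" using assms(3) by (auto simp: fun_eq_iff indicator_def)
  finally show ?thesis .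
qed

lemma hyperplane_norm_bounds:
  fixes z :: "real^'n::finite"
  assumes "z $ k = 0"
  shows "norm z \<le> norm (z + y *\<^sub>R axis k 1)" "\<bar>y\<bar> \<le> norm (z + y *\<^sub>R axis k 1)"
proof -
  show "norm z \<le> norm (z + y *\<^sub>R axis k 1)"
    by (rule norm_le_componentwise_cart) (use assms in \<open>auto simp: axis_def\<close>)
  show "\<bar>y\<bar> \<le> norm (z + y *\<^sub>R axis k 1)"
    using component_le_norm_cart[of "z + y *\<^sub>R axis k 1" k] assms by (simp add: axis_def)
qed

text \<open>The divergence theorem without boundary term. After slicing by lines in direction
  \<open>k\<close>, each slice is the integral of the derivative of a compactly supported function
  of one variable. Nothing is assumed about the boundary of \<open>U\<close>.\<close>

lemma integral_pderiv_compact_support: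
  fixes F :: "real^'n::finite \<Rightarrow> real"
  assumes U: "open U" and K: "compact K" "K \<subseteq> U"
    and F: "\<And>x. x \<in> U \<Longrightarrow> (F has_derivative F' x) (at x)" "\<And>x. x \<in> U - K \<Longrightarrow> F x = 0"
    and c: "continuous_on U (\<lambda>x. F' x (axis k 1))"
  shows "(LINT x:U|lborel. F' x (axis k 1)) = 0"
proof -
  define e where "e = (axis k 1 :: real^'n)"
  \<comment> \<open>Lines may leave and re-enter \<open>U\<close>, so the function and its
    derivative are extended by zero. The extensions stay regular because \<open>F\<close> already
    vanishes on the open set \<open>U - K\<close>.\<close>
  define G where "G x = (if x \<in> U then F x else 0)" for x
  define d where "d x = (if x \<in> U then F' x e else 0)" for x
  have opK: "open (-K)" using K(1) by (simp add: compact_imp_closed open_Compl)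
  have G0: "G x = 0" if "x \<notin> K" for x using that F(2) by (auto simp: G_def)
  have d0: "d x = 0" if "x \<notin> K" for x
  proof (cases "x \<in> U")
    case True
    have "((\<lambda>_. 0) has_derivative F' x) (at x)"
      by (rule has_derivative_transform_within_open[OF F(1)[OF True], of "U - K"])
        (use True that U K F(2) in \<open>auto simp: compact_imp_closed open_Diff\<close>)
    then have "F' x = (\<lambda>_. 0)" using has_derivative_unique[of "\<lambda>_. 0" "F' x" x "\<lambda>_. 0"] by simp
    then show ?thesis by (simp add: d_def)
  qed (simp add: d_def)
  have contd: "continuous_on UNIV d"
  proof -
    have "continuous_on (U \<union> -K) d"
    proof (rule continuous_on_open_Un[OF U opK])
      show "continuous_on U d" using c by (rule continuous_on_eq) (simp add: d_def e_def)
      show "continuous_on (-K) d" by (rule continuous_on_eq[of _ "\<lambda>_. 0"]) (auto simp: d0)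
    qed
    moreover have "U \<union> -K = UNIV" using K by auto
    ultimately show ?thesis by simp
  qed
  have dG: "((\<lambda>y. G (z + y *\<^sub>R e)) has_real_derivative d (z + y *\<^sub>R e)) (at y)" for z y
  proof (cases "z + y *\<^sub>R e \<in> U")
    case True
    have "(G has_derivative F' (z + y *\<^sub>R e)) (at (z + y *\<^sub>R e))"
      by (rule has_derivative_transform_within_open[OF F(1)[OF True] U True]) (simp add: G_def)
    then have "((\<lambda>y. G (z + y *\<^sub>R e)) has_derivative (\<lambda>t. F' (z + y *\<^sub>R e) (t *\<^sub>R e))) (at y)"
      by (rule has_derivative_compose[rotated]) (auto intro!: derivative_eq_intros)
    moreover have "F' (z + y *\<^sub>R e) (t *\<^sub>R e) = d (z + y *\<^sub>R e) * t" for t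
      using has_derivative_bounded_linear[OF F(1)[OF True]] True
      by (simp add: d_def linear_cmul bounded_linear.linear)
    ultimately show ?thesis by (simp add: has_field_derivative_def)
  next
    case False
    then have nK: "z + y *\<^sub>R e \<notin> K" using K by auto
    have o: "open ((\<lambda>y. z + y *\<^sub>R e) -` (-K))" by (intro continuous_open_vimage opK continuous_intros)
    have "((\<lambda>y. G (z + y *\<^sub>R e)) has_real_derivative 0) (at y)"
      by (rule has_field_derivative_transform_within_open[of "\<lambda>_. 0", OF _ o]) (use nK G0 in auto)
    then show ?thesis using d0[OF nK] by simp
  qed
  obtain R where R: "\<And>x. x \<in> K \<Longrightarrow> norm x \<le> R"
    using compact_imp_bounded[OF K(1)] unfolding bounded_iff by blast
  have "(LINT x:U|lborel. F' x (axis k 1)) = (LINT x|lborel. d x)"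
    unfolding set_lebesgue_integral_def by (intro Bochner_Integration.integral_cong) (auto simp: d_def e_def indicator_def)
  also have "\<dots> = (LINT z|hyperplane_lborel k. LINT y|lborel. d (z + y *\<^sub>R axis k 1))"
    by (intro integral_hyperplane_fubini integrable_continuous_compact_support[OF contd K(1) d0])
  also have "\<dots> = (LINT z|hyperplane_lborel k. 0)"
  proof (rule integral_cong_AE)
    show "AE z in hyperplane_lborel k. (LINT y|lborel. d (z + y *\<^sub>R axis k 1)) = 0"
      using hyperplane_lborel_AE[of k]
    proof eventually_elim
      case (elim z)
      have out: "z + y *\<^sub>R e \<notin> K" if "\<bar>y\<bar> > R" for y
        using R[of "z + y *\<^sub>R e"] hyperplane_norm_bounds(2)[OF elim, of y] that by (auto simp: e_def)
      \<comment> \<open>The endpoints must lie strictly beyond \<open>R\<close>; the modulus covers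
        the case of empty \<open>K\<close>, in which \<open>R\<close> may be negative.\<close>
      let ?a = "\<bar>R\<bar> + 1"
      have "(LINT y|lborel. d (z + y *\<^sub>R e)) = (LINT y|lborel. d (z + y *\<^sub>R e) * indicator {-?a..?a} y)"
      proof (intro Bochner_Integration.integral_cong refl)
        show "d (z + y *\<^sub>R e) = d (z + y *\<^sub>R e) * indicator {-?a..?a} y" for y
          using d0[OF out[of y]] by (cases "\<bar>y\<bar> > R") (auto simp: indicator_def)
      qed
      also have "\<dots> = G (z + ?a *\<^sub>R e) - G (z + (-?a) *\<^sub>R e)"
        by (rule integral_FTC_Icc_real[OF _ dG])
          (auto intro!: continuous_on_interior[of UNIV] continuous_on_compose2[OF contd] continuous_intros)
      also have "\<dots> = 0" using G0[OF out[of ?a]] G0[OF out[of "-?a"]] by simp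
      finally show ?case by (simp add: e_def)
    qed
    have [measurable]: "d \<in> borel_measurable borel" using contd by (rule borel_measurable_continuous_onI)
    show "(\<lambda>z. LINT y|lborel. d (z + y *\<^sub>R axis k 1)) \<in> borel_measurable (hyperplane_lborel k)"
      by measurable
  qed simp
  finally show ?thesis by simp
qed

section \<open>Graph charts\<close>

lemma grad_eqI:
  fixes f :: "real^'n::finite \<Rightarrow> real"
  assumes "(f has_derivative f') (at x)"
  shows "f' h = grad f x \<bullet> h" "pderiv_at i f x = f' (axis i 1)" "grad f x $ i = f' (axis i 1)"
proof -
  have fd: "frechet_derivative f (at x) = f'" using frechet_derivative_at[OF assms] by simp
  show "pderiv_at i f x = f' (axis i 1)" "grad f x $ i = f' (axis i 1)" for i
    by (simp_all add: grad_def pderiv_at_def fd)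
  have g: "grad f x $ i = f' (axis i 1)" for i by (simp add: grad_def pderiv_at_def fd)
  have lin: "linear f'" using assms by (simp add: has_derivative_linear)
  have "f' h = f' (\<Sum>i\<in>UNIV. h $ i *\<^sub>R axis i 1)" by (subst basis_expansion[symmetric]) (simp add: scalar_mult_eq_scaleR)
  also have "\<dots> = (\<Sum>i\<in>UNIV. h $ i * f' (axis i 1))" using lin by (simp add: linear_sum linear_cmul)
  also have "\<dots> = grad f x \<bullet> h" by (simp add: inner_vec_def g mult.commute)
  finally show "f' h = grad f x \<bullet> h" .
qed

lemma grad_has_derivative:
  fixes f :: "real^'n::finite \<Rightarrow> real"
  assumes "(f has_derivative f') (at x)" shows "(f has_derivative (\<lambda>h. grad f x \<bullet> h)) (at x)"
  by (rule has_derivative_eq_rhs[OF assms]) (rule ext, rule grad_eqI(1)[OF assms])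

lemma grad_unique:
  fixes f :: "real^'n::finite \<Rightarrow> real"
  assumes "(f has_derivative (\<lambda>h. v \<bullet> h)) (at x)" shows "grad f x = v"
  using grad_eqI(3)[OF assms] by (simp add: vec_eq_iff inner_axis)

text \<open>\<open>grad f\<close> is built from the derivative at full neighbourhoods and carries no
  information at points of \<open>S\<close> outside \<open>U\<close>. There \<open>G\<close>
  replaces it, as the continuous extension.\<close>

lemma C1_on_grad:
  fixes f :: "real^'n::finite \<Rightarrow> real"
  assumes "C1_on U S f"
  obtains G where "continuous_on S f" "continuous_on S G"
    "\<And>x. x \<in> U \<Longrightarrow> (f has_derivative (\<lambda>h. G x \<bullet> h)) (at x)" "\<And>x. x \<in> U \<Longrightarrow> grad f x = G x"
proof -
  obtain D where D: "continuous_on S f" "continuous_on S D"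
    "\<And>x. x \<in> U \<Longrightarrow> (f has_derivative blinfun_apply (D x)) (at x)" using assms by (rule C1_onE) blast
  define G :: "_ \<Rightarrow> real^'n" where "G x = (\<chi> i. D x (axis i 1))" for x
  have cG: "continuous_on S G" unfolding G_def by (intro continuous_on_vec_lambda continuous_intros D)
  have gG: "grad f x = G x" if "x \<in> U" for x
    using grad_eqI(3)[OF D(3)[OF that]] by (simp add: G_def vec_eq_iff)
  show ?thesis
    by (rule that[OF D(1) cG _ gG]) (use grad_has_derivative[OF D(3)] gG in auto)
qed

lemma C1_on_open_grad:
  fixes f :: "real^'n::finite \<Rightarrow> real"
  assumes "C1_on U S f" "U \<subseteq> S"
  shows "continuous_on U (grad f)" "\<And>x. x \<in> U \<Longrightarrow> (f has_derivative (\<lambda>h. grad f x \<bullet> h)) (at x)"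
proof -
  have "continuous_on U (grad f) \<and> (\<forall>x\<in>U. (f has_derivative (\<lambda>h. grad f x \<bullet> h)) (at x))"
  proof (rule C1_on_grad[OF assms(1)])
    fix G assume G: "continuous_on S G" "\<And>x. x \<in> U \<Longrightarrow> (f has_derivative (\<lambda>h. G x \<bullet> h)) (at x)"
      "\<And>x. x \<in> U \<Longrightarrow> grad f x = G x"
    have "continuous_on U (grad f)"
      using continuous_on_subset[OF G(1) assms(2)] by (rule continuous_on_eq) (simp add: G(3))
    then show ?thesis using G(2,3) by simp
  qed
  then show "continuous_on U (grad f)" "\<And>x. x \<in> U \<Longrightarrow> (f has_derivative (\<lambda>h. grad f x \<bullet> h)) (at x)" by auto
qed

abbreviation "hyp \<equiv> hyperplane_lborel"

definition chart_height :: "'n::finite \<Rightarrow> real \<Rightarrow> (real^'n \<Rightarrow> real) \<Rightarrow> real^'n \<Rightarrow> real"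
  where "chart_height k s \<gamma> x = s * (x $ k - \<gamma> x)"

text \<open>The gradient of \<open>chart_height\<close>, hence an inward normal that is not
  normalised. Its \<open>k\<close>-th component is the constant \<open>s\<close>, which is what
  makes the comparison of two charts work.\<close>

definition chart_conormal :: "'n::finite \<Rightarrow> real \<Rightarrow> (real^'n \<Rightarrow> real) \<Rightarrow> real^'n \<Rightarrow> real^'n"
  where "chart_conormal k s \<gamma> x = s *\<^sub>R (axis k 1 - grad \<gamma> x)"

text \<open>The area element of the graph, and at the same time the length of the conormal.\<close>

definition chart_jac :: "(real^'n::finite \<Rightarrow> real) \<Rightarrow> real^'n \<Rightarrow> real"
  where "chart_jac \<gamma> x = sqrt (1 + (norm (grad \<gamma> x))\<^sup>2)"

definition chart_lift :: "'n::finite \<Rightarrow> (real^'n \<Rightarrow> real) \<Rightarrow> real^'n \<Rightarrow> real^'n"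
  where "chart_lift k \<gamma> z = z + \<gamma> z *\<^sub>R axis k 1"

locale graph_chart =
  fixes \<Omega> :: "(real^'n::finite) set" and k s \<gamma> W
  assumes open_dom: "open \<Omega>" and chart: "C2_graph_chart \<Omega> k s \<gamma> W"
begin

abbreviation "ht \<equiv> chart_height k s \<gamma>"
abbreviation "cn \<equiv> chart_conormal k s \<gamma>"
abbreviation "jac \<equiv> chart_jac \<gamma>"
abbreviation "lift \<equiv> chart_lift k \<gamma>"

lemma open_W: "open W" and s_cases: "s = 1 \<or> s = -1"
  and mem_iff: "x \<in> W \<Longrightarrow> x \<in> \<Omega> \<longleftrightarrow> ht x > 0"
  using chart by (auto simp: C2_graph_chart_def chart_height_def)

lemma s_sq [simp]: "s * s = 1" "s * (s * a) = a" "\<bar>s\<bar> = 1" using s_cases by auto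

lemma \<gamma>_C2: "C2_on UNIV UNIV \<gamma>" using chart by (simp add: C2_graph_chart_def)

lemma \<gamma>_C1: "C1_on UNIV UNIV \<gamma>" 
  using \<gamma>_C2 unfolding C2_on_def C1_on_def by auto

lemma \<gamma>_shift [simp]: "\<gamma> (x + y *\<^sub>R axis k 1) = \<gamma> x"
  using chart by (auto simp: C2_graph_chart_def axis_def)

lemma \<gamma>_has_derivative: "(\<gamma> has_derivative (\<lambda>h. grad \<gamma> x \<bullet> h)) (at x)"
  and continuous_\<gamma>: "continuous_on UNIV \<gamma>"
  and continuous_grad: "continuous_on UNIV (grad \<gamma>)"
  using C1_on_open_grad[OF \<gamma>_C1] C1_on_continuous[OF \<gamma>_C1] by auto

lemma grad_shift [simp]: "grad \<gamma> (x + y *\<^sub>R axis k 1) = grad \<gamma> x"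
proof -
  have "((\<lambda>z. \<gamma> (z + y *\<^sub>R axis k 1)) has_derivative (\<lambda>h. grad \<gamma> (x + y *\<^sub>R axis k 1) \<bullet> h)) (at x)"
    by (rule has_derivative_compose[OF _ \<gamma>_has_derivative]) (auto intro!: derivative_eq_intros)
  then show ?thesis using grad_unique by fastforce
qed

lemma grad_k [simp]: "grad \<gamma> x $ k = 0"
proof -
  have "((\<lambda>y. \<gamma> (x + y *\<^sub>R axis k 1)) has_derivative (\<lambda>h. grad \<gamma> (x + 0 *\<^sub>R axis k 1) \<bullet> (h *\<^sub>R axis k 1))) (at 0)"
    by (rule has_derivative_compose[OF _ \<gamma>_has_derivative]) (auto intro!: derivative_eq_intros)
  then have "((\<lambda>y. \<gamma> x) has_derivative (\<lambda>h. h * grad \<gamma> x $ k)) (at (0::real))"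
    by (simp add: inner_axis)
  then have "(\<lambda>h. h * grad \<gamma> x $ k) = (\<lambda>h. 0)"
    by (rule has_derivative_unique) auto
  then show ?thesis by (metis mult_1)
qed

lemma jac_pos: "jac x > 0"
  by (auto simp: chart_jac_def add_pos_nonneg)

text \<open>Pythagoras: \<open>grad \<gamma> x\<close> is orthogonal to \<open>axis k 1\<close>,
  since \<open>\<gamma>\<close> is constant in that direction.\<close>

lemma norm_cn: "norm (cn x) = jac x"
proof -
  have "(norm (axis k 1 - grad \<gamma> x))\<^sup>2 = 1 + (norm (grad \<gamma> x))\<^sup>2"
    by (simp add: power2_norm_eq_inner inner_diff_left inner_diff_right inner_axis inner_axis' )
  then show ?thesis
    by (simp add: chart_conormal_def chart_jac_def) (metis norm_ge_zero real_sqrt_unique)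
qed

lemma cn_k [simp]: "cn x $ k = s" by (simp add: chart_conormal_def axis_def)

lemma continuous_cn: "continuous_on UNIV cn"
  unfolding chart_conormal_def by (intro continuous_intros continuous_grad)

lemma continuous_jac: "continuous_on UNIV jac"
  unfolding chart_jac_def by (intro continuous_intros continuous_grad)

lemma continuous_lift: "continuous_on UNIV lift"
  unfolding chart_lift_def by (intro continuous_intros continuous_\<gamma>)

lemma lift_measurable [measurable]: "lift \<in> borel_measurable borel"
  by (rule borel_measurable_continuous_onI[OF continuous_lift])

lemma jac_measurable [measurable]: "jac \<in> borel_measurable borel"
  by (rule borel_measurable_continuous_onI[OF continuous_jac])

lemma jac_lift [simp]: "jac (lift z) = jac z" and cn_lift [simp]: "cn (lift z) = cn z"
  by (simp_all add: chart_jac_def chart_conormal_def chart_lift_def)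

lemma ht_has_derivative: "(ht has_derivative (\<lambda>h. cn x \<bullet> h)) (at x)"
proof -
  have "((\<lambda>x. s * (x $ k - \<gamma> x)) has_derivative (\<lambda>h. s * (h $ k - grad \<gamma> x \<bullet> h))) (at x)"
    by (intro has_derivative_mult_right has_derivative_diff \<gamma>_has_derivative
        bounded_linear_imp_has_derivative bounded_linear_vec_nth)
  then show ?thesis
    by (simp add: chart_height_def[abs_def] chart_conormal_def inner_diff_left inner_axis')
qed

lemma ht_C1: "C1_on UNIV UNIV ht"
proof -
  have "C1_on UNIV UNIV (\<lambda>x. s * (x $ k + (- 1) * \<gamma> x))"
    by (intro C1_on_mult C1_on_add C1_on_const C1_on_bounded_linear bounded_linear_vec_nth \<gamma>_C1)
  then show ?thesis by (simp add: chart_height_def[abs_def])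
qed

lemma continuous_ht: "continuous_on UNIV ht" using ht_C1 by (rule C1_on_continuous)

lemma ht_shift [simp]: "ht (z + y *\<^sub>R axis k 1) = ht z + s * y"
  by (simp add: chart_height_def axis_nth algebra_simps)

lemma ht_lift: "z $ k = 0 \<Longrightarrow> ht (lift z) = 0"
  by (simp add: chart_height_def chart_lift_def axis_nth)

text \<open>A chart describes only membership in \<Omega>. A point of negative height has a
  neighbourhood that misses \<Omega>; a point of height zero is not in \<Omega> but is approached
  from inside by moving it along axis \<open>k\<close>.\<close>

lemma frontier_iff:
  assumes "x \<in> W" shows "x \<in> frontier \<Omega> \<longleftrightarrow> ht x = 0"
proof
  assume x: "x \<in> frontier \<Omega>"
  then have "x \<notin> \<Omega>" using open_dom by (simp add: frontier_def interior_open)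
  then have le: "ht x \<le> 0" using mem_iff[OF assms] by simp
  have "\<not> ht x < 0"
  proof
    assume "ht x < 0"
    moreover have "open {y. ht y < 0}"
      using open_Collect_less[OF continuous_ht continuous_on_const[of _ 0]] by simp
    ultimately have "open (W \<inter> {y. ht y < 0})" "x \<in> W \<inter> {y. ht y < 0}" using open_W assms by auto
    moreover have "(W \<inter> {y. ht y < 0}) \<inter> \<Omega> = {}" using mem_iff by force
    moreover have "x \<in> closure \<Omega>" using x by (simp add: frontier_def)
    ultimately show False using open_Int_closure_eq_empty by blast
  qed
  then show "ht x = 0" using le by simp
next
  assume h: "ht x = 0"
  then have "x \<notin> \<Omega>" using mem_iff[OF assms] by simp
  moreover have "x \<in> closure \<Omega>"
  proof -
    \<comment> \<open>The factor \<open>s\<close> turns the shift to the side of \<Omega>: the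
      heights are \<open>inverse (real (Suc n))\<close>, whichever sign \<open>s\<close>
      has.\<close>
    let ?f = "\<lambda>n. x + (s * inverse (real (Suc n))) *\<^sub>R axis k 1"
    have "(\<lambda>n. x + (s * inverse (real (Suc n))) *\<^sub>R axis k 1) \<longlonglongrightarrow> x + (s * 0) *\<^sub>R axis k 1"
      by (intro tendsto_intros LIMSEQ_inverse_real_of_nat)
    then have lim: "?f \<longlonglongrightarrow> x" by simp
    have "\<forall>\<^sub>F n in sequentially. ?f n \<in> W" using lim open_W assms by (rule topological_tendstoD)
    then obtain N where N: "\<And>n. n \<ge> N \<Longrightarrow> ?f n \<in> W" unfolding eventually_sequentially by blast
    have "?f (n + N) \<in> \<Omega>" for n
      using mem_iff[OF N[of "n + N"]] h by simp
    moreover have "(\<lambda>n. ?f (n + N)) \<longlonglongrightarrow> x" using lim by (rule LIMSEQ_ignore_initial_segment)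
    ultimately show ?thesis unfolding closure_sequential by (intro exI[of _ "\<lambda>n. ?f (n + N)"]) simp
  qed
  ultimately show "x \<in> frontier \<Omega>" using open_dom by (simp add: frontier_def interior_open)
qed

end

text \<open>A unit vector is determined by its open half space. For different \<open>a\<close> and
  \<open>b\<close>, tilting \<open>- b\<close> slightly towards \<open>a\<close> gives a vector on
  the positive side of \<open>a\<close> and on the negative side of \<open>b\<close>.\<close>

lemma unit_vectors_eqI:
  fixes a b :: "'a::real_inner"
  assumes ab: "norm a = 1" "norm b = 1" and imp: "\<And>v. a \<bullet> v > 0 \<Longrightarrow> b \<bullet> v \<ge> 0"
  shows "a = b"
proof (rule ccontr)
  assume ne: "a \<noteq> b"
  define c where "c = a \<bullet> b"
  have aa: "a \<bullet> a = 1" "b \<bullet> b = 1" using ab by (simp_all add: norm_eq_1)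
  have "0 < (a - b) \<bullet> (a - b)" using ne by simp
  then have "c < 1" by (simp add: c_def aa inner_diff_left inner_diff_right inner_commute)
  \<comment> \<open>The midpoint of \<open>c\<close> and 1: larger than \<open>c\<close>, which
    gives a positive product with \<open>a\<close>, and small enough that
    \<open>\<alpha> * c < 1\<close>, which gives a negative product with \<open>b\<close>.\<close>
  define \<alpha> where "\<alpha> = (c + 1) / 2"
  have "a \<bullet> (\<alpha> *\<^sub>R a - b) = \<alpha> - c" by (simp add: inner_diff_right aa c_def)
  also have "\<alpha> - c > 0" using \<open>c < 1\<close> by (simp add: \<alpha>_def field_simps)
  finally have "b \<bullet> (\<alpha> *\<^sub>R a - b) \<ge> 0" by (rule imp)
  then have "\<alpha> * c - 1 \<ge> 0" by (simp add: inner_diff_right aa c_def inner_commute)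
  moreover have "\<alpha> * c < 1"
  proof -
    have "-1 \<le> c" using Cauchy_Schwarz_ineq2[of a b] ab by (simp add: c_def)
    then have "(1 - c) * (c + 2) > 0" using \<open>c < 1\<close> by (intro mult_pos_pos) auto
    then show ?thesis by (simp add: \<alpha>_def field_simps)
  qed
  ultimately show False by simp
qed

text \<open>If the first height strictly increases in direction \<open>v\<close>, the second cannot
  strictly decrease: shortly after \<open>x\<close> the same points would lie both inside and
  outside \<Omega>. The half spaces of the two conormals therefore agree, and so do the unit
  vectors.\<close>

lemma chart_normal_unique:
  assumes "graph_chart \<Omega> k s \<gamma> W" "graph_chart \<Omega> k' s' \<gamma>' W'"
    and x: "x \<in> frontier \<Omega>" "x \<in> W" "x \<in> W'"
  shows "chart_conormal k s \<gamma> x /\<^sub>R chart_jac \<gamma> x = chart_conormal k' s' \<gamma>' x /\<^sub>R chart_jac \<gamma>' x"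
proof -
  interpret a: graph_chart \<Omega> k s \<gamma> W by fact
  interpret b: graph_chart \<Omega> k' s' \<gamma>' W' by fact
  show ?thesis
  proof (rule unit_vectors_eqI)
    fix v assume "(a.cn x /\<^sub>R a.jac x) \<bullet> v > 0"
    then have pos: "a.cn x \<bullet> v > 0" using a.jac_pos[of x] by (simp add: zero_less_mult_iff)
    have line: "((\<lambda>t. x + t *\<^sub>R v) has_derivative (\<lambda>t. t *\<^sub>R v)) (at 0)"
      by (auto intro!: derivative_eq_intros)
    have "((\<lambda>t. a.ht (x + t *\<^sub>R v)) has_derivative (\<lambda>t. a.cn (x + 0 *\<^sub>R v) \<bullet> (t *\<^sub>R v))) (at 0)"
      by (rule has_derivative_compose[OF line a.ht_has_derivative])
    then have da: "((\<lambda>t. a.ht (x + t *\<^sub>R v)) has_real_derivative a.cn x \<bullet> v) (at 0)"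
      by (simp add: has_field_derivative_def mult.commute[of _ "a.cn x \<bullet> v"])
    have "((\<lambda>t. b.ht (x + t *\<^sub>R v)) has_derivative (\<lambda>t. b.cn (x + 0 *\<^sub>R v) \<bullet> (t *\<^sub>R v))) (at 0)"
      by (rule has_derivative_compose[OF line b.ht_has_derivative])
    then have db: "((\<lambda>t. b.ht (x + t *\<^sub>R v)) has_real_derivative b.cn x \<bullet> v) (at 0)"
      by (simp add: has_field_derivative_def mult.commute[of _ "b.cn x \<bullet> v"])
    have za: "a.ht x = 0" "b.ht x = 0" using x a.frontier_iff b.frontier_iff by auto
    have "b.cn x \<bullet> v \<ge> 0"
    proof (rule ccontr)
      assume "\<not> ?thesis"
      then obtain d2 where d2: "d2 > 0" "\<And>h. 0 < h \<Longrightarrow> h < d2 \<Longrightarrow> b.ht (x + h *\<^sub>R v) < 0"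
        using DERIV_neg_dec_right[OF db] za by auto
      obtain d1 where d1: "d1 > 0" "\<And>h. 0 < h \<Longrightarrow> h < d1 \<Longrightarrow> a.ht (x + h *\<^sub>R v) > 0"
        using DERIV_pos_inc_right[OF da pos] za by auto
      have "((\<lambda>h. x + h *\<^sub>R v) \<longlongrightarrow> x + 0 *\<^sub>R v) (at_right 0)" by (intro tendsto_intros)
      then have "\<forall>\<^sub>F h in at_right 0. x + h *\<^sub>R v \<in> W \<inter> W'"
        by (rule topological_tendstoD) (use x a.open_W b.open_W in auto)
      then have "\<forall>\<^sub>F h in at_right (0::real). x + h *\<^sub>R v \<in> W \<inter> W' \<and> h \<in> {0<..<min d1 d2}"
        by (rule eventually_conj) (use d1 d2 in \<open>simp add: eventually_at_right_field, auto intro: exI[of _ "min d1 d2"]\<close>)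
      then obtain h where h: "x + h *\<^sub>R v \<in> W \<inter> W'" "h \<in> {0<..<min d1 d2}"
        by (metis (no_types, lifting) eventually_happens' trivial_limit_at_right_real)
      show False using a.mem_iff[of "x + h *\<^sub>R v"] b.mem_iff[of "x + h *\<^sub>R v"] h d1(2)[of h] d2(2)[of h] by auto
    qed
    then show "(b.cn x /\<^sub>R b.jac x) \<bullet> v \<ge> 0" using b.jac_pos[of x] by simp
  qed (use a.norm_cn[of x] b.norm_cn[of x] a.jac_pos[of x] b.jac_pos[of x] in auto)
qed

context graph_chart begin

text \<open>Every chart around \<open>x\<close> proposes the same vector, so the definite
  description is meaningful and can be evaluated in whichever chart is at hand.\<close>

lemma outward_unit_normal_eq:
  assumes "x \<in> frontier \<Omega>" "x \<in> W"
  shows "outward_unit_normal \<Omega> x = - (cn x /\<^sub>R jac x)"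
  unfolding outward_unit_normal_def
proof (rule the_equality)
  show "\<exists>k s \<gamma> W. C2_graph_chart \<Omega> k s \<gamma> W \<and> x \<in> W \<and>
      - (cn x /\<^sub>R jac x) = - (s / sqrt (1 + (norm (grad \<gamma> x))\<^sup>2)) *\<^sub>R (axis k 1 - grad \<gamma> x)"
    using chart assms by (intro exI[of _ k] exI[of _ s] exI[of _ \<gamma>] exI[of _ W])
      (simp add: chart_conormal_def chart_jac_def divide_inverse mult.commute)
next
  fix \<nu> assume "\<exists>k s \<gamma> W. C2_graph_chart \<Omega> k s \<gamma> W \<and> x \<in> W \<and>
      \<nu> = - (s / sqrt (1 + (norm (grad \<gamma> x))\<^sup>2)) *\<^sub>R (axis k 1 - grad \<gamma> x)"
  then obtain k' s' \<gamma>' W' where c: "C2_graph_chart \<Omega> k' s' \<gamma>' W'" "x \<in> W'"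
      "\<nu> = - (s' / sqrt (1 + (norm (grad \<gamma>' x))\<^sup>2)) *\<^sub>R (axis k' 1 - grad \<gamma>' x)" by blast
  have "\<nu> = - (chart_conormal k' s' \<gamma>' x /\<^sub>R chart_jac \<gamma>' x)"
    unfolding c(3) by (simp add: chart_conormal_def chart_jac_def divide_inverse mult.commute)
  also have "\<dots> = - (cn x /\<^sub>R jac x)"
    using chart_normal_unique[of \<Omega> k s \<gamma> W k' s' \<gamma>' W' x] assms c graph_chart_axioms open_dom
    by (simp add: graph_chart_def)
  finally show "\<nu> = - (cn x /\<^sub>R jac x)" .
qed

section \<open>The boundary layer of one chart and its limit\<close>

abbreviation "ray m z \<tau> \<equiv> lift z + (s / real (Suc m) * \<tau>) *\<^sub>R axis k 1"

text \<open>Times \<open>cn x\<close> this is the gradient of the cutoff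
  \<open>step_fun (real (Suc m) * ht x)\<close>. On \<open>ray m z\<close> over a point with
  \<open>z $ k = 0\<close> the rescaled height is exactly the parameter \<tau>. Scaling by
  \<open>Suc m\<close> avoids a division by zero at index 0.\<close>

definition layer :: "nat \<Rightarrow> real^'n \<Rightarrow> real"
  where "layer m x = step_deriv (real (Suc m) * ht x) * real (Suc m)"

lemma continuous_layer: "continuous_on S (layer m)"
  unfolding layer_def
  by (intro continuous_intros continuous_on_subset[OF continuous_ht]) auto

lemma layer_measurable [measurable]: "layer m \<in> borel_measurable borel"
  by (intro borel_measurable_continuous_onI continuous_layer)

lemma layer_nonneg: "0 \<le> layer m x" by (simp add: layer_def step_deriv_nonneg)

text \<open>
  On the line through \<open>z\<close> in direction \<open>k\<close> the substitution \<open>y = \<gamma> z + s \<tau> / m\<close> turns the layer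
  into the fixed profile \<open>step_deriv\<close>.
\<close>

lemma
  fixes f :: "real^'n \<Rightarrow> real"
  assumes f: "continuous_on \<Omega> f" and K: "compact K" "K \<subseteq> W" "\<And>x. x \<in> \<Omega> - K \<Longrightarrow> f x = 0"
    and M: "0 \<le> M" "\<And>x. x \<in> \<Omega> \<Longrightarrow> \<bar>f x\<bar> \<le> M"
    and R: "\<And>x. x \<in> K \<Longrightarrow> norm x \<le> R"
  defines "\<Phi> \<equiv> \<lambda>m z. LINT \<tau>|lborel. (indicator \<Omega> (ray m z \<tau>) *
      f (ray m z \<tau>)) * step_deriv \<tau>"
  shows layer_integrable: "integrable lborel (\<lambda>x. indicator \<Omega> x * f x * layer m x)"
    and layer_integral: "(LINT x:\<Omega>|lborel. f x * layer m x) = (LINT z|hyp k. \<Phi> m z)"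
    and layer_slice_bound: "z $ k = 0 \<Longrightarrow> \<bar>\<Phi> m z\<bar> \<le> M * indicator (cball 0 R) z"
    and layer_slice_measurable: "\<Phi> m \<in> borel_measurable borel"
    and layer_bound: "\<bar>LINT x:\<Omega>|lborel. f x * layer m x\<bar> \<le> M * measure (hyp k) (cball 0 R)"
proof -
  let ?h = "\<lambda>x. indicator \<Omega> x * f x"
  have hm [measurable]: "?h \<in> borel_measurable borel"
    using borel_measurable_continuous_on_indicator[OF _ f] open_dom by simp
  have hb: "\<bar>?h x\<bar> \<le> M" for x using M by (auto simp: indicator_def)
  have hK: "?h x = 0" if "x \<notin> K" for x using K(3) that by (auto simp: indicator_def)
  obtain B where B: "B \<ge> 0" "\<And>y. step_deriv y \<le> B" using step_deriv_bounded by blast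
  have intK: "integrable lborel (\<lambda>x. M * (B * real (Suc m)) * indicator K x)" for m
    using K(1) emeasure_bounded_finite[OF compact_imp_bounded[OF K(1)]]
    by (intro integrable_mult_right integrable_real_indicator) (auto simp: compact_imp_closed)
  show int: "integrable lborel (\<lambda>x. ?h x * layer m x)" for m
  proof (rule Bochner_Integration.integrable_bound[OF intK[of m]])
    show "AE x in lborel. norm (?h x * layer m x) \<le> norm (M * (B * real (Suc m)) * indicator K x)"
    proof (rule AE_I2)
      fix x :: "real^'n"
      show "norm (?h x * layer m x) \<le> norm (M * (B * real (Suc m)) * indicator K x)"
      proof (cases "x \<in> K")
        case True
        have "\<bar>?h x * layer m x\<bar> = \<bar>?h x\<bar> * layer m x" by (simp add: abs_mult layer_nonneg)
        also have "\<dots> \<le> M * (B * real (Suc m))"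
          by (intro mult_mono hb) (auto simp: layer_def step_deriv_nonneg B M intro!: mult_right_mono)
        finally show ?thesis using True M B by simp
      qed (use hK[of x] in simp)
    qed
  qed measurable
  have slice: "(LINT y|lborel. ?h (z + y *\<^sub>R axis k 1) * layer m (z + y *\<^sub>R axis k 1)) = \<Phi> m z"
    if z: "z $ k = 0" for z m
  proof -
    \<comment> \<open>The modulus of the substitution factor cancels the factor
      \<open>real (Suc m)\<close> inside \<open>layer\<close>, so afterwards \<open>m\<close>
      survives only in the point of evaluation.\<close>
    have c: "s / real (Suc m) \<noteq> 0" "\<bar>s / real (Suc m)\<bar> * real (Suc m) = 1" using s_cases by auto
    have pt: "z + (\<gamma> z + s / real (Suc m) * \<tau>) *\<^sub>R axis k 1 = ray m z \<tau>" for \<tau>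
      by (simp add: chart_lift_def scaleR_add_left add.assoc)
    have ly: "layer m (ray m z \<tau>) = step_deriv \<tau> * real (Suc m)" for \<tau>
      using s_cases ht_lift[OF z] by (auto simp: layer_def simp del: of_nat_Suc)
    have "(LINT y|lborel. ?h (z + y *\<^sub>R axis k 1) * layer m (z + y *\<^sub>R axis k 1)) =
      \<bar>s / real (Suc m)\<bar> *\<^sub>R (LINT \<tau>|lborel. ?h (z + (\<gamma> z + s / real (Suc m) * \<tau>) *\<^sub>R axis k 1) *
        layer m (z + (\<gamma> z + s / real (Suc m) * \<tau>) *\<^sub>R axis k 1))"
      by (rule lborel_integral_real_affine[OF c(1)])
    also have "\<dots> = (LINT \<tau>|lborel. \<bar>s / real (Suc m)\<bar> * (?h (z + (\<gamma> z + s / real (Suc m) * \<tau>) *\<^sub>R axis k 1) *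
        layer m (z + (\<gamma> z + s / real (Suc m) * \<tau>) *\<^sub>R axis k 1)))"
      by (simp only: real_scaleR_def integral_mult_right_zero)
    also have "\<dots> = \<Phi> m z"
      unfolding \<Phi>_def pt ly
    proof (rule Bochner_Integration.integral_cong[OF refl])
      fix \<tau>
      have "\<bar>s / real (Suc m)\<bar> * (h * (d * real (Suc m))) = h * d" for h d
        using c(2) by (metis mult.assoc mult.commute mult_1)
      then show "\<bar>s / real (Suc m)\<bar> * (?h (ray m z \<tau>) * (step_deriv \<tau> * real (Suc m)))
        = ?h (ray m z \<tau>) * step_deriv \<tau>" .
    qed
    finally show ?thesis .
  qed
  show \<Phi>m: "\<Phi> m \<in> borel_measurable borel" for m
    unfolding \<Phi>_def by measurable
  have bnd: "\<bar>\<Phi> m z\<bar> \<le> M * indicator (cball 0 R) z" if z: "z $ k = 0" for z m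
  proof (cases "norm z \<le> R")
    case True
    have "\<bar>\<Phi> m z\<bar> \<le> (LINT \<tau>|lborel. M * step_deriv \<tau>)"
      unfolding \<Phi>_def
    proof (rule integral_abs_bound[THEN order_trans], rule integral_mono')
      show "integrable lborel (\<lambda>\<tau>. M * step_deriv \<tau>)" by (intro integrable_mult_right step_deriv_integral)
      show "0 \<le> M * step_deriv \<tau>" for \<tau> by (simp add: M step_deriv_nonneg)
      show "\<bar>?h (ray m z \<tau>) * step_deriv \<tau>\<bar> \<le> M * step_deriv \<tau>" for \<tau>
        unfolding abs_mult[of _ "step_deriv \<tau>"] abs_of_nonneg[OF step_deriv_nonneg]
        by (rule mult_right_mono[OF hb step_deriv_nonneg])
    qed
    then show ?thesis using True by (simp add: step_deriv_integral)
  next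
    case False
    \<comment> \<open>The ray projects orthogonally to \<open>z\<close>, so its points are at least
      as far from the origin as \<open>z\<close>; over a base point outside the ball it misses
      \<open>K\<close>.\<close>
    have "?h (ray m z \<tau>) = 0" for \<tau>
    proof (rule hK)
      have "norm z \<le> norm (ray m z \<tau>)"
        using hyperplane_norm_bounds(1)[OF z, of "\<gamma> z + s / real (Suc m) * \<tau>"]
        by (simp add: chart_lift_def scaleR_add_left add.assoc)
      then show "ray m z \<tau> \<notin> K" using R False by force
    qed
    then have "\<Phi> m z = 0" unfolding \<Phi>_def by (simp only: mult_zero_left integral_zero)
    then show ?thesis using False M by simp
  qed
  then show "z $ k = 0 \<Longrightarrow> \<bar>\<Phi> m z\<bar> \<le> M * indicator (cball 0 R) z" .
  have "(LINT x:\<Omega>|lborel. f x * layer m x) = (LINT x|lborel. ?h x * layer m x)" for m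
    by (simp add: set_lebesgue_integral_def mult.assoc)
  also have "\<dots> m = (LINT z|hyp k. LINT y|lborel. ?h (z + y *\<^sub>R axis k 1) * layer m (z + y *\<^sub>R axis k 1))" for m
    by (rule integral_hyperplane_fubini(2)[OF int])
  also have "\<dots> m = (LINT z|hyp k. \<Phi> m z)" for m
  proof (rule integral_cong_AE)
    show "AE z in hyp k. (LINT y|lborel. ?h (z + y *\<^sub>R axis k 1) * layer m (z + y *\<^sub>R axis k 1)) = \<Phi> m z"
      using hyperplane_lborel_AE[of k] by eventually_elim (rule slice)
  qed (use \<Phi>m in measurable)
  finally show eq: "(LINT x:\<Omega>|lborel. f x * layer m x) = (LINT z|hyp k. \<Phi> m z)" for m .
  have fin: "emeasure (hyp k) (cball 0 R) < \<infinity>" by (rule hyperplane_lborel_cball_finite)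
  have "\<bar>LINT z|hyp k. \<Phi> m z\<bar> \<le> (LINT z|hyp k. M * indicator (cball 0 R) z)"
  proof (rule integral_abs_bound[THEN order_trans], rule integral_mono_AE')
    show "integrable (hyp k) (\<lambda>z. M * indicator (cball 0 R) z)"
      using fin by (intro integrable_mult_right integrable_real_indicator) auto
    show "AE z in hyp k. \<bar>\<Phi> m z\<bar> \<le> M * indicator (cball 0 R) z"
      using hyperplane_lborel_AE[of k] by eventually_elim (rule bnd)
  qed (simp add: M)
  also have "\<dots> = M * measure (hyp k) (cball 0 R)" using fin by simp
  finally show "\<bar>LINT x:\<Omega>|lborel. f x * layer m x\<bar> \<le> M * measure (hyp k) (cball 0 R)"
    by (simp only: eq)
qed

text \<open>Dominated convergence twice: in \<tau> on a fixed line, where the rays shrink to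
  \<open>lift z\<close> and the profile has mass one, and then in \<open>z\<close>, where the slices
  are bounded by a multiple of the indicator of a ball.\<close>

lemma layer_limit:
  fixes f :: "real^'n \<Rightarrow> real"
  assumes f: "continuous_on (closure \<Omega>) f" and K: "compact K" "K \<subseteq> W" "\<And>x. x \<in> closure \<Omega> - K \<Longrightarrow> f x = 0"
  shows "(\<lambda>m. LINT x:\<Omega>|lborel. f x * layer m x) \<longlonglongrightarrow>
    (LINT z|hyp k. indicator (frontier \<Omega> \<inter> W) (lift z) * f (lift z))"
proof -
  let ?\<Phi> = "\<lambda>m z. LINT \<tau>|lborel. (indicator \<Omega> (ray m z \<tau>) *
      f (ray m z \<tau>)) * step_deriv \<tau>"
  have f': "continuous_on \<Omega> f" using f closure_subset by (rule continuous_on_subset)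
  have K': "x \<in> \<Omega> - K \<Longrightarrow> f x = 0" for x using K(3) closure_subset by auto
  have "compact (f ` (closure \<Omega> \<inter> K))"
    by (intro compact_continuous_image continuous_on_subset[OF f] closed_Int_compact K) auto
  then have "bounded (f ` (closure \<Omega> \<inter> K))" by (rule compact_imp_bounded)
  then obtain M0 where M0: "\<And>x. x \<in> closure \<Omega> \<inter> K \<Longrightarrow> \<bar>f x\<bar> \<le> M0"
    unfolding bounded_iff by auto
  define M where "M = max 0 M0"
  have M: "0 \<le> M" "\<And>x. x \<in> \<Omega> \<Longrightarrow> \<bar>f x\<bar> \<le> M"
  proof -
    show "\<bar>f x\<bar> \<le> M" if "x \<in> \<Omega>" for x
      using M0[of x] K'[of x] that closure_subset[of \<Omega>] by (cases "x \<in> K") (auto simp: M_def)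
  qed (simp add: M_def)
  obtain R where R: "\<And>x. x \<in> K \<Longrightarrow> norm x \<le> R"
    using compact_imp_bounded[OF K(1)] unfolding bounded_iff by blast
  note fact = f' K(1,2) K' M R
  have [measurable]: "?\<Phi> m \<in> borel_measurable borel" for m by (rule layer_slice_measurable[OF fact])
  have hm [measurable]: "(\<lambda>x. indicator \<Omega> x * f x) \<in> borel_measurable borel"
    using borel_measurable_continuous_on_indicator[OF _ f'] open_dom by simp
  have hb: "\<bar>indicator \<Omega> x * f x\<bar> \<le> M" for x using M by (auto simp: indicator_def)
  have fm [measurable]: "(\<lambda>x. indicator (frontier \<Omega>) x * f x) \<in> borel_measurable borel"
    using borel_measurable_continuous_on_indicator[of "frontier \<Omega>" f] continuous_on_subset[OF f, of "frontier \<Omega>"]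
    by (simp add: frontier_def)
  have lim_slice: "(\<lambda>m. ?\<Phi> m z) \<longlonglongrightarrow> indicator (frontier \<Omega> \<inter> W) (lift z) * f (lift z)"
    if z: "z $ k = 0" for z
  proof -
    let ?a = "indicator (frontier \<Omega> \<inter> W) (lift z) * f (lift z)"
    have "(\<lambda>m. ?\<Phi> m z) \<longlonglongrightarrow> (LINT \<tau>|lborel. ?a * step_deriv \<tau>)"
    proof (rule integral_dominated_convergence[where w = "\<lambda>\<tau>. M * step_deriv \<tau>"])
      show "integrable lborel (\<lambda>\<tau>. M * step_deriv \<tau>)" by (intro integrable_mult_right step_deriv_integral)
      show "AE \<tau> in lborel. norm ((indicator \<Omega> (ray m z \<tau>) *
          f (ray m z \<tau>)) * step_deriv \<tau>) \<le> M * step_deriv \<tau>" for m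
        using hb unfolding norm_mult by (intro AE_I2 mult_mono) (auto simp: M step_deriv_nonneg abs_mult)
      show "AE \<tau> in lborel. (\<lambda>m. (indicator \<Omega> (ray m z \<tau>) *
          f (ray m z \<tau>)) * step_deriv \<tau>) \<longlonglongrightarrow> ?a * step_deriv \<tau>"
      proof (rule AE_I2)
        fix \<tau> :: real
        let ?x = "\<lambda>m. ray m z \<tau>"
        show "(\<lambda>m. (indicator \<Omega> (?x m) * f (?x m)) * step_deriv \<tau>) \<longlonglongrightarrow> ?a * step_deriv \<tau>"
        \<comment> \<open>For positive \<tau> the ray has positive height, hence lies in \<Omega> as
          soon as it is in \<open>W\<close>; for the other \<tau> the profile is zero.\<close>
        proof (cases "\<tau> > 0")
          case False
          then show ?thesis by (simp add: step_deriv_eq_0)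
        next
          case True
          have "(\<lambda>m. lift z + (s * inverse (real (Suc m)) * \<tau>) *\<^sub>R axis k 1) \<longlonglongrightarrow> lift z + (s * 0 * \<tau>) *\<^sub>R axis k 1"
            by (intro tendsto_intros LIMSEQ_inverse_real_of_nat)
          then have xl: "?x \<longlonglongrightarrow> lift z" by (simp add: divide_inverse)
          have hx: "ht (?x m) > 0" for m
            using True ht_lift[OF z] by simp
          have "(\<lambda>m. indicator \<Omega> (?x m) * f (?x m)) \<longlonglongrightarrow> ?a"
          proof (cases "lift z \<in> W")
            case True
            have fr: "lift z \<in> frontier \<Omega>" using frontier_iff[OF True] ht_lift[OF z] by simp
            have "\<forall>\<^sub>F m in sequentially. ?x m \<in> W" using xl open_W True by (rule topological_tendstoD)
            then have ev: "\<forall>\<^sub>F m in sequentially. ?x m \<in> \<Omega>"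
              by eventually_elim (use mem_iff hx in blast)
            have "(\<lambda>m. f (?x m)) \<longlonglongrightarrow> f (lift z)"
              by (rule continuous_on_tendsto_compose[OF f xl])
                (use fr ev closure_subset in \<open>auto simp: frontier_def elim!: eventually_mono\<close>)
            moreover have "\<forall>\<^sub>F m in sequentially. f (?x m) = indicator \<Omega> (?x m) * f (?x m)"
              using ev by eventually_elim simp
            ultimately show ?thesis using True fr by (simp add: Lim_transform_eventually)
          next
            case False
            \<comment> \<open>Outside \<open>W\<close> the sign of the height says nothing about
              \<Omega>, but there \<open>lift z\<close> has a neighbourhood disjoint from the closed
              set \<open>K\<close>, and \<open>f\<close> vanishes on the part of \<Omega> outside
              \<open>K\<close>.\<close>
            have "\<forall>\<^sub>F m in sequentially. ?x m \<in> - K"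
              using xl by (rule topological_tendstoD) (use K False in \<open>auto simp: compact_imp_closed open_Compl\<close>)
            then have "\<forall>\<^sub>F m in sequentially. indicator \<Omega> (?x m) * f (?x m) = 0"
              by eventually_elim (use K' in \<open>auto simp: indicator_def\<close>)
            then show ?thesis using False by (simp add: tendsto_eventually)
          qed
          then show ?thesis by (rule tendsto_mult_right)
        qed
      qed
    qed measurable
    then show ?thesis by (simp add: step_deriv_integral)
  qed
  have "(\<lambda>m. LINT z|hyp k. ?\<Phi> m z) \<longlonglongrightarrow>
      (LINT z|hyp k. indicator (frontier \<Omega> \<inter> W) (lift z) * f (lift z))"
  proof (rule integral_dominated_convergence[where w = "\<lambda>z. M * indicator (cball 0 R) z"])
    show "integrable (hyp k) (\<lambda>z. M * indicator (cball 0 R) z)"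
      using hyperplane_lborel_cball_finite[of k R] by (intro integrable_mult_right integrable_real_indicator) auto
    show "AE z in hyp k. (\<lambda>m. ?\<Phi> m z) \<longlonglongrightarrow> indicator (frontier \<Omega> \<inter> W) (lift z) * f (lift z)"
      using hyperplane_lborel_AE[of k] by eventually_elim (rule lim_slice)
    show "AE z in hyp k. norm (?\<Phi> m z) \<le> M * indicator (cball 0 R) z" for m
      using hyperplane_lborel_AE[of k] by eventually_elim (simp only: real_norm_def layer_slice_bound[OF fact])
    \<comment> \<open>\<open>f\<close> is controlled only on the closure of \<Omega>. It has to be
      multiplied by the indicator of the boundary before it is a Borel function that can be composed
      with \<open>lift\<close>.\<close>
    have "(\<lambda>x. indicator W x * (indicator (frontier \<Omega>) x * f x)) \<in> borel_measurable borel"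
      using open_W by (intro borel_measurable_times fm borel_measurable_indicator) auto
    from measurable_compose[OF lift_measurable this]
    have "(\<lambda>z. indicator W (lift z) * (indicator (frontier \<Omega>) (lift z) * f (lift z))) \<in> borel_measurable borel" .
    also have "(\<lambda>z. indicator W (lift z) * (indicator (frontier \<Omega>) (lift z) * f (lift z))) =
        (\<lambda>z. indicator (frontier \<Omega> \<inter> W) (lift z) * f (lift z))"
      by (auto simp: indicator_def)
    finally show "(\<lambda>z. indicator (frontier \<Omega> \<inter> W) (lift z) * f (lift z)) \<in> borel_measurable (hyp k)"
      by simp
  qed simp
  then show ?thesis by (simp only: layer_integral[OF fact])
qed

end

section \<open>The surface measure\<close>

text \<open>Boxes are a generator stable under intersection, so it suffices to reach the indicator
  of each box as an increasing limit of C1 functions with values between 0 and 1.\<close>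

lemma measure_eqI_C1_test:
  fixes M N :: "'a::euclidean_space measure"
  assumes [measurable_cong, simp]: "sets M = sets borel" "sets N = sets borel"
    and fin: "emeasure M UNIV \<noteq> \<infinity>"
    and eq: "\<And>f. C1_on UNIV UNIV f \<Longrightarrow> (\<And>x. 0 \<le> f x) \<Longrightarrow> (\<And>x. f x \<le> 1) \<Longrightarrow>
      (\<integral>\<^sup>+x. ennreal (f x) \<partial>M) = (\<integral>\<^sup>+x. ennreal (f x) \<partial>N)"
  shows "M = N"
proof (rule measure_eqI_generator_eq[where \<Omega> = UNIV and E = "range (\<lambda>(a, b). box a b :: 'a set)"
      and A = "\<lambda>i::nat. box (- (real i *\<^sub>R One)) (real i *\<^sub>R One)"])
  show "sets M = sigma_sets UNIV (range (\<lambda>(a, b). box a b :: 'a set))"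
    "sets N = sigma_sets UNIV (range (\<lambda>(a, b). box a b :: 'a set))"
    by (simp_all add: borel_eq_box)
  show "Int_stable (range (\<lambda>(a, b). box a b :: 'a set))"
  proof -
    have "box X Y \<in> range (\<lambda>(a, b). box a b :: 'a set)" for X Y :: 'a
      using rangeI[of "\<lambda>(a, b). box a b" "(X, Y)"] by simp
    then show ?thesis by (auto simp: Int_stable_def box_Int_box)
  qed
  show "emeasure M (box (- (real i *\<^sub>R One)) (real i *\<^sub>R One)) \<noteq> \<infinity>" for i
    using fin emeasure_mono[of "box (- (real i *\<^sub>R One)) (real i *\<^sub>R One)" UNIV M] by (auto simp: top_unique)
  show "emeasure M X = emeasure N X" if "X \<in> range (\<lambda>(a, b). box a b)" for X
  proof -
    from that obtain a b where X: "X = box a b" by auto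
    \<comment> \<open>Each face contributes a factor that is positive exactly on its inner side, so
      the product is positive exactly on the open box.\<close>
    define F where "F x = (\<Prod>i\<in>Basis. pos_sq ((x - a) \<bullet> i) * pos_sq ((b - x) \<bullet> i))" for x
    have lin: "C1_on UNIV UNIV (\<lambda>x. (x - a) \<bullet> i)" "C1_on UNIV UNIV (\<lambda>x. (b - x) \<bullet> i)" for i
    proof -
      have "C1_on UNIV UNIV (\<lambda>x. x \<bullet> i + - (a \<bullet> i))"
        by (intro C1_on_add C1_on_const C1_on_bounded_linear bounded_linear_inner_left)
      then show "C1_on UNIV UNIV (\<lambda>x. (x - a) \<bullet> i)" by (simp add: inner_diff_left)
      have "C1_on UNIV UNIV (\<lambda>x. b \<bullet> i + (-1) * (x \<bullet> i))"
        by (intro C1_on_add C1_on_mult C1_on_const C1_on_bounded_linear bounded_linear_inner_left)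
      then show "C1_on UNIV UNIV (\<lambda>x. (b - x) \<bullet> i)" by (simp add: inner_diff_left)
    qed
    have FC: "C1_on UNIV UNIV F" unfolding F_def
      by (intro C1_on_prod C1_on_mult C1_on_pos_sq lin)
    have F0: "0 \<le> F x" for x by (simp add: F_def prod_nonneg)
    have Fpos: "F x > 0 \<longleftrightarrow> x \<in> box a b" for x
    proof -
      have "F x \<noteq> 0 \<longleftrightarrow> x \<in> box a b"
        by (auto simp: F_def pos_sq_eq_0_iff mem_box inner_diff_left not_le)
      then show ?thesis using F0[of x] by auto
    qed
    \<comment> \<open>\<open>n F / (1 + n F)\<close> increases to the indicator of \<open>{F > 0}\<close>, which is the box\<close>
    define f where "f n x = (real n * F x) * inverse (1 + real n * F x)" for n x
    have den: "1 + real n * F x > 0" for n x using F0[of x] by (simp add: add_pos_nonneg)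
    have fC: "C1_on UNIV UNIV (f n)" for n unfolding f_def
      by (intro C1_on_mult C1_on_inverse C1_on_add C1_on_const FC subset_UNIV) (rule less_imp_neq[OF den, symmetric])
    have fb: "0 \<le> f n x" "f n x \<le> 1" for n x
      using den[of n x] F0[of x] by (auto simp: f_def field_simps)
    have fm [measurable]: "f n \<in> borel_measurable borel" for n
      by (intro borel_measurable_continuous_onI C1_on_continuous[OF fC])
    have f_mono: "f n x \<le> f m x" if "n \<le> m" for n m x
    proof -
      have "f n x = 1 - inverse (1 + real n * F x)" for n
        using den[of n x] by (simp add: f_def field_simps)
      moreover have "inverse (1 + real m * F x) \<le> inverse (1 + real n * F x)"
        using that F0[of x] den[of n x] by (intro le_imp_inverse_le) (auto intro: mult_right_mono)
      ultimately show ?thesis by simp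
    qed
    have f_lim: "(\<lambda>n. f n x) \<longlonglongrightarrow> indicator (box a b) x" for x
    proof (cases "x \<in> box a b")
      case True
      then have "F x > 0" by (simp add: Fpos)
      have e: "f n x = 1 - inverse (1 + real n * F x)" for n
        using den[of n x] by (simp add: f_def field_simps)
      have "filterlim (\<lambda>n. 1 + real n * F x) at_top sequentially"
        by (intro filterlim_tendsto_add_at_top[OF tendsto_const]
            filterlim_at_top_mult_tendsto_pos[OF tendsto_const \<open>F x > 0\<close>] filterlim_real_sequentially)
      then have "(\<lambda>n. inverse (1 + real n * F x)) \<longlonglongrightarrow> 0" by (rule tendsto_inverse_0_at_top)
      then have "(\<lambda>n. 1 - inverse (1 + real n * F x)) \<longlonglongrightarrow> 1 - 0" by (intro tendsto_intros)
      then show ?thesis using True by (simp add: e)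
    next
      case False
      then have "F x = 0" using Fpos[of x] F0[of x] by auto
      then show ?thesis using False by (simp add: f_def)
    qed
    have lim: "(\<lambda>n. \<integral>\<^sup>+x. ennreal (f n x) \<partial>P) \<longlonglongrightarrow> emeasure P (box a b)" if "sets P = sets borel" for P
    proof -
      have "(\<lambda>n. \<integral>\<^sup>+x. ennreal (f n x) \<partial>P) \<longlonglongrightarrow> (\<integral>\<^sup>+x. ennreal (indicator (box a b) x) \<partial>P)"
      proof (rule nn_integral_LIMSEQ)
        show "incseq (\<lambda>n x. ennreal (f n x))"
          by (auto simp: incseq_def le_fun_def intro!: ennreal_leI f_mono)
        show "(\<lambda>x. ennreal (f n x)) \<in> borel_measurable P" for n
        proof -
          have [measurable_cong]: "sets P = sets borel" by fact
          show ?thesis by measurable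
        qed
        show "(\<lambda>n. ennreal (f n x)) \<longlonglongrightarrow> ennreal (indicator (box a b) x)" for x
          by (intro tendsto_ennrealI f_lim)
      qed
      then show ?thesis using that by (simp add: ennreal_indicator)
    qed
    have "(\<integral>\<^sup>+x. ennreal (f n x) \<partial>M) = (\<integral>\<^sup>+x. ennreal (f n x) \<partial>N)" for n
      by (rule eq[OF fC fb])
    then have "(\<lambda>n. \<integral>\<^sup>+x. ennreal (f n x) \<partial>M) \<longlonglongrightarrow> emeasure N (box a b)"
      using lim[of N] by simp
    then show ?thesis unfolding X using lim[of M] LIMSEQ_unique by simp
  qed
qed (auto simp: UN_box_eq_UNIV)

lemma continuous_compact_support_bounded:
  fixes f :: "'a::real_normed_vector \<Rightarrow> real"
  assumes "continuous_on S f" "compact K" "closed S" "\<And>x. x \<in> S - K \<Longrightarrow> f x = 0"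
  obtains M where "0 \<le> M" "\<And>x. x \<in> S \<Longrightarrow> \<bar>f x\<bar> \<le> M"
proof -
  have "compact (f ` (S \<inter> K))"
    by (intro compact_continuous_image continuous_on_subset[OF assms(1)] closed_Int_compact assms) auto
  then have "bounded (f ` (S \<inter> K))" by (rule compact_imp_bounded)
  then obtain M where M: "\<And>x. x \<in> S \<inter> K \<Longrightarrow> \<bar>f x\<bar> \<le> M" unfolding bounded_iff by auto
  show ?thesis
  proof (rule that[of "max 0 M"])
    show "\<bar>f x\<bar> \<le> max 0 M" if "x \<in> S" for x
      using M[of x] assms(4)[of x] that by (cases "x \<in> K") auto
  qed simp
qed

text \<open>Convergence is asked of the products with \<open>g\<close> and not of the multipliers,
  because a chart cutoff tends to 1 only inside the chart; in the applications \<open>g\<close>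
  vanishes elsewhere.\<close>

lemma set_integral_cutoff_limit:
  fixes g :: "'a::euclidean_space \<Rightarrow> real"
  assumes g: "set_integrable lborel S g"
    and c: "\<And>m. set_borel_measurable lborel S (c m)" "\<And>m x. x \<in> S \<Longrightarrow> \<bar>c m x\<bar> \<le> B"
    and lim: "\<And>x. x \<in> S \<Longrightarrow> (\<lambda>m. c m x * g x) \<longlonglongrightarrow> l x * g x" and S: "S \<in> sets borel" 
    and l: "set_borel_measurable lborel S l"
  shows "set_integrable lborel S (\<lambda>x. c m x * g x)"
    and "(\<lambda>m. LINT x:S|lborel. c m x * g x) \<longlonglongrightarrow> (LINT x:S|lborel. l x * g x)"
proof -
  let ?G = "\<lambda>x. indicator S x *\<^sub>R g x"
  have [measurable]: "(\<lambda>x. indicator S x *\<^sub>R g x) \<in> borel_measurable lborel"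
    "(\<lambda>x. indicator S x *\<^sub>R c m x) \<in> borel_measurable lborel"
    "(\<lambda>x. indicator S x *\<^sub>R l x) \<in> borel_measurable lborel" for m
    using g c(1) l by (auto simp: set_integrable_def set_borel_measurable_def)
  have eq: "(\<lambda>x. indicator S x *\<^sub>R (h x * g x)) = (\<lambda>x. (indicator S x *\<^sub>R h x) * (indicator S x *\<^sub>R g x))" for h :: "'a \<Rightarrow> real"
    by (auto simp: indicator_def fun_eq_iff)
  have m: "(\<lambda>x. indicator S x *\<^sub>R (c m x * g x)) \<in> borel_measurable lborel"
    "(\<lambda>x. indicator S x *\<^sub>R (l x * g x)) \<in> borel_measurable lborel" for m
    unfolding eq by measurable
  have w: "integrable lborel (\<lambda>x. B * \<bar>?G x\<bar>)"
    using g by (intro integrable_mult_right integrable_abs) (simp add: set_integrable_def)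
  have bd: "norm (indicator S x *\<^sub>R (c m x * g x)) \<le> B * \<bar>?G x\<bar>" for m x
    using c(2)[of x m] by (auto simp: indicator_def abs_mult intro!: mult_right_mono)
  show "set_integrable lborel S (\<lambda>x. c m x * g x)"
    unfolding set_integrable_def
    by (rule Bochner_Integration.integrable_bound[OF w m(1)])
      (rule AE_I2, rule order_trans[OF bd], simp)
  show "(\<lambda>m. LINT x:S|lborel. c m x * g x) \<longlonglongrightarrow> (LINT x:S|lborel. l x * g x)"
    unfolding set_lebesgue_integral_def
  proof (rule integral_dominated_convergence[OF m(2) m(1) w])
    show "AE x in lborel. (\<lambda>m. indicator S x *\<^sub>R (c m x * g x)) \<longlonglongrightarrow> indicator S x *\<^sub>R (l x * g x)"
      using lim by (intro AE_I2) (auto simp: indicator_def)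
  qed (use bd in auto)
qed

lemma set_borel_measurable_continuous_lborel:
  fixes f :: "'a::euclidean_space \<Rightarrow> real"
  assumes "continuous_on S f" "S \<in> sets borel" shows "set_borel_measurable lborel S f"
  using borel_measurable_continuous_on_indicator[OF assms(2,1)] by (simp add: set_borel_measurable_def)

section \<open>The divergence theorem in one chart\<close>

context graph_chart begin

lemma layer_cutoff_derivative:
  "((\<lambda>x. step_fun (real (Suc m) * ht x)) has_derivative (\<lambda>h. (layer m x *\<^sub>R cn x) \<bullet> h)) (at x)"
proof -
  have "((\<lambda>x. real (Suc m) * ht x) has_derivative (\<lambda>h. real (Suc m) * (cn x \<bullet> h))) (at x)"
    by (intro has_derivative_mult_right ht_has_derivative)
  from has_derivative_compose[OF this step_fun_has_derivative[unfolded has_field_derivative_def]]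
  show ?thesis by (simp add: layer_def mult.assoc)
qed

lemma cutoff_limit:
  assumes "x \<in> \<Omega>" "x \<in> W"
  shows "(\<lambda>m. step_fun (real (Suc m) * ht x)) \<longlonglongrightarrow> 1"
proof -
  have pos: "ht x > 0" using mem_iff assms by simp
  obtain N where N: "2 / ht x < real N" using reals_Archimedean2 by blast
  have "step_fun (real (Suc m) * ht x) = 1" if "m \<ge> N" for m
  proof (rule step_fun_eq_1)
    have "2 / ht x \<le> real (Suc m)" using N that by simp
    then show "2 \<le> real (Suc m) * ht x" using pos by (simp add: field_simps)
  qed
  then show ?thesis by (intro tendsto_eventually) (auto simp: eventually_sequentially)
qed

text \<open>Where the step is nonzero, the height is at least \<open>1 / real (Suc m)\<close>. This
  closed condition separates the support from the boundary, and inside \<open>W\<close> it forces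
  membership in \<Omega>.\<close>

lemma cutoff_support:
  assumes "compact K" "K \<subseteq> W"
  shows "compact (K \<inter> {x. 1 \<le> real (Suc m) * ht x})" "K \<inter> {x. 1 \<le> real (Suc m) * ht x} \<subseteq> \<Omega>"
proof -
  have "closed {x. 1 \<le> real (Suc m) * ht x}"
    by (intro closed_Collect_le continuous_intros continuous_ht)
  then show "compact (K \<inter> {x. 1 \<le> real (Suc m) * ht x})" using assms by (intro compact_Int_closed)
  show "K \<inter> {x. 1 \<le> real (Suc m) * ht x} \<subseteq> \<Omega>"
  proof
    fix x assume "x \<in> K \<inter> {x. 1 \<le> real (Suc m) * ht x}"
    then have "x \<in> W" "1 \<le> real (Suc m) * ht x" using assms by auto
    then have "real (Suc m) * ht x > 0" by linarith
    then have "ht x > 0" by (rule zero_less_mult_pos) simp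
    then show "x \<in> \<Omega>" using mem_iff[OF \<open>x \<in> W\<close>] by simp
  qed
qed

text \<open>
  The integral of the derivative over \<open>\<Omega>\<close> does not refer to the chart; this is what makes the
  surface measures of two charts agree.
\<close>

lemma integral_pderiv_chart:
  fixes f :: "real^'n \<Rightarrow> real"
  assumes f: "C1_on UNIV UNIV f" and K: "compact K" "K \<subseteq> W" "\<And>x. x \<notin> K \<Longrightarrow> f x = 0"
  shows "(LINT x:\<Omega>|lborel. grad f x $ i) =
    - (LINT z|hyp k. indicator (frontier \<Omega> \<inter> W) (lift z) * (f (lift z) * cn z $ i))"
proof -
  have fc: "continuous_on UNIV f" using f by (rule C1_on_continuous)
  have gc: "continuous_on UNIV (grad f)" and fd: "(f has_derivative (\<lambda>h. grad f x \<bullet> h)) (at x)" for x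
    using C1_on_open_grad[OF f] by auto
  have gK: "grad f x = 0" if "x \<notin> K" for x
  proof -
    have "(f has_derivative (\<lambda>h. 0 \<bullet> h)) (at x)"
    proof (rule has_derivative_transform_within_open[of "\<lambda>_. 0" _ _ _ "-K"])
      show "open (-K)" using K(1) by (simp add: compact_imp_closed open_Compl)
    qed (use that K in auto)
    then show ?thesis by (rule grad_unique)
  qed
  let ?a = "\<lambda>m x. (f x * cn x $ i) * layer m x" and ?b = "\<lambda>m x. step_fun (real (Suc m) * ht x) * grad f x $ i"
  have fcn: "continuous_on S (\<lambda>x. f x * cn x $ i)" for S
    by (rule continuous_on_subset[of UNIV]) (auto intro!: continuous_intros fc continuous_cn)
  obtain M where M: "0 \<le> M" "\<And>x. x \<in> UNIV \<Longrightarrow> \<bar>f x * cn x $ i\<bar> \<le> M"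
    using continuous_compact_support_bounded[OF fcn[of UNIV] K(1)] K(3) by auto
  obtain R where R: "\<And>x. x \<in> K \<Longrightarrow> norm x \<le> R"
    using compact_imp_bounded[OF K(1)] unfolding bounded_iff by blast
  have ia: "set_integrable lborel \<Omega> (?a m)" for m
    unfolding set_integrable_def
    using layer_integrable[OF fcn K(1,2) _ M(1) _ R, of m] K(3) M(2) by (simp add: mult.assoc)
  have "integrable lborel (\<lambda>x. grad f x $ i)"
    by (rule integrable_continuous_compact_support[OF _ K(1)]) (auto intro!: continuous_intros gc simp: gK)
  then have ig: "set_integrable lborel \<Omega> (\<lambda>x. grad f x $ i)"
    unfolding set_integrable_def using open_dom by (intro integrable_mult_indicator) auto
  have cm: "set_borel_measurable lborel \<Omega> (\<lambda>x. step_fun (real (Suc m) * ht x))" for m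
    using open_dom by (intro set_borel_measurable_continuous_lborel continuous_intros continuous_on_subset[OF continuous_ht]) auto
  have lim1: "(\<lambda>m. step_fun (real (Suc m) * ht x) * grad f x $ i) \<longlonglongrightarrow> 1 * grad f x $ i" if "x \<in> \<Omega>" for x
  proof (cases "x \<in> K")
    case True
    then show ?thesis using K(2) by (intro tendsto_mult[OF cutoff_limit[OF that] tendsto_const]) auto
  qed (simp add: gK)
  have l1: "set_borel_measurable lborel \<Omega> (\<lambda>x. 1::real)"
    using open_dom by (intro set_borel_measurable_continuous_lborel) auto
  note lim = set_integral_cutoff_limit[OF ig cm _ lim1 _ l1, of "1"]
  have ib: "set_integrable lborel \<Omega> (?b m)" for m
    by (rule lim(1)) (use step_fun_bounds open_dom in auto)
  have limb: "(\<lambda>m. LINT x:\<Omega>|lborel. ?b m x) \<longlonglongrightarrow> (LINT x:\<Omega>|lborel. 1 * grad f x $ i)"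
    by (rule lim(2)) (use step_fun_bounds open_dom in auto)
  \<comment> \<open>The product of \<open>f\<close> with the cutoff has compact support in \<Omega>,
    so its derivative integrates to zero; the product rule splits this into the layer part and the
    cut-off gradient.\<close>
  have zero: "(LINT x:\<Omega>|lborel. ?a m x) + (LINT x:\<Omega>|lborel. ?b m x) = 0" for m
  proof -
    have "(LINT x:\<Omega>|lborel. f x * ((layer m x *\<^sub>R cn x) \<bullet> axis i 1) + (grad f x \<bullet> axis i 1) * step_fun (real (Suc m) * ht x)) = 0"
    proof (rule integral_pderiv_compact_support[where K = "K \<inter> {x. 1 \<le> real (Suc m) * ht x}" and F = "\<lambda>x. f x * step_fun (real (Suc m) * ht x)"])
      show "((\<lambda>x. f x * step_fun (real (Suc m) * ht x)) has_derivative
          (\<lambda>h. f x * ((layer m x *\<^sub>R cn x) \<bullet> h) + (grad f x \<bullet> h) * step_fun (real (Suc m) * ht x))) (at x)" for x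
        by (rule has_derivative_mult[OF fd layer_cutoff_derivative])
      show "continuous_on \<Omega> (\<lambda>x. f x * ((layer m x *\<^sub>R cn x) \<bullet> axis i 1) + (grad f x \<bullet> axis i 1) * step_fun (real (Suc m) * ht x))"
        by (rule continuous_on_subset[of UNIV])
          (auto intro!: continuous_intros fc gc continuous_cn continuous_layer continuous_ht)
      show "f x * step_fun (real (Suc m) * ht x) = 0" if "x \<in> \<Omega> - K \<inter> {x. 1 \<le> real (Suc m) * ht x}" for x
        using that K(3)[of x] step_fun_eq_0[of "real (Suc m) * ht x"] by (cases "x \<in> K") auto
    qed (use open_dom cutoff_support[OF K(1,2)] in auto)
    moreover have "f x * ((layer m x *\<^sub>R cn x) \<bullet> axis i 1) + (grad f x \<bullet> axis i 1) * step_fun (real (Suc m) * ht x) = ?a m x + ?b m x" for x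
      by (simp add: inner_axis)
    ultimately have "(LINT x:\<Omega>|lborel. ?a m x + ?b m x) = 0" by simp
    then show ?thesis using set_integral_add(2)[OF ia ib] by simp
  qed
  have lima: "(\<lambda>m. LINT x:\<Omega>|lborel. ?a m x) \<longlonglongrightarrow>
      (LINT z|hyp k. indicator (frontier \<Omega> \<inter> W) (lift z) * (f (lift z) * cn (lift z) $ i))"
    using K by (intro layer_limit[OF fcn]) auto
  have "(\<lambda>m. (LINT x:\<Omega>|lborel. ?a m x) + (LINT x:\<Omega>|lborel. ?b m x)) \<longlonglongrightarrow>
     (LINT z|hyp k. indicator (frontier \<Omega> \<inter> W) (lift z) * (f (lift z) * cn (lift z) $ i)) +
      (LINT x:\<Omega>|lborel. 1 * grad f x $ i)"
    by (rule tendsto_add[OF lima limb])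
  \<comment> \<open>The sum is zero for every \<open>m\<close>, so the two limits are opposite. The
    minus sign reflects that the conormal points inward.\<close>
  then show ?thesis unfolding zero by (simp add: LIMSEQ_const_iff)
qed

end

text \<open>Since \<open>\<gamma>\<close> is defined on the whole hyperplane, this is the area
  measure of the entire graph; it describes the boundary of \<Omega> only inside
  \<open>W\<close>.\<close>

definition chart_measure :: "'n::finite \<Rightarrow> (real^'n \<Rightarrow> real) \<Rightarrow> (real^'n) measure"
  where "chart_measure k \<gamma> =
    distr (density (hyp k) (\<lambda>z. ennreal (chart_jac \<gamma> z))) borel (chart_lift k \<gamma>)"

lemma sets_chart_measure [simp, measurable_cong]: "sets (chart_measure k \<gamma>) = sets borel"
  by (simp add: chart_measure_def)

lemma space_chart_measure [simp]: "space (chart_measure k \<gamma>) = UNIV"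
  by (simp add: chart_measure_def)

text \<open>Inside \<open>pos_sq\<close> stands a polynomial in the coordinates, positive exactly on
  the ball. These bumps serve as localising weights, in the partition of unity and as test functions
  in time.\<close>

lemma bump_C1:
  fixes c :: "'a::euclidean_space"
  shows "C1_on UNIV UNIV (\<lambda>x. pos_sq (r\<^sup>2 - (norm (x - c))\<^sup>2))"
    and "0 < r \<Longrightarrow> 0 < pos_sq (r\<^sup>2 - (norm (x - c))\<^sup>2) \<longleftrightarrow> x \<in> ball c r"
proof -
  have "C1_on UNIV UNIV (\<lambda>x. r\<^sup>2 + (-1) * (\<Sum>i\<in>Basis. (x \<bullet> i + - (c \<bullet> i)) * (x \<bullet> i + - (c \<bullet> i))))"
    by (intro C1_on_add C1_on_mult C1_on_const C1_on_sum C1_on_bounded_linear bounded_linear_inner_left)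
  moreover have "(norm (x - c))\<^sup>2 = (\<Sum>i\<in>Basis. (x \<bullet> i + - (c \<bullet> i)) * (x \<bullet> i + - (c \<bullet> i)))" for x
    unfolding power2_norm_eq_inner by (subst euclidean_inner) (simp add: inner_diff_left)
  ultimately show "C1_on UNIV UNIV (\<lambda>x. pos_sq (r\<^sup>2 - (norm (x - c))\<^sup>2))"
    by (intro C1_on_pos_sq) simp
  show "0 < pos_sq (r\<^sup>2 - (norm (x - c))\<^sup>2) \<longleftrightarrow> x \<in> ball c r" if "0 < r"
  proof -
    have "r\<^sup>2 \<le> (norm (x - c))\<^sup>2 \<longleftrightarrow> r \<le> norm (x - c)" using that by (intro power_mono_iff) auto
    then have "(norm (x - c))\<^sup>2 < r\<^sup>2 \<longleftrightarrow> norm (x - c) < r" by (metis not_le)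
    then show ?thesis by (simp add: pos_sq_pos_iff dist_norm norm_minus_commute)
  qed
qed

context graph_chart begin

lemma nn_integral_chart_measure:
  assumes [measurable]: "f \<in> borel_measurable borel"
  shows "(\<integral>\<^sup>+x. f x \<partial>chart_measure k \<gamma>) = (\<integral>\<^sup>+z. ennreal (jac z) * f (lift z) \<partial>hyp k)"
  unfolding chart_measure_def by (subst nn_integral_distr) (auto simp: nn_integral_density)

lemma emeasure_chart_measure:
  assumes "A \<in> sets borel"
  shows "emeasure (chart_measure k \<gamma>) A =
    (\<integral>\<^sup>+z. indicator A (z + \<gamma> z *\<^sub>R axis k 1) * ennreal (sqrt (1 + (norm (grad \<gamma> z))\<^sup>2)) \<partial>hyp k)"
  using nn_integral_chart_measure[of "indicator A"] assms
  by (simp add: chart_lift_def chart_jac_def mult.commute)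

lemma lift_in_K_imp_cball:
  assumes "\<And>x. x \<in> K \<Longrightarrow> norm x \<le> R" "z $ k = 0" "lift z \<in> K" shows "z \<in> cball 0 R"
  using hyperplane_norm_bounds(1)[OF assms(2), of "\<gamma> z"] assms(1)[OF assms(3)]
  by (simp add: chart_lift_def)

lemma integrable_lift:
  fixes g :: "real^'n \<Rightarrow> real"
  assumes "continuous_on UNIV g" "compact K" "\<And>x. x \<notin> K \<Longrightarrow> g x = 0" "A \<in> sets borel"
  shows "integrable (hyp k) (\<lambda>z. indicator A (lift z) * g (lift z))"
proof -
  obtain M where M: "0 \<le> M" "\<And>x. x \<in> UNIV \<Longrightarrow> \<bar>g x\<bar> \<le> M"
    using continuous_compact_support_bounded[OF assms(1,2)] assms(3) by auto
  obtain R where R: "\<And>x. x \<in> K \<Longrightarrow> norm x \<le> R"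
    using compact_imp_bounded[OF assms(2)] unfolding bounded_iff by blast
  have "integrable (hyp k) (\<lambda>z. M * indicator (cball 0 R) z)"
    using hyperplane_lborel_cball_finite[of k R] by (intro integrable_mult_right integrable_real_indicator) auto
  then show ?thesis
  proof (rule Bochner_Integration.integrable_bound)
    have "(\<lambda>x. indicator A x * g x) \<in> borel_measurable borel"
      using borel_measurable_continuous_onI[OF assms(1)] assms(4) by measurable
    from measurable_compose[OF lift_measurable this]
    show "(\<lambda>z. indicator A (lift z) * g (lift z)) \<in> borel_measurable (hyp k)" by simp
    show "AE z in hyp k. norm (indicator A (lift z) * g (lift z)) \<le> norm (M * indicator (cball 0 R) z)"
      using hyperplane_lborel_AE[of k]
    proof eventually_elim
      case (elim z)
      show ?case
      proof (cases "lift z \<in> K")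
        case True
        then show ?thesis using lift_in_K_imp_cball[OF R elim True] M(2)[of "lift z"] M(1)
          by (simp add: abs_mult indicator_def)
      qed (simp add: assms(3))
    qed
  qed
qed

end

text \<open>Multiplied by \<open>- s\<close>, both sides become the integral of the
  \<open>k\<close>-th partial derivative of \<open>f\<close> over \<Omega>. The area element of the
  first chart is absent on the left because the \<open>k\<close>-th component of its conormal is
  just \<open>s\<close>; on the right it appears as a divisor.\<close>

lemma chart_integral_consistent:
  fixes f :: "real^'n::finite \<Rightarrow> real"
  assumes "graph_chart \<Omega> k s \<gamma> W" "graph_chart \<Omega> k' s' \<gamma>' W'"
    and f: "C1_on UNIV UNIV f" and K: "compact K" "K \<subseteq> W \<inter> W'" "\<And>x. x \<notin> K \<Longrightarrow> f x = 0"
  shows "(LINT z|hyp k. indicator (frontier \<Omega>) (chart_lift k \<gamma> z) * f (chart_lift k \<gamma> z)) =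
    (LINT z|hyp k'. indicator (frontier \<Omega>) (chart_lift k' \<gamma>' z) *
      (f (chart_lift k' \<gamma>' z) * (chart_jac \<gamma>' (chart_lift k' \<gamma>' z) / chart_jac \<gamma> (chart_lift k' \<gamma>' z))))"
proof -
  interpret a: graph_chart \<Omega> k s \<gamma> W by fact
  interpret b: graph_chart \<Omega> k' s' \<gamma>' W' by fact
  \<comment> \<open>the \<open>k\<close>-th component is the one in which the conormal of the first chart is constant\<close>
  let ?I = "LINT x:\<Omega>|lborel. grad f x $ k"
  have K': "K \<subseteq> W" "K \<subseteq> W'" using K(2) by auto
  have "?I = - (LINT z|hyp k. indicator (frontier \<Omega> \<inter> W) (a.lift z) * (f (a.lift z) * a.cn z $ k))"
    by (rule a.integral_pderiv_chart[OF f K(1) K'(1) K(3)])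
  also have "(\<lambda>z. indicator (frontier \<Omega> \<inter> W) (a.lift z) * (f (a.lift z) * a.cn z $ k)) =
      (\<lambda>z. (indicator (frontier \<Omega>) (a.lift z) * f (a.lift z)) * s)"
    using K' K(3) by (force simp: fun_eq_iff indicator_def)
  finally have 1: "?I = - s * (LINT z|hyp k. indicator (frontier \<Omega>) (a.lift z) * f (a.lift z))"
    unfolding integral_mult_left_zero by (simp only: mult_minus_left mult.commute)
  have "?I = - (LINT z|hyp k'. indicator (frontier \<Omega> \<inter> W') (b.lift z) * (f (b.lift z) * b.cn z $ k))"
    by (rule b.integral_pderiv_chart[OF f K(1) K'(2) K(3)])
  also have "(\<lambda>z. indicator (frontier \<Omega> \<inter> W') (b.lift z) * (f (b.lift z) * b.cn z $ k)) =
      (\<lambda>z. (indicator (frontier \<Omega>) (b.lift z) * (f (b.lift z) * (b.jac (b.lift z) / a.jac (b.lift z)))) * s)"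
  proof
    fix z
    let ?x = "b.lift z"
    show "indicator (frontier \<Omega> \<inter> W') ?x * (f ?x * b.cn z $ k) =
      (indicator (frontier \<Omega>) ?x * (f ?x * (b.jac ?x / a.jac ?x))) * s"
    proof (cases "?x \<in> K \<and> ?x \<in> frontier \<Omega>")
      case True
      then have x: "?x \<in> frontier \<Omega>" "?x \<in> W" "?x \<in> W'" using K' by auto
      have "a.cn ?x /\<^sub>R a.jac ?x = b.cn ?x /\<^sub>R b.jac ?x"
        by (rule chart_normal_unique[OF assms(1,2) x])
      then have "(a.cn ?x /\<^sub>R a.jac ?x) $ k = (b.cn ?x /\<^sub>R b.jac ?x) $ k" by simp
      \<comment> \<open>Equality of the unit normals, read in component \<open>k\<close>: the second
        conormal is the first one rescaled by the quotient of the area elements.\<close>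
      then have "b.cn z $ k = s * b.jac ?x / a.jac ?x"
        using a.jac_pos[of ?x] b.jac_pos[of z] by (simp add: field_simps)
      then show ?thesis using x by simp
    qed (use K(3) in \<open>auto simp: indicator_def\<close>)
  qed
  finally have 2: "?I = - s * (LINT z|hyp k'. indicator (frontier \<Omega>) (b.lift z) * (f (b.lift z) * (b.jac (b.lift z) / a.jac (b.lift z))))"
    unfolding integral_mult_left_zero by (simp only: mult_minus_left mult.commute)
  show ?thesis using 1 2 a.s_cases by auto
qed

text \<open>A common weight, supported in a ball inside both charts, makes both measures finite with
  the same integrals of C1 functions, hence equal. The weight is positive on \<open>A\<close> and
  can be divided out again.\<close>

lemma chart_measure_consistent_ball:
  fixes A :: "(real^'n::finite) set"
  assumes "graph_chart \<Omega> k s \<gamma> W" "graph_chart \<Omega> k' s' \<gamma>' W'"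
    and A: "A \<in> sets borel" "A \<subseteq> frontier \<Omega> \<inter> ball c r" and r: "0 < r" "cball c r \<subseteq> W \<inter> W'"
  shows "emeasure (chart_measure k \<gamma>) A = emeasure (chart_measure k' \<gamma>') A"
proof -
  interpret a: graph_chart \<Omega> k s \<gamma> W by fact
  interpret b: graph_chart \<Omega> k' s' \<gamma>' W' by fact
  define \<phi> where "\<phi> x = pos_sq (r\<^sup>2 - (norm (x - c))\<^sup>2)" for x
  have \<phi>C: "C1_on UNIV UNIV \<phi>" unfolding \<phi>_def by (rule bump_C1)
  have \<phi>c: "continuous_on UNIV \<phi>" using \<phi>C by (rule C1_on_continuous)
  have \<phi>0: "0 \<le> \<phi> x" for x by (simp add: \<phi>_def)
  have \<phi>pos: "0 < \<phi> x \<longleftrightarrow> x \<in> ball c r" for x unfolding \<phi>_def by (rule bump_C1(2)[OF r(1)])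
  have \<phi>K: "\<phi> x = 0" if "x \<notin> cball c r" for x using \<phi>pos[of x] \<phi>0[of x] that by auto
  note [measurable] = borel_measurable_continuous_onI[OF \<phi>c]
  have fr [measurable]: "frontier \<Omega> \<in> sets borel" by simp
  let ?i = "indicator (frontier \<Omega>) :: real^'n \<Rightarrow> real"
  \<comment> \<open>The divisor \<open>a.jac\<close> cancels the area element of the first chart
    measure and leaves precisely the integrals compared in
    \<open>chart_integral_consistent\<close>.\<close>
  let ?w = "\<lambda>x. ?i x * (\<phi> x / a.jac x)"
  let ?IM = "\<lambda>f. LINT z|hyp k. ?i (a.lift z) * (\<phi> (a.lift z) * f (a.lift z))"
  let ?IN = "\<lambda>f. LINT z|hyp k'. ?i (b.lift z) * ((\<phi> (b.lift z) * f (b.lift z)) * (b.jac (b.lift z) / a.jac (b.lift z)))"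
  define M where "M = density (chart_measure k \<gamma>) (\<lambda>x. ennreal (?w x))"
  define N where "N = density (chart_measure k' \<gamma>') (\<lambda>x. ennreal (?w x))"
  have [measurable]: "(\<lambda>x. ennreal (?w x)) \<in> borel_measurable borel"
    by measurable
  have w0: "0 \<le> ?w x" for x
    using a.jac_pos[of x] \<phi>0[of x] by (simp add: zero_le_mult_iff)
  have e3: "ennreal a * (ennreal w * ennreal g) = ennreal (a * (w * g))" if "0 \<le> a" "0 \<le> w" "0 \<le> g" for a w g
    using that by (simp add: ennreal_mult)
  have intM: "(\<integral>\<^sup>+x. ennreal (f x) \<partial>M) = ennreal (?IM f)"
    and intN: "(\<integral>\<^sup>+x. ennreal (f x) \<partial>N) = ennreal (?IN f)"
    if f: "C1_on UNIV UNIV f" "\<And>x. 0 \<le> f x" for f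
  proof -
    have fc: "continuous_on UNIV f" using f(1) by (rule C1_on_continuous)
    note [measurable] = borel_measurable_continuous_onI[OF fc]
    have "(\<integral>\<^sup>+x. ennreal (f x) \<partial>M) = (\<integral>\<^sup>+z. ennreal (a.jac z) * (ennreal (?w (a.lift z)) * ennreal (f (a.lift z))) \<partial>hyp k)"
      unfolding M_def by (subst nn_integral_density, measurable, subst a.nn_integral_chart_measure) auto
    also have "\<dots> = (\<integral>\<^sup>+z. ennreal (?i (a.lift z) * (\<phi> (a.lift z) * f (a.lift z))) \<partial>hyp k)"
    proof (rule nn_integral_cong)
      fix z
      show "ennreal (a.jac z) * (ennreal (?w (a.lift z)) * ennreal (f (a.lift z))) =
        ennreal (?i (a.lift z) * (\<phi> (a.lift z) * f (a.lift z)))"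
        unfolding e3[OF less_imp_le[OF a.jac_pos] w0 f(2)] using a.jac_pos[of z] by (simp add: mult.assoc)
    qed
    also have "\<dots> = ennreal (?IM f)"
      by (intro nn_integral_eq_integral a.integrable_lift[OF _ compact_cball, of "\<lambda>x. \<phi> x * f x" c r])
        (auto intro!: continuous_intros \<phi>c fc simp: \<phi>K \<phi>0 f)
    finally show "(\<integral>\<^sup>+x. ennreal (f x) \<partial>M) = ennreal (?IM f)" .
    have "(\<integral>\<^sup>+x. ennreal (f x) \<partial>N) = (\<integral>\<^sup>+z. ennreal (b.jac z) * (ennreal (?w (b.lift z)) * ennreal (f (b.lift z))) \<partial>hyp k')"
      unfolding N_def by (subst nn_integral_density, measurable, subst b.nn_integral_chart_measure) auto
    also have "\<dots> = (\<integral>\<^sup>+z. ennreal (?i (b.lift z) * ((\<phi> (b.lift z) * f (b.lift z)) * (b.jac (b.lift z) / a.jac (b.lift z)))) \<partial>hyp k')"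
    proof (rule nn_integral_cong)
      fix z
      show "ennreal (b.jac z) * (ennreal (?w (b.lift z)) * ennreal (f (b.lift z))) =
        ennreal (?i (b.lift z) * ((\<phi> (b.lift z) * f (b.lift z)) * (b.jac (b.lift z) / a.jac (b.lift z))))"
        unfolding e3[OF less_imp_le[OF b.jac_pos] w0 f(2)] by (simp add: mult_ac)
    qed
    also have "\<dots> = ennreal (?IN f)"
    proof (intro nn_integral_eq_integral b.integrable_lift[OF _ compact_cball, of "\<lambda>x. \<phi> x * f x * (b.jac x / a.jac x)" c r])
      show "continuous_on UNIV (\<lambda>x. \<phi> x * f x * (b.jac x / a.jac x))"
        using a.jac_pos by (auto intro!: continuous_intros \<phi>c fc a.continuous_jac b.continuous_jac) (metis less_irrefl)
      show "AE x in hyp k'. 0 \<le> ?i (b.lift x) * (\<phi> (b.lift x) * f (b.lift x) * (b.jac (b.lift x) / a.jac (b.lift x)))"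
        using a.jac_pos b.jac_pos \<phi>0 f(2) by (intro AE_I2 mult_nonneg_nonneg divide_nonneg_nonneg) (auto intro: less_imp_le)
    qed (auto simp: \<phi>K)
    finally show "(\<integral>\<^sup>+x. ennreal (f x) \<partial>N) = ennreal (?IN f)" .
  qed
  have "M = N"
  proof (rule measure_eqI_C1_test)
    show "sets M = sets borel" "sets N = sets borel" by (simp_all add: M_def N_def)
    have "emeasure M UNIV = (\<integral>\<^sup>+x. ennreal 1 \<partial>M)" by (simp add: M_def)
    also have "\<dots> \<noteq> \<infinity>" using intM[OF C1_on_const, of 1] by simp
    finally show "emeasure M UNIV \<noteq> \<infinity>" .
    fix f :: "real^'n \<Rightarrow> real" assume f: "C1_on UNIV UNIV f" "\<And>x. 0 \<le> f x" "\<And>x. f x \<le> 1"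
    have "?IM f = ?IN f"
      by (rule chart_integral_consistent[OF assms(1,2) C1_on_mult[OF \<phi>C f(1)] compact_cball r(2)]) (simp add: \<phi>K)
    then show "(\<integral>\<^sup>+x. ennreal (f x) \<partial>M) = (\<integral>\<^sup>+x. ennreal (f x) \<partial>N)"
      by (simp add: intM[OF f(1,2)] intN[OF f(1,2)])
  qed
  \<comment> \<open>On \<open>A\<close> the reciprocal weight is finite and positive, so the measure
    of \<open>A\<close> is recovered from the weighted measure alone.\<close>
  have wt: "emeasure P A = (\<integral>\<^sup>+x. ennreal (indicator A x * (a.jac x / \<phi> x)) \<partial>density P (\<lambda>x. ennreal (?w x)))"
    if P: "sets P = sets borel" for P
  proof -
    have [measurable_cong]: "sets P = sets borel" and [measurable]: "A \<in> sets borel" by fact+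
    have "(\<integral>\<^sup>+x. ennreal (indicator A x * (a.jac x / \<phi> x)) \<partial>density P (\<lambda>x. ennreal (?w x)))
       = (\<integral>\<^sup>+x. ennreal (?w x) * ennreal (indicator A x * (a.jac x / \<phi> x)) \<partial>P)"
      by (intro nn_integral_density) measurable
    also have "\<dots> = (\<integral>\<^sup>+x. indicator A x \<partial>P)"
    proof (rule nn_integral_cong)
      fix x
      show "ennreal (?w x) * ennreal (indicator A x * (a.jac x / \<phi> x)) = indicator A x"
      proof (cases "x \<in> A")
        case True
        then have "\<phi> x > 0" "x \<in> frontier \<Omega>" using A(2) \<phi>pos by auto
        then show ?thesis using True a.jac_pos[of x] by (simp add: ennreal_mult[symmetric])
      qed simp
    qed
    finally show ?thesis using A(1) P by simp
  qed
  show ?thesis using wt[of "chart_measure k \<gamma>"] wt[of "chart_measure k' \<gamma>'"] \<open>M = N\<close>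
    by (simp add: M_def N_def)
qed

text \<open>Countably many balls of the previous lemma cover \<open>A\<close> by the Lindelof
  property; made disjoint, they reduce the claim to countable additivity.\<close>

lemma chart_measure_consistent:
  fixes A :: "(real^'n::finite) set"
  assumes c: "graph_chart \<Omega> k s \<gamma> W" "graph_chart \<Omega> k' s' \<gamma>' W'"
    and A: "A \<in> sets borel" "A \<subseteq> frontier \<Omega> \<inter> W \<inter> W'"
  shows "emeasure (chart_measure k \<gamma>) A = emeasure (chart_measure k' \<gamma>') A"
\<comment> \<open>A nonempty \<open>A\<close> makes the family of balls nonempty, as its enumeration
  by \<open>from_nat_into\<close> requires.\<close>
proof (cases "A = {}")
  case False
  have op: "open (W \<inter> W')" using c by (auto simp: graph_chart_def C2_graph_chart_def)
  define F where "F = {ball x r | x r. 0 < r \<and> cball x r \<subseteq> W \<inter> W'}"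
  have open_F: "\<And>S. S \<in> F \<Longrightarrow> open S" by (auto simp: F_def)
  obtain F' where F': "F' \<subseteq> F" "countable F'" "\<Union>F' = \<Union>F"
    using Lindelof[of F] open_F by blast
  have cover: "A \<subseteq> \<Union>F'"
  proof
    fix x assume "x \<in> A"
    then obtain r where "r > 0" "cball x r \<subseteq> W \<inter> W'"
      using op A(2) unfolding open_contains_cball by blast
    then have "x \<in> \<Union>F" unfolding F_def by (auto intro!: exI[of _ "ball x r"])
    then show "x \<in> \<Union>F'" using F' by simp
  qed
  then have ne: "F' \<noteq> {}" using False by auto
  define B where "B = disjointed (from_nat_into F')"
  have Bs: "B n \<subseteq> from_nat_into F' n" "from_nat_into F' n \<in> F" for n
    using disjointed_subset[of "from_nat_into F'" n] from_nat_into[OF ne, of n] F'(1) by (auto simp: B_def)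
  have FB: "from_nat_into F' n \<in> sets borel" for n using Bs(2)[of n] by (auto simp: F_def)
  then have Bm: "B n \<in> sets borel" for n
    unfolding B_def using sets.range_disjointed_sets[of "from_nat_into F'" borel] by auto
  have UN: "(\<Union>n. A \<inter> B n) = A"
    using cover UN_disjointed_eq[of "from_nat_into F'"] range_from_nat_into[OF ne F'(2)] by (auto simp: B_def)
  have dj: "disjoint_family (\<lambda>n. A \<inter> B n)"
    using disjoint_family_disjointed[of "from_nat_into F'"] by (auto simp: B_def disjoint_family_on_def)
  have eq: "emeasure (chart_measure k \<gamma>) (A \<inter> B n) = emeasure (chart_measure k' \<gamma>') (A \<inter> B n)" for n
  proof -
    obtain x r where xr: "from_nat_into F' n = ball x r" "0 < r" "cball x r \<subseteq> W \<inter> W'"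
      using Bs(2)[of n] by (auto simp: F_def)
    show ?thesis
      by (rule chart_measure_consistent_ball[OF c _ _ xr(2,3)]) (use A Bm Bs(1)[of n] xr in auto)
  qed
  have "emeasure P A = (\<Sum>n. emeasure P (A \<inter> B n))" if "sets P = sets borel" for P
  proof -
    have "range (\<lambda>n. A \<inter> B n) \<subseteq> sets P" using A(1) Bm that by auto
    from suminf_emeasure[OF this dj] show ?thesis unfolding UN by simp
  qed
  then show ?thesis using eq by simp
qed simp

lemma set_integral_sum:
  fixes f :: "'i \<Rightarrow> 'a \<Rightarrow> real"
  assumes "\<And>i. i \<in> I \<Longrightarrow> set_integrable M A (f i)"
  shows "(LINT x:A|M. (\<Sum>i\<in>I. f i x)) = (\<Sum>i\<in>I. LINT x:A|M. f i x)"
  using assms unfolding set_lebesgue_integral_def set_integrable_def scaleR_sum_right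
  by (rule Bochner_Integration.integral_sum)

section \<open>Existence, uniqueness and finiteness of the surface measure\<close>

locale C2_domain =
  fixes \<Omega> :: "(real^'n::finite) set"
  assumes open_\<Omega>: "open \<Omega>" and bounded_\<Omega>: "bounded \<Omega>" and C2_bd: "C2_boundary \<Omega>"
begin

abbreviation "cl \<equiv> closure \<Omega>"
abbreviation "bd \<equiv> frontier \<Omega>"
abbreviation "surf \<equiv> surface_measure \<Omega>"
abbreviation "nrm \<equiv> outward_unit_normal \<Omega>"

lemma compact_closure: "compact cl" and compact_frontier: "compact bd"
  using bounded_\<Omega> by (auto simp: compact_frontier_bounded)

lemma graph_chartI: "C2_graph_chart \<Omega> k s \<gamma> W \<Longrightarrow> graph_chart \<Omega> k s \<gamma> W"
  using open_\<Omega> by (simp add: graph_chart_def)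

lemma frontier_chart:
  assumes "x \<in> bd"
  obtains k s \<gamma> W where "graph_chart \<Omega> k s \<gamma> W" "x \<in> W"
proof -
  have "\<exists>k s \<gamma> W. C2_graph_chart \<Omega> k s \<gamma> W \<and> x \<in> W"
    using assms C2_bd unfolding C2_boundary_def by blast
  then show ?thesis using that graph_chartI by blast
qed

text \<open>The property inside the definite description of \<open>surface_measure\<close>, with its
  chart integral written as a value of \<open>chart_measure\<close>.\<close>

definition is_surface_measure :: "(real^'n) measure \<Rightarrow> bool" where
  "is_surface_measure \<sigma> \<longleftrightarrow> sets \<sigma> = sets borel \<and> emeasure \<sigma> (- bd) = 0 \<and>
    (\<forall>k s \<gamma> W A. graph_chart \<Omega> k s \<gamma> W \<and> A \<in> sets borel \<and> A \<subseteq> bd \<inter> W \<longrightarrow>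
      emeasure \<sigma> A = emeasure (chart_measure k \<gamma>) A)"

lemma surface_measure_eq_The: "surf = (THE \<sigma>. is_surface_measure \<sigma>)"
proof -
  have "(\<forall>k s \<gamma> W A. graph_chart \<Omega> k s \<gamma> W \<and> A \<in> sets borel \<and> A \<subseteq> bd \<inter> W \<longrightarrow>
      emeasure \<sigma> A = emeasure (chart_measure k \<gamma>) A) \<longleftrightarrow>
    (\<forall>k s \<gamma> W A. C2_graph_chart \<Omega> k s \<gamma> W \<and> A \<in> sets borel \<and> A \<subseteq> bd \<inter> W \<longrightarrow>
      emeasure \<sigma> A =
        (\<integral>\<^sup>+ z. indicator A (z + \<gamma> z *\<^sub>R axis k 1) * ennreal (sqrt (1 + (norm (grad \<gamma> z))\<^sup>2))
          \<partial>hyp k))" for \<sigma> :: "(real^'n) measure"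
  proof -
    have gc: "C2_graph_chart \<Omega> k s \<gamma> W \<longleftrightarrow> graph_chart \<Omega> k s \<gamma> W" for k s \<gamma> W
      using open_\<Omega> by (simp add: graph_chart_def)
    have "(graph_chart \<Omega> k s \<gamma> W \<and> A \<in> sets borel \<and> A \<subseteq> bd \<inter> W \<longrightarrow>
        emeasure \<sigma> A = emeasure (chart_measure k \<gamma>) A) \<longleftrightarrow>
      (C2_graph_chart \<Omega> k s \<gamma> W \<and> A \<in> sets borel \<and> A \<subseteq> bd \<inter> W \<longrightarrow>
        emeasure \<sigma> A = (\<integral>\<^sup>+ z. indicator A (z + \<gamma> z *\<^sub>R axis k 1) *
          ennreal (sqrt (1 + (norm (grad \<gamma> z))\<^sup>2)) \<partial>hyp k))" for k s \<gamma> W A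
      unfolding gc using graph_chart.emeasure_chart_measure[of \<Omega> k s \<gamma> W A] by auto
    then show ?thesis by (simp only:)
  qed
  then show ?thesis unfolding surface_measure_def is_surface_measure_def by simp
qed

text \<open>Finitely many charts cover the compact boundary. Cut the boundary into disjoint Borel
  pieces, one per chart, and add up the chart measures of the pieces; consistency of charts shows
  that any other chart gives the same values. A competitor agrees on every piece and is null off the
  boundary, so it is the same measure.\<close>

lemma ex1_surface_measure: "\<exists>!\<sigma>. is_surface_measure \<sigma>"
proof -
  have "\<forall>x\<in>bd. \<exists>c. graph_chart \<Omega> (fst c) (fst (snd c)) (fst (snd (snd c))) (snd (snd (snd c))) \<and> x \<in> snd (snd (snd c))"
  proof
    fix x assume "x \<in> bd"
    then obtain k s \<gamma> W where "graph_chart \<Omega> k s \<gamma> W" "x \<in> W" by (rule frontier_chart)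
    then show "\<exists>c. graph_chart \<Omega> (fst c) (fst (snd c)) (fst (snd (snd c))) (snd (snd (snd c))) \<and> x \<in> snd (snd (snd c))"
      by (intro exI[of _ "(k, s, \<gamma>, W)"]) simp
  qed
  then obtain ch where ch: "\<And>x. x \<in> bd \<Longrightarrow> graph_chart \<Omega> (fst (ch x)) (fst (snd (ch x))) (fst (snd (snd (ch x)))) (snd (snd (snd (ch x))))"
    "\<And>x. x \<in> bd \<Longrightarrow> x \<in> snd (snd (snd (ch x)))"
    unfolding bchoice_iff by blast
  define Wc where "Wc x = snd (snd (snd (ch x)))" for x
  have oW: "open (Wc x)" if "x \<in> bd" for x
    using graph_chart.open_W[OF ch(1)[OF that]] by (simp add: Wc_def)
  obtain C where C: "C \<subseteq> bd" "finite C" "bd \<subseteq> (\<Union>x\<in>C. Wc x)"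
    using compactE_image[OF compact_frontier, of "bd" Wc] oW ch(2) unfolding Wc_def by blast
  obtain h where h: "bij_betw h {0..<card C} C" using ex_bij_betw_nat_finite[OF C(2)] by blast
  define N where "N = card C"
  \<comment> \<open>\<open>disjointed\<close> works on sequences, so the finite cover is padded by
    empty sets.\<close>
  define V where "V i = (if i < N then Wc (h i) else {})" for i
  define \<mu> where "\<mu> i = chart_measure (fst (ch (h i))) (fst (snd (snd (ch (h i)))))" for i
  define B where "B i = bd \<inter> disjointed V i" for i
  have hC: "h i \<in> bd" if "i < N" for i
    using h that C(1) unfolding N_def bij_betw_def by fastforce
  have Vb: "V i \<in> sets borel" for i using oW hC by (auto simp: V_def)
  have Bb: "B i \<in> sets borel" for i
  proof -
    have "range (disjointed V) \<subseteq> sets borel" using Vb by (intro sets.range_disjointed_sets) auto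
    then show ?thesis unfolding B_def by (intro sets.Int) auto
  qed
  have UB: "(\<Union>i<N. B i) = bd"
  proof -
    have "C = h ` {..<N}" using h by (auto simp: bij_betw_def atLeast0LessThan N_def)
    then have "(\<Union>i. V i) = (\<Union>x\<in>C. Wc x)" by (auto simp: V_def split: if_splits)
    then have "(\<Union>i. B i) = bd" using C(3) UN_disjointed_eq[of V] by (auto simp: B_def)
    moreover have "B i = {}" if "\<not> i < N" for i
      using disjointed_subset[of V i] that by (auto simp: B_def V_def)
    ultimately show ?thesis by (auto; metis UN_iff empty_iff UNIV_I)
  qed
  have dB: "disjoint_family_on (\<lambda>i. A \<inter> B i) {..<N}" for A
    using disjoint_family_disjointed[of V] by (auto simp: B_def disjoint_family_on_def)
  have BV: "B i \<subseteq> bd \<inter> Wc (h i)" if "i < N" for i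
    using disjointed_subset[of V i] that by (auto simp: B_def V_def)
  have split: "emeasure P (A \<inter> bd) = (\<Sum>i<N. emeasure P (A \<inter> B i))"
    if "sets P = sets borel" "A \<in> sets borel" for P A
  proof -
    have "(\<lambda>i. A \<inter> B i) ` {..<N} \<subseteq> sets P" using that Bb by auto
    from sum_emeasure[OF this dB] have "(\<Sum>i<N. emeasure P (A \<inter> B i)) = emeasure P (\<Union>i<N. A \<inter> B i)" by simp
    also have "(\<Union>i<N. A \<inter> B i) = A \<inter> bd" using UB by auto
    finally show ?thesis by simp
  qed
  define m where "m A = (\<Sum>i<N. emeasure (\<mu> i) (A \<inter> B i))" for A
  define \<sigma> where "\<sigma> = measure_of UNIV (sets borel) m"
  have setsS: "sets \<sigma> = sets borel"
    using sets.sigma_sets_eq[of "borel :: (real^'n) measure"] by (simp add: \<sigma>_def)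
  have \<mu>b: "sets (\<mu> i) = sets borel" for i by (simp add: \<mu>_def)
  have em: "emeasure \<sigma> A = m A" if "A \<in> sets borel" for A
    unfolding \<sigma>_def
  proof (rule emeasure_measure_of_sigma[OF _ _ _ that])
    show "sigma_algebra UNIV (sets (borel :: (real^'n) measure))"
      using sets.sigma_algebra_axioms[of "borel :: (real^'n) measure"] by simp
    show "positive (sets borel) m" by (simp add: positive_def m_def)
    show "countably_additive (sets borel) m"
    proof (rule countably_additiveI)
      fix A :: "nat \<Rightarrow> (real^'n) set" assume A: "range A \<subseteq> sets borel" "disjoint_family A"
      have "(\<Sum>n. m (A n)) = (\<Sum>i<N. \<Sum>n. emeasure (\<mu> i) (A n \<inter> B i))"
        unfolding m_def by (rule suminf_sum) simp
      also have "\<dots> = (\<Sum>i<N. emeasure (\<mu> i) (\<Union>n. A n \<inter> B i))"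
      proof (rule sum.cong[OF refl])
        fix i
        have "range (\<lambda>n. A n \<inter> B i) \<subseteq> sets (\<mu> i)" using A(1) Bb \<mu>b by auto
        moreover have "disjoint_family (\<lambda>n. A n \<inter> B i)" using A(2) by (auto simp: disjoint_family_on_def)
        ultimately show "(\<Sum>n. emeasure (\<mu> i) (A n \<inter> B i)) = emeasure (\<mu> i) (\<Union>n. A n \<inter> B i)"
          by (rule suminf_emeasure)
      qed
      also have "\<dots> = m (\<Union>n. A n)" by (simp add: m_def)
      finally show "(\<Sum>n. m (A n)) = m (\<Union>n. A n)" .
    qed
  qed
  have S: "is_surface_measure \<sigma>"
    unfolding is_surface_measure_def
  proof (intro conjI allI impI setsS)
    have "- bd \<inter> B i = {}" for i by (auto simp: B_def)
    then show "emeasure \<sigma> (- bd) = 0" by (subst em) (auto simp: m_def)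
    fix k s \<gamma> W A assume "graph_chart \<Omega> k s \<gamma> W \<and> A \<in> sets borel \<and> A \<subseteq> bd \<inter> W"
    then have c: "graph_chart \<Omega> k s \<gamma> W" and A: "A \<in> sets borel" "A \<subseteq> bd \<inter> W" by auto
    have "emeasure \<sigma> A = (\<Sum>i<N. emeasure (\<mu> i) (A \<inter> B i))" by (simp add: em A m_def)
    also have "\<dots> = (\<Sum>i<N. emeasure (chart_measure k \<gamma>) (A \<inter> B i))"
    proof (rule sum.cong[OF refl])
      fix i assume "i \<in> {..<N}"
      then have i: "i < N" by simp
      show "emeasure (\<mu> i) (A \<inter> B i) = emeasure (chart_measure k \<gamma>) (A \<inter> B i)"
        unfolding \<mu>_def
        by (rule chart_measure_consistent[OF ch(1)[OF hC[OF i]] c])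
          (use A Bb BV[OF i] in \<open>auto simp: Wc_def\<close>)
    qed
    also have "\<dots> = emeasure (chart_measure k \<gamma>) (A \<inter> bd)" using A by (simp add: split)
    also have "A \<inter> bd = A" using A by auto
    finally show "emeasure \<sigma> A = emeasure (chart_measure k \<gamma>) A" .
  qed
  moreover have "\<sigma>' = \<sigma>" if S': "is_surface_measure \<sigma>'" for \<sigma>'
  proof (rule measure_eqI)
    have b: "sets \<sigma>' = sets borel" using S' by (simp add: is_surface_measure_def)
    show "sets \<sigma>' = sets \<sigma>" using b setsS by simp
    fix A assume "A \<in> sets \<sigma>'"
    then have A: "A \<in> sets borel" using b by simp
    have *: "emeasure P A = (\<Sum>i<N. emeasure (\<mu> i) (A \<inter> B i))" if P: "is_surface_measure P" for P
    proof -
      have Pb: "sets P = sets borel" and P0: "emeasure P (- bd) = 0" using P by (auto simp: is_surface_measure_def)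
      have "AE x in P. x \<in> bd"
        by (rule AE_I[of _ _ "- bd"]) (use Pb P0 in auto)
      then have "emeasure P A = emeasure P (A \<inter> bd)"
        by (intro emeasure_eq_AE) (use A Pb in \<open>auto elim!: eventually_mono\<close>)
      also have "\<dots> = (\<Sum>i<N. emeasure P (A \<inter> B i))" by (rule split[OF Pb A])
      also have "\<dots> = (\<Sum>i<N. emeasure (\<mu> i) (A \<inter> B i))"
      proof (rule sum.cong[OF refl])
        fix i assume "i \<in> {..<N}"
        then have i: "i < N" by simp
        have "A \<inter> B i \<in> sets borel" "A \<inter> B i \<subseteq> bd \<inter> snd (snd (snd (ch (h i))))"
          using A Bb BV[OF i] by (auto simp: Wc_def)
        then show "emeasure P (A \<inter> B i) = emeasure (\<mu> i) (A \<inter> B i)"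
          using P ch(1)[OF hC[OF i]] unfolding is_surface_measure_def \<mu>_def by blast
      qed
      finally show ?thesis .
    qed
    show "emeasure \<sigma>' A = emeasure \<sigma> A" using *[OF S'] *[OF S] by simp
  qed
  ultimately show ?thesis by blast
qed

lemma is_surface_measure_surface_measure: "is_surface_measure surf"
  unfolding surface_measure_eq_The by (rule theI'[OF ex1_surface_measure])

lemma sets_surface_measure [simp, measurable_cong]: "sets surf = sets borel"
  and emeasure_surface_chart: "graph_chart \<Omega> k s \<gamma> W \<Longrightarrow> A \<in> sets borel \<Longrightarrow> A \<subseteq> bd \<inter> W \<Longrightarrow>
      emeasure surf A = emeasure (chart_measure k \<gamma>) A"
  using is_surface_measure_surface_measure unfolding is_surface_measure_def by blast+

text \<open>Over a small closed ball inside a chart the area element is bounded and the base points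
  stay in a ball of the hyperplane; compactness leaves finitely many such balls.\<close>

lemma emeasure_surface_finite: "emeasure surf bd < \<infinity>"
proof -
  have "\<exists>r. 0 < r \<and> emeasure surf (bd \<inter> cball x r) < \<infinity>" if x: "x \<in> bd" for x
  proof -
    obtain k s \<gamma> W where c: "graph_chart \<Omega> k s \<gamma> W" "x \<in> W" using frontier_chart[OF x] by blast
    interpret graph_chart \<Omega> k s \<gamma> W by (rule c(1))
    obtain r where r: "r > 0" "cball x r \<subseteq> W" using open_W c(2) open_contains_cball by blast
    let ?A = "bd \<inter> cball x r"
    have Ab: "?A \<in> sets borel" by (intro sets.Int) auto
    obtain M where M: "\<And>y. y \<in> cball x r \<Longrightarrow> norm (jac y) \<le> M"
    proof -
      have "bounded (jac ` cball x r)"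
        by (intro compact_imp_bounded compact_continuous_image continuous_on_subset[OF continuous_jac]) auto
      then show ?thesis using that unfolding bounded_iff by blast
    qed
    have nb: "norm y \<le> norm x + r" if "y \<in> cball x r" for y
      using that norm_triangle_ineq2[of y x] by (simp add: dist_norm norm_minus_commute)
    have "emeasure surf ?A = emeasure (chart_measure k \<gamma>) ?A"
      by (rule emeasure_surface_chart[OF c(1) Ab]) (use r in auto)
    also have "\<dots> = (\<integral>\<^sup>+z. ennreal (jac z) * indicator ?A (lift z) \<partial>hyp k)"
      using nn_integral_chart_measure[of "indicator ?A"] Ab by simp
    also have "\<dots> \<le> (\<integral>\<^sup>+z. ennreal M * indicator (cball 0 (norm x + r)) z \<partial>hyp k)"
    proof (rule nn_integral_mono_AE)
      show "AE z in hyp k. ennreal (jac z) * indicator ?A (lift z) \<le> ennreal M * indicator (cball 0 (norm x + r)) z"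
        using hyperplane_lborel_AE[of k]
      proof eventually_elim
        case (elim z)
        show ?case
        proof (cases "lift z \<in> ?A")
          case True
          then have "z \<in> cball 0 (norm x + r)" using lift_in_K_imp_cball[OF nb elim] by blast
          moreover have "jac z \<le> M" using M[of "lift z"] True by simp
          ultimately show ?thesis using True by (simp add: ennreal_leI)
        qed simp
      qed
    qed
    also have "\<dots> = ennreal M * emeasure (hyp k) (cball 0 (norm x + r))"
      by (simp add: nn_integral_cmult_indicator)
    also have "\<dots> < \<infinity>" using hyperplane_lborel_cball_finite[of k "norm x + r"] by (simp add: ennreal_mult_less_top)
    finally show ?thesis using r by blast
  qed
  then obtain r where r: "\<And>x. x \<in> bd \<Longrightarrow> 0 < r x"
    "\<And>x. x \<in> bd \<Longrightarrow> emeasure surf (bd \<inter> cball x (r x)) < \<infinity>"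
    by metis
  obtain C where C: "C \<subseteq> bd" "finite C" "bd \<subseteq> (\<Union>x\<in>C. ball x (r x))"
    using compactE_image[OF compact_frontier, of "bd" "\<lambda>x. ball x (r x)"] r(1) by force
  have "emeasure surf bd \<le> emeasure surf (\<Union>x\<in>C. bd \<inter> cball x (r x))"
  proof (rule emeasure_mono)
    show "bd \<subseteq> (\<Union>x\<in>C. bd \<inter> cball x (r x))" using C(3) ball_subset_cball by blast
  qed (use C in \<open>auto intro!: sets.finite_UN sets.Int\<close>)
  also have "\<dots> \<le> (\<Sum>x\<in>C. emeasure surf (bd \<inter> cball x (r x)))"
    by (rule emeasure_subadditive_finite[OF C(2)]) (auto intro!: sets.Int)
  also have "\<dots> < \<infinity>" using C r(2) by (simp add: subset_iff less_top)
  finally show ?thesis .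
qed

text \<open>An integrand that vanishes on the boundary outside \<open>W\<close> sees only the
  restriction of the surface measure to \<open>W\<close>, which coincides with that of the chart
  measure.\<close>

lemma surface_integral_chart:
  fixes f :: "real^'n \<Rightarrow> real"
  assumes c: "graph_chart \<Omega> k s \<gamma> W" and f: "continuous_on bd f"
    and W: "\<And>x. x \<in> bd - W \<Longrightarrow> f x = 0"
  shows "(LINT x:bd|surf. f x) =
    (LINT z|hyp k. indicator (bd \<inter> W) (chart_lift k \<gamma> z) *
      (f (chart_lift k \<gamma> z) * chart_jac \<gamma> z))"
proof -
  interpret graph_chart \<Omega> k s \<gamma> W by (rule c)
  let ?S = "bd \<inter> W"
  have Sb [measurable]: "?S \<in> sets borel" using open_W by (intro sets.Int) auto
  let ?g = "\<lambda>x. indicator bd x * f x"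
  have gm [measurable]: "?g \<in> borel_measurable borel"
    using borel_measurable_continuous_on_indicator[OF _ f] by simp
  have g: "indicator bd x *\<^sub>R f x = indicator ?S x *\<^sub>R ?g x" for x
    using W by (auto simp: indicator_def)
  have eq: "density surf (indicator ?S) = density (chart_measure k \<gamma>) (indicator ?S)"
  proof (rule measure_eqI)
    fix A assume "A \<in> sets (density surf (indicator ?S))"
    then have A: "A \<in> sets borel" by simp
    then show "emeasure (density surf (indicator ?S)) A = emeasure (density (chart_measure k \<gamma>) (indicator ?S)) A"
      using Sb emeasure_surface_chart[OF c, of "?S \<inter> A"] by (auto simp: emeasure_restricted)
  qed simp
  have den: "(LINT x|P. indicator ?S x *\<^sub>R ?g x) = (LINT x|density P (indicator ?S). ?g x)" if [measurable_cong]: "sets P = sets borel" for P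
  proof -
    have "(LINT x|density P (\<lambda>x. ennreal (indicator ?S x)). ?g x) = (LINT x|P. indicator ?S x *\<^sub>R ?g x)"
      by (rule integral_density) (auto)
    then show ?thesis by (simp add: ennreal_indicator)
  qed
  have "(LINT x:bd|surf. f x) = (LINT x|surf. indicator ?S x *\<^sub>R ?g x)"
    unfolding set_lebesgue_integral_def g ..
  also have "\<dots> = (LINT x|chart_measure k \<gamma>. indicator ?S x *\<^sub>R ?g x)"
    by (simp only: den eq sets_surface_measure sets_chart_measure)
  also have "\<dots> = (LINT z|density (hyp k) (\<lambda>z. ennreal (jac z)). indicator ?S (lift z) *\<^sub>R ?g (lift z))"
    unfolding chart_measure_def by (rule integral_distr) auto
  also have "\<dots> = (LINT z|hyp k. jac z *\<^sub>R (indicator ?S (lift z) *\<^sub>R ?g (lift z)))"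
  proof (rule integral_density)
    have "(\<lambda>x. indicator ?S x *\<^sub>R ?g x) \<in> borel_measurable borel" by measurable
    from measurable_compose[OF lift_measurable this]
    show "(\<lambda>z. indicator ?S (lift z) *\<^sub>R ?g (lift z)) \<in> borel_measurable (hyp k)" by simp
  qed (use jac_pos in \<open>auto intro: less_imp_le\<close>)
  also have "\<dots> = (LINT z|hyp k. indicator ?S (lift z) * (f (lift z) * jac z))"
    by (intro Bochner_Integration.integral_cong refl) (simp add: indicator_def)
  finally show ?thesis .
qed

section \<open>Boundary cutoffs\<close>

lemma set_integrable_closure:
  fixes f :: "real^'n \<Rightarrow> real"
  assumes "continuous_on cl f" shows "set_integrable lborel \<Omega> f"
proof -
  have "set_integrable lborel cl f"
    unfolding set_integrable_def by (rule borel_integrable_compact[OF compact_closure assms])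
  then show ?thesis
    by (rule set_integrable_subset) (use open_\<Omega> closure_subset in auto)
qed

lemma set_integrable_frontier:
  fixes f :: "real^'n \<Rightarrow> real"
  assumes f: "continuous_on bd f" shows "set_integrable surf bd f"
proof -
  have "bounded (f ` bd)"
    by (intro compact_imp_bounded compact_continuous_image f compact_frontier)
  then obtain M where M: "\<And>x. x \<in> bd \<Longrightarrow> norm (f x) \<le> M" unfolding bounded_iff by blast
  have "integrable surf (\<lambda>x. M * indicator bd x)"
    using emeasure_surface_finite by (intro integrable_mult_right integrable_real_indicator) auto
  then show ?thesis
    unfolding set_integrable_def
  proof (rule Bochner_Integration.integrable_bound)
    show "(\<lambda>x. indicator bd x *\<^sub>R f x) \<in> borel_measurable surf"
      using borel_measurable_continuous_on_indicator[OF _ f] by simp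
    show "AE x in surf. norm (indicator bd x *\<^sub>R f x) \<le> norm (M * indicator bd x)"
      using M by (intro AE_I2) (auto simp: indicator_def intro: order_trans[OF _ abs_ge_self])
  qed
qed

lemma frontier_disjoint: "x \<in> bd \<Longrightarrow> x \<notin> \<Omega>"
  using open_\<Omega> by (simp add: frontier_def interior_open)

lemma frontier_subset_closure: "bd \<subseteq> cl"
  by (simp add: frontier_def)

text \<open>Continuity is local, and near a boundary point one chart supplies a continuous
  formula.\<close>

lemma continuous_outward_unit_normal: "continuous_on bd nrm"
  unfolding continuous_on_def
proof
  fix x assume x: "x \<in> bd"
  then obtain k s \<gamma> W where c: "graph_chart \<Omega> k s \<gamma> W" "x \<in> W" by (rule frontier_chart)
  interpret graph_chart \<Omega> k s \<gamma> W by (rule c(1))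
  have "continuous_on UNIV (\<lambda>y. - (cn y /\<^sub>R jac y))"
    by (intro continuous_intros continuous_cn continuous_jac) (metis jac_pos less_irrefl)
  then have "((\<lambda>y. - (cn y /\<^sub>R jac y)) \<longlongrightarrow> - (cn x /\<^sub>R jac x)) (at x within bd)"
    using continuous_on_subset[of UNIV _ "bd"] x unfolding continuous_on_def by blast
  moreover have "\<forall>\<^sub>F y in at x within bd. - (cn y /\<^sub>R jac y) = nrm y"
    unfolding eventually_at_topological
    using open_W c(2) outward_unit_normal_eq by (intro exI[of _ W]) auto
  ultimately show "(nrm \<longlongrightarrow> nrm x) (at x within bd)"
    using outward_unit_normal_eq[OF x c(2)] by (simp add: Lim_transform_eventually)
qed

text \<open>On the boundary the conormal is minus the area element times the outward normal, and
  this factor is the density of the surface measure over the hyperplane. The limit of the layer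
  therefore no longer depends on the chart.\<close>

lemma layer_vector_limit:
  fixes V :: "real^'n \<Rightarrow> real^'n" and \<theta> :: "real^'n \<Rightarrow> real"
  assumes c: "graph_chart \<Omega> k s \<gamma> W"
    and \<theta>: "continuous_on cl \<theta>" and K: "compact K" "K \<subseteq> W" "\<And>x. x \<in> cl - K \<Longrightarrow> \<theta> x = 0"
    and V: "continuous_on cl V"
  shows "(\<lambda>m. LINT x:\<Omega>|lborel. (\<theta> x * (V x \<bullet> chart_conormal k s \<gamma> x)) * graph_chart.layer k s \<gamma> m x) \<longlonglongrightarrow>
    - (LINT x:bd|surf. \<theta> x * (V x \<bullet> nrm x))"
proof -
  interpret graph_chart \<Omega> k s \<gamma> W by (rule c)
  have cont: "continuous_on cl (\<lambda>x. \<theta> x * (V x \<bullet> cn x))"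
    by (intro continuous_intros \<theta> V continuous_on_subset[OF continuous_cn]) auto
  have contn: "continuous_on bd (\<lambda>x. \<theta> x * (V x \<bullet> nrm x))"
    by (intro continuous_intros continuous_outward_unit_normal continuous_on_subset[OF \<theta>] continuous_on_subset[OF V]
        frontier_subset_closure)
  have "(LINT x:bd|surf. \<theta> x * (V x \<bullet> nrm x)) =
    (LINT z|hyp k. indicator (bd \<inter> W) (lift z) * ((\<theta> (lift z) * (V (lift z) \<bullet> nrm (lift z))) * jac z))"
    by (rule surface_integral_chart[OF c contn]) (use K frontier_subset_closure in auto)
  also have "\<dots> = (LINT z|hyp k. - (indicator (bd \<inter> W) (lift z) * (\<theta> (lift z) * (V (lift z) \<bullet> cn (lift z)))))"
  proof (rule Bochner_Integration.integral_cong[OF refl])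
    fix z
    show "indicator (bd \<inter> W) (lift z) * ((\<theta> (lift z) * (V (lift z) \<bullet> nrm (lift z))) * jac z) =
      - (indicator (bd \<inter> W) (lift z) * (\<theta> (lift z) * (V (lift z) \<bullet> cn (lift z))))"
      using outward_unit_normal_eq[of "lift z"] jac_pos[of z] by (cases "lift z \<in> bd \<inter> W") auto
  qed
  also have "\<dots> = - (LINT z|hyp k. indicator (bd \<inter> W) (lift z) * (\<theta> (lift z) * (V (lift z) \<bullet> cn (lift z))))"
    by (rule Bochner_Integration.integral_minus)
  finally show ?thesis
    using layer_limit[OF cont K(1,2)] K(3) by simp
qed

text \<open>The constant depends neither on \<open>V\<close> nor on \<open>m\<close>. With
  \<open>V\<close> depending on time, this is what will dominate the layer integrals. It is the
  supremum of \<theta> times the length of the conormal, multiplied by the measure of a ball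
  containing the shadow of \<open>K\<close>.\<close>

lemma layer_vector_bound:
  fixes \<theta> :: "real^'n \<Rightarrow> real"
  assumes c: "graph_chart \<Omega> k s \<gamma> W"
    and \<theta>: "continuous_on cl \<theta>" and K: "compact K" "K \<subseteq> W" "\<And>x. x \<in> cl - K \<Longrightarrow> \<theta> x = 0"
  obtains B where "0 \<le> B" "\<And>V M m. continuous_on cl V \<Longrightarrow> 0 \<le> M \<Longrightarrow> (\<And>x. x \<in> \<Omega> \<Longrightarrow> norm (V x) \<le> M) \<Longrightarrow>
    \<bar>LINT x:\<Omega>|lborel. (\<theta> x * (V x \<bullet> chart_conormal k s \<gamma> x)) * graph_chart.layer k s \<gamma> m x\<bar> \<le> B * M"
proof -
  interpret graph_chart \<Omega> k s \<gamma> W by (rule c)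
  have "continuous_on cl (\<lambda>x. \<theta> x * norm (cn x))"
    by (intro continuous_intros \<theta> continuous_on_subset[OF continuous_cn]) auto
  then obtain N where N: "0 \<le> N" "\<And>x. x \<in> cl \<Longrightarrow> \<bar>\<theta> x * norm (cn x)\<bar> \<le> N"
    by (rule continuous_compact_support_bounded[OF _ K(1)]) (use K in auto)
  obtain R where R: "\<And>x. x \<in> K \<Longrightarrow> norm x \<le> R"
    using compact_imp_bounded[OF K(1)] unfolding bounded_iff by blast
  show ?thesis
  proof (rule that[of "N * measure (hyp k) (cball 0 R)"])
    show "0 \<le> N * measure (hyp k) (cball 0 R)" using N by simp
    fix V :: "real^'n \<Rightarrow> real^'n" and M m
    assume V: "continuous_on cl V" and M: "0 \<le> M" "\<And>x. x \<in> \<Omega> \<Longrightarrow> norm (V x) \<le> M"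
    have "\<bar>LINT x:\<Omega>|lborel. (\<theta> x * (V x \<bullet> cn x)) * layer m x\<bar> \<le> (N * M) * measure (hyp k) (cball 0 R)"
    proof (rule layer_bound[OF _ K(1,2) _ _ _ R])
      show "continuous_on \<Omega> (\<lambda>x. \<theta> x * (V x \<bullet> cn x))"
        by (intro continuous_intros continuous_on_subset[OF \<theta>] continuous_on_subset[OF V] continuous_on_subset[OF continuous_cn])
          (use closure_subset in auto)
      show "\<theta> x * (V x \<bullet> cn x) = 0" if "x \<in> \<Omega> - K" for x using K(3)[of x] that closure_subset by auto
      show "\<bar>\<theta> x * (V x \<bullet> cn x)\<bar> \<le> N * M" if "x \<in> \<Omega>" for x
      proof -
        have "\<bar>\<theta> x * (V x \<bullet> cn x)\<bar> \<le> \<bar>\<theta> x\<bar> * (norm (V x) * norm (cn x))"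
          unfolding abs_mult by (intro mult_left_mono Cauchy_Schwarz_ineq2) auto
        also have "\<dots> = \<bar>\<theta> x * norm (cn x)\<bar> * norm (V x)" by (simp add: abs_mult)
        also have "\<dots> \<le> N * M" using N M(2)[OF that] that closure_subset by (intro mult_mono) auto
        finally show ?thesis .
      qed
    qed (use N M in auto)
    then show "\<bar>LINT x:\<Omega>|lborel. (\<theta> x * (V x \<bullet> cn x)) * layer m x\<bar> \<le> N * measure (hyp k) (cball 0 R) * M"
      by (simp add: mult_ac)
  qed
qed

text \<open>One summand \<open>\<theta>\<close> of a partition of unity, with the factor \<open>c m\<close> that cuts it off near the boundary.\<close>

definition cutoff_piece where
  "cutoff_piece \<theta> c dc B \<longleftrightarrow>
    (\<forall>m. C1_on UNIV UNIV (c m) \<and> continuous_on UNIV (dc m)) \<and>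
    (\<forall>m y. 0 \<le> c m y \<and> c m y \<le> (1::real) \<and> (c m has_derivative (\<lambda>h. dc m y \<bullet> h)) (at y)) \<and>
    (\<forall>m. \<exists>K. compact K \<and> K \<subseteq> \<Omega> \<and> (\<forall>y\<in>\<Omega> - K. \<theta> y * c m y = 0)) \<and>
    (\<forall>y\<in>\<Omega>. (\<lambda>m. \<theta> y * c m y) \<longlonglongrightarrow> \<theta> y) \<and>
    0 \<le> B \<and>
    (\<forall>V. continuous_on cl V \<longrightarrow>
      (\<lambda>m. LINT y:\<Omega>|lborel. V y \<bullet> (c m y *\<^sub>R grad \<theta> y + \<theta> y *\<^sub>R dc m y)) \<longlonglongrightarrow>
        (LINT y:\<Omega>|lborel. V y \<bullet> grad \<theta> y) - (LINT y:bd|surf. \<theta> y * (V y \<bullet> nrm y))) \<and>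
    (\<forall>V M m. continuous_on cl V \<longrightarrow> 0 \<le> M \<longrightarrow> (\<forall>x\<in>\<Omega>. norm (V x) \<le> M) \<longrightarrow>
      \<bar>LINT y:\<Omega>|lborel. V y \<bullet> (c m y *\<^sub>R grad \<theta> y + \<theta> y *\<^sub>R dc m y)\<bar> \<le> B * M)"

lemma grad_bound:
  fixes w :: "real^'n \<Rightarrow> real^'n" and c :: "real^'n \<Rightarrow> real"
  assumes w: "continuous_on cl w" and V: "continuous_on cl V" and c: "continuous_on cl c"
    and c1: "\<And>x. x \<in> \<Omega> \<Longrightarrow> \<bar>c x\<bar> \<le> 1" and M: "\<And>x. x \<in> \<Omega> \<Longrightarrow> norm (V x) \<le> M"
  shows "\<bar>LINT y:\<Omega>|lborel. c y * (V y \<bullet> w y)\<bar> \<le> (LINT y:\<Omega>|lborel. norm (w y)) * M"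
proof -
  have "\<bar>LINT y:\<Omega>|lborel. c y * (V y \<bullet> w y)\<bar> \<le> (LINT y:\<Omega>|lborel. norm (w y) * M)"
    unfolding set_lebesgue_integral_def
  proof (rule integral_abs_bound[THEN order_trans], rule integral_mono)
    show "integrable lborel (\<lambda>y. \<bar>indicator \<Omega> y *\<^sub>R (c y * (V y \<bullet> w y))\<bar>)"
    proof (rule integrable_abs)
      have "set_integrable lborel \<Omega> (\<lambda>y. c y * (V y \<bullet> w y))"
        by (intro set_integrable_closure continuous_on_mult c continuous_on_inner V w)
      then show "integrable lborel (\<lambda>y. indicator \<Omega> y *\<^sub>R (c y * (V y \<bullet> w y)))"
        by (simp add: set_integrable_def)
    qed
    show "integrable lborel (\<lambda>y. indicator \<Omega> y *\<^sub>R (norm (w y) * M))"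
    proof -
      have "set_integrable lborel \<Omega> (\<lambda>y. norm (w y) * M)"
        by (intro set_integrable_closure continuous_on_mult continuous_on_norm w continuous_on_const)
      then show ?thesis by (simp add: set_integrable_def)
    qed
    show "\<bar>indicator \<Omega> y *\<^sub>R (c y * (V y \<bullet> w y))\<bar> \<le> indicator \<Omega> y *\<^sub>R (norm (w y) * M)" for y
    proof (cases "y \<in> \<Omega>")
      case True
      have "\<bar>c y\<bar> * \<bar>V y \<bullet> w y\<bar> \<le> 1 * (norm (V y) * norm (w y))"
        by (intro mult_mono c1 True Cauchy_Schwarz_ineq2) auto
      also have "\<dots> \<le> norm (w y) * M" using mult_right_mono[OF M[OF True] norm_ge_zero[of "w y"]] by (simp add: mult.commute)
      finally show ?thesis using True by (simp add: abs_mult)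
    qed simp
  qed
  also have "\<dots> = (LINT y:\<Omega>|lborel. norm (w y)) * M" by simp
  finally show ?thesis .
qed

lemma C1_on_neighbourhood_grad:
  fixes \<theta> :: "real^'n \<Rightarrow> real"
  assumes U: "open U" "cl \<subseteq> U" and \<theta>: "C1_on U U \<theta>" and K: "compact K" "\<And>x. x \<in> U - K \<Longrightarrow> \<theta> x = 0"
  shows "continuous_on cl \<theta>" "continuous_on cl (grad \<theta>)"
    "\<And>x. x \<in> U - K \<Longrightarrow> grad \<theta> x = 0"
proof -
  show "continuous_on cl \<theta>" "continuous_on cl (grad \<theta>)"
    using C1_on_continuous[OF \<theta>] C1_on_open_grad(1)[OF \<theta>] U(2) by (auto intro: continuous_on_subset)
  show "grad \<theta> x = 0" if "x \<in> U - K" for x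
  proof (rule grad_unique)
    show "(\<theta> has_derivative (\<lambda>h. 0 \<bullet> h)) (at x)"
      by (rule has_derivative_transform_within_open[of "\<lambda>_. 0" _ _ _ "U - K"])
        (use that U K in \<open>auto simp: compact_imp_closed open_Diff\<close>)
  qed
qed

text \<open>A piece supported inside \<Omega> needs no cutting. It vanishes on the boundary, so the
  surface integral expected in the limit is zero.\<close>

lemma cutoff_piece_interior:
  fixes \<theta> :: "real^'n \<Rightarrow> real"
  assumes U: "open U" "cl \<subseteq> U" and \<theta>: "C1_on U U \<theta>"
    and K: "compact K" "\<And>x. x \<in> U - K \<Longrightarrow> \<theta> x = 0" and K\<Omega>: "K \<subseteq> \<Omega>"
  shows "cutoff_piece \<theta> (\<lambda>_ _. 1) (\<lambda>_ _. 0) (LINT y:\<Omega>|lborel. norm (grad \<theta> y))"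
proof -
  note g = C1_on_neighbourhood_grad[OF U \<theta> K]
  have fr: "(LINT y:bd|surf. \<theta> y * (V y \<bullet> nrm y)) = 0" for V
  proof -
    have "\<theta> x = 0" if "x \<in> bd" for x
      using K(2)[of x] K\<Omega> U frontier_disjoint[OF that] frontier_subset_closure that by blast
    then have "indicator bd x *\<^sub>R (\<theta> x * (V x \<bullet> nrm x)) = 0" for x
      by (simp add: indicator_def)
    then show ?thesis unfolding set_lebesgue_integral_def by (simp only: integral_zero)
  qed
  have "\<Omega> \<subseteq> U" using U(2) closure_subset by blast
  then have "\<exists>K. compact K \<and> K \<subseteq> \<Omega> \<and> (\<forall>y\<in>\<Omega> - K. \<theta> y = 0)"
    using K K\<Omega> by (intro exI[of _ K]) blast
  moreover have "0 \<le> (LINT y:\<Omega>|lborel. norm (grad \<theta> y))"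
    unfolding set_lebesgue_integral_def by (rule Bochner_Integration.integral_nonneg) simp
  moreover have "\<bar>LINT y:\<Omega>|lborel. V y \<bullet> grad \<theta> y\<bar> \<le> (LINT y:\<Omega>|lborel. norm (grad \<theta> y)) * M"
    if "continuous_on cl V" "\<forall>x\<in>\<Omega>. norm (V x) \<le> M" for V M
    using grad_bound[OF g(2) that(1), of "\<lambda>_. 1" M] that(2) by simp
  moreover have "((\<lambda>_. 1::real) has_derivative (\<bullet>) (0::real^'n)) (at y)" for y
    by (rule has_derivative_eq_rhs[OF has_derivative_const]) (simp add: fun_eq_iff)
  ultimately show ?thesis
    unfolding cutoff_piece_def by (auto simp: fr C1_on_const)
qed

text \<open>The gradient of the product has two parts: the cut-off gradient of \<theta>, which
  converges by dominated convergence, and the layer term, which yields the surface integral. The two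
  contribute \<open>?N\<close> and \<open>B\<close> to the bound.\<close>

lemma cutoff_piece_boundary:
  fixes \<theta> :: "real^'n \<Rightarrow> real"
  assumes U: "open U" "cl \<subseteq> U" and \<theta>: "C1_on U U \<theta>"
    and K: "compact K" "\<And>x. x \<in> U - K \<Longrightarrow> \<theta> x = 0"
    and c: "graph_chart \<Omega> k s \<gamma> W" and KW: "K \<subseteq> W"
  shows "\<exists>c dc B. cutoff_piece \<theta> c dc B"
proof -
  interpret graph_chart \<Omega> k s \<gamma> W by (rule c)
  note g = C1_on_neighbourhood_grad[OF U \<theta> K]
  have K': "\<And>x. x \<in> cl - K \<Longrightarrow> \<theta> x = 0" using K U by auto
  obtain B where B: "0 \<le> B" "\<And>V M m. continuous_on cl V \<Longrightarrow> 0 \<le> M \<Longrightarrow> (\<And>x. x \<in> \<Omega> \<Longrightarrow> norm (V x) \<le> M) \<Longrightarrow>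
    \<bar>LINT x:\<Omega>|lborel. (\<theta> x * (V x \<bullet> cn x)) * layer m x\<bar> \<le> B * M"
    using layer_vector_bound[OF c g(1) K(1) KW K'] by blast
  let ?c = "\<lambda>m x. step_fun (real (Suc m) * ht x)" and ?dc = "\<lambda>m x. layer m x *\<^sub>R cn x"
  let ?N = "LINT y:\<Omega>|lborel. norm (grad \<theta> y)"
  have cC: "C1_on UNIV UNIV (?c m)" for m
    by (intro C1_on_step_fun C1_on_mult C1_on_const ht_C1)
  have cc: "continuous_on S (?c m)" for m S
    using C1_on_continuous[OF cC] by (rule continuous_on_subset) simp
  have dcc: "continuous_on UNIV (?dc m)" for m
    by (intro continuous_intros continuous_layer continuous_cn)
  have supp: "\<exists>K. compact K \<and> K \<subseteq> \<Omega> \<and> (\<forall>y\<in>\<Omega> - K. \<theta> y * ?c m y = 0)" for m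
  proof (intro exI[of _ "K \<inter> {x. 1 \<le> real (Suc m) * ht x}"] conjI ballI cutoff_support[OF K(1) KW, of m])
    fix y assume y: "y \<in> \<Omega> - K \<inter> {x. 1 \<le> real (Suc m) * ht x}"
    show "\<theta> y * ?c m y = 0"
      using y K'[of y] closure_subset[of \<Omega>] step_fun_eq_0[of "real (Suc m) * ht y"] by (cases "y \<in> K") auto
  qed
  have lim1: "(\<lambda>m. \<theta> y * ?c m y) \<longlonglongrightarrow> \<theta> y" if "y \<in> \<Omega>" for y
  proof (cases "y \<in> K")
    case True
    then show ?thesis using tendsto_mult[OF tendsto_const cutoff_limit[OF that], of "\<theta> y"] KW by auto
  next
    case False
    moreover have "y \<in> cl" using that closure_subset by auto
    ultimately show ?thesis using K'[of y] by simp
  qed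
  have split: "(LINT y:\<Omega>|lborel. V y \<bullet> (?c m y *\<^sub>R grad \<theta> y + \<theta> y *\<^sub>R ?dc m y)) =
      (LINT y:\<Omega>|lborel. ?c m y * (V y \<bullet> grad \<theta> y)) + (LINT x:\<Omega>|lborel. (\<theta> x * (V x \<bullet> cn x)) * layer m x)"
    if V: "continuous_on cl V" for V m
  proof -
    have "set_integrable lborel \<Omega> (\<lambda>y. ?c m y * (V y \<bullet> grad \<theta> y))"
      by (intro set_integrable_closure continuous_on_mult cc continuous_on_inner V g)
    moreover have "set_integrable lborel \<Omega> (\<lambda>x. (\<theta> x * (V x \<bullet> cn x)) * layer m x)"
      by (intro set_integrable_closure continuous_on_mult continuous_layer continuous_on_inner V g
          continuous_on_subset[OF continuous_cn]) auto
    ultimately show ?thesis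
      by (subst set_integral_add(2)[symmetric]) (auto simp: inner_add_right mult_ac)
  qed
  have lim: "(\<lambda>m. LINT y:\<Omega>|lborel. V y \<bullet> (?c m y *\<^sub>R grad \<theta> y + \<theta> y *\<^sub>R ?dc m y)) \<longlonglongrightarrow>
        (LINT y:\<Omega>|lborel. V y \<bullet> grad \<theta> y) - (LINT y:bd|surf. \<theta> y * (V y \<bullet> nrm y))"
    if V: "continuous_on cl V" for V
  proof -
    have Vg: "set_integrable lborel \<Omega> (\<lambda>y. V y \<bullet> grad \<theta> y)"
      by (intro set_integrable_closure continuous_on_inner V g)
    have "(\<lambda>m. LINT y:\<Omega>|lborel. ?c m y * (V y \<bullet> grad \<theta> y)) \<longlonglongrightarrow> (LINT y:\<Omega>|lborel. 1 * (V y \<bullet> grad \<theta> y))"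
    proof (rule set_integral_cutoff_limit(2)[OF Vg])
      show "set_borel_measurable lborel \<Omega> (?c m)" for m
        using open_\<Omega> by (intro set_borel_measurable_continuous_lborel cc) auto
      show "\<bar>?c m x\<bar> \<le> 1" for m x using step_fun_bounds by simp
      show "set_borel_measurable lborel \<Omega> (\<lambda>_. 1::real)"
        using open_\<Omega> by (intro set_borel_measurable_continuous_lborel) auto
      show "(\<lambda>m. ?c m x * (V x \<bullet> grad \<theta> x)) \<longlonglongrightarrow> 1 * (V x \<bullet> grad \<theta> x)" if x: "x \<in> \<Omega>" for x
      proof (cases "x \<in> K")
        case True
        then show ?thesis using KW by (intro tendsto_mult[OF cutoff_limit[OF x] tendsto_const]) auto
      next
        case False
        then show ?thesis using g(3)[of x] x U closure_subset[of \<Omega>] by auto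
      qed
    qed (use open_\<Omega> in auto)
    from tendsto_add[OF this layer_vector_limit[OF c g(1) K(1) KW K' V]]
    show ?thesis unfolding split[OF V] by (simp only: mult_1_left add_uminus_conv_diff)
  qed
  have bound: "\<bar>LINT y:\<Omega>|lborel. V y \<bullet> (?c m y *\<^sub>R grad \<theta> y + \<theta> y *\<^sub>R ?dc m y)\<bar> \<le> (?N + B) * M"
    if V: "continuous_on cl V" "0 \<le> M" "\<forall>x\<in>\<Omega>. norm (V x) \<le> M" for V M m
  proof -
    have "\<bar>LINT y:\<Omega>|lborel. ?c m y * (V y \<bullet> grad \<theta> y)\<bar> \<le> ?N * M"
      by (rule grad_bound[OF g(2) V(1) cc]) (use step_fun_bounds V in auto)
    moreover have "\<bar>LINT x:\<Omega>|lborel. (\<theta> x * (V x \<bullet> cn x)) * layer m x\<bar> \<le> B * M"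
      by (rule B(2)) (use V in auto)
    ultimately show ?thesis unfolding split[OF V(1)] by (simp add: distrib_right)
  qed
  have "0 \<le> ?N" unfolding set_lebesgue_integral_def by (rule Bochner_Integration.integral_nonneg) simp
  then have "cutoff_piece \<theta> ?c ?dc (?N + B)"
    unfolding cutoff_piece_def
    by (intro conjI allI ballI impI cC dcc step_fun_bounds layer_cutoff_derivative supp lim1 lim bound add_nonneg_nonneg B(1)) auto
  then show ?thesis by blast
qed

text \<open>
  The gradients \<open>G m\<close> of the cutoffs \<open>X m\<close> tend weakly to minus the outward normal times surface measure.
\<close>

definition boundary_cutoff :: "(nat \<Rightarrow> real^'n \<Rightarrow> real) \<Rightarrow> (nat \<Rightarrow> real^'n \<Rightarrow> real^'n) \<Rightarrow> real \<Rightarrow> bool" where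
  "boundary_cutoff X G B \<longleftrightarrow>
    (\<forall>m. C1_on \<Omega> \<Omega> (X m) \<and> continuous_on cl (X m) \<and> continuous_on cl (G m)) \<and>
    (\<forall>m. \<forall>y\<in>\<Omega>. 0 \<le> X m y \<and> X m y \<le> 1 \<and> (X m has_derivative (\<lambda>h. G m y \<bullet> h)) (at y)) \<and>
    (\<forall>m. \<exists>K. compact K \<and> K \<subseteq> \<Omega> \<and> (\<forall>y\<in>\<Omega> - K. X m y = 0)) \<and>
    (\<forall>y\<in>\<Omega>. (\<lambda>m. X m y) \<longlonglongrightarrow> 1) \<and>
    0 \<le> B \<and>
    (\<forall>V. continuous_on cl V \<longrightarrow>
      (\<lambda>m. LINT y:\<Omega>|lborel. V y \<bullet> G m y) \<longlonglongrightarrow>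
        - (LINT y:bd|surf. V y \<bullet> nrm y)) \<and>
    (\<forall>V M m. continuous_on cl V \<longrightarrow> 0 \<le> M \<longrightarrow> (\<forall>x\<in>\<Omega>. norm (V x) \<le> M) \<longrightarrow>
      \<bar>LINT y:\<Omega>|lborel. V y \<bullet> G m y\<bar> \<le> B * M)"

text \<open>Every point of the closure has a ball that lies in \<Omega> or in a chart. A partition
  of unity for finitely many of them splits 1 into pieces that can be cut separately, and the sum of
  the cut pieces is the cutoff.\<close>

lemma exists_boundary_cutoff: "\<exists>X G B. boundary_cutoff X G B"
proof -
  have "\<exists>r. 0 < r \<and> (cball x r \<subseteq> \<Omega> \<or> (\<exists>k s \<gamma> W. graph_chart \<Omega> k s \<gamma> W \<and> cball x r \<subseteq> W))"
    if x: "x \<in> cl" for x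
  proof (cases "x \<in> \<Omega>")
    case True
    then show ?thesis using open_\<Omega> open_contains_cball by blast
  next
    case False
    then have "x \<in> bd" using x open_\<Omega> by (simp add: frontier_def interior_open)
    then obtain k s \<gamma> W where c: "graph_chart \<Omega> k s \<gamma> W" "x \<in> W" by (rule frontier_chart)
    then obtain r where "0 < r" "cball x r \<subseteq> W"
      using graph_chart.open_W[OF c(1)] open_contains_cball by blast
    then show ?thesis using c(1) by blast
  qed
  then have "\<forall>x\<in>cl. \<exists>r. 0 < r \<and> (cball x r \<subseteq> \<Omega> \<or> (\<exists>k s \<gamma> W. graph_chart \<Omega> k s \<gamma> W \<and> cball x r \<subseteq> W))"
    by blast
  then obtain r where r: "\<And>x. x \<in> cl \<Longrightarrow> 0 < r x"
    "\<And>x. x \<in> cl \<Longrightarrow> cball x (r x) \<subseteq> \<Omega> \<or> (\<exists>k s \<gamma> W. graph_chart \<Omega> k s \<gamma> W \<and> cball x (r x) \<subseteq> W)"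
    unfolding bchoice_iff by blast
  obtain C where C: "C \<subseteq> cl" "finite C" "cl \<subseteq> (\<Union>x\<in>C. ball x (r x))"
    using compactE_image[OF compact_closure, of "cl" "\<lambda>x. ball x (r x)"] r(1) by force
  have rC: "0 < r x" if "x \<in> C" for x using C(1) r(1) that by auto
  define b where "b x y = pos_sq ((r x)\<^sup>2 - (norm (y - x))\<^sup>2)" for x y
  define S where "S y = (\<Sum>x\<in>C. b x y)" for y
  define U where "U = {y. 0 < S y}"
  \<comment> \<open>Division by the sum makes the bumps add up to 1 on \<open>U\<close>. As
    \<open>U\<close> is an open neighbourhood of the closure, the gradients exist at boundary points
    as well. Off \<open>U\<close> the convention \<open>inverse 0 = 0\<close> gives the value
    0.\<close>
  define \<theta> where "\<theta> x y = b x y * inverse (S y)" for x y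
  have bC: "C1_on UNIV UNIV (b x)" for x unfolding b_def by (rule bump_C1)
  have SC: "C1_on UNIV UNIV S" unfolding S_def by (intro C1_on_sum bC)
  have b0: "0 \<le> b x y" for x y by (simp add: b_def)
  have bpos: "0 < b x y \<longleftrightarrow> y \<in> ball x (r x)" if "x \<in> C" for x y
    unfolding b_def by (rule bump_C1(2)[OF rC[OF that]])
  have Uo: "open U"
    unfolding U_def using open_Collect_less[OF continuous_on_const C1_on_continuous[OF SC], of 0] by simp
  have clU: "cl \<subseteq> U"
  proof
    fix y assume "y \<in> cl"
    then obtain x where "x \<in> C" "y \<in> ball x (r x)" using C(3) by auto
    then have "0 < b x y" "b x y \<le> S y"
      unfolding S_def using bpos b0 C(2) by (auto intro: member_le_sum)
    then show "y \<in> U" by (simp add: U_def)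
  qed
  have \<Omega>U: "\<Omega> \<subseteq> U" using clU closure_subset by blast
  have \<theta>C: "C1_on U U (\<theta> x)" for x
    unfolding \<theta>_def
    by (intro C1_on_mult C1_on_inverse C1_on_subset[OF bC] C1_on_subset[OF SC]) (auto simp: U_def)
  have \<theta>0: "0 \<le> \<theta> x y" for x y unfolding \<theta>_def S_def by (simp add: b0 sum_nonneg)
  have \<theta>K: "\<theta> x y = 0" if "x \<in> C" "y \<notin> cball x (r x)" for x y
    using bpos[OF that(1), of y] b0[of x y] that(2) by (auto simp: \<theta>_def)
  have \<theta>1: "(\<Sum>x\<in>C. \<theta> x y) = 1" if "y \<in> U" for y
    unfolding \<theta>_def sum_distrib_right[symmetric] S_def[symmetric] using that by (simp add: U_def)
  have "\<forall>x\<in>C. \<exists>p. cutoff_piece (\<theta> x) (fst p) (fst (snd p)) (snd (snd p))"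
  proof
    fix x assume x: "x \<in> C"
    have K: "\<And>y. y \<in> U - cball x (r x) \<Longrightarrow> \<theta> x y = 0" using \<theta>K[OF x] by auto
    have "\<exists>c dc B. cutoff_piece (\<theta> x) c dc B"
    proof (cases "cball x (r x) \<subseteq> \<Omega>")
      case True
      show ?thesis using cutoff_piece_interior[OF Uo clU \<theta>C compact_cball K True] by blast
    next
      case False
      then obtain k s \<gamma> W where c: "graph_chart \<Omega> k s \<gamma> W" "cball x (r x) \<subseteq> W" using r(2)[of x] x C(1) by blast
      show ?thesis by (rule cutoff_piece_boundary[OF Uo clU \<theta>C compact_cball K c])
    qed
    then obtain c dc B where "cutoff_piece (\<theta> x) c dc B" by blast
    then show "\<exists>p. cutoff_piece (\<theta> x) (fst p) (fst (snd p)) (snd (snd p))"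
      by (intro exI[of _ "(c, dc, B)"]) simp
  qed
  then obtain pc where pc: "\<And>x. x \<in> C \<Longrightarrow> cutoff_piece (\<theta> x) (fst (pc x)) (fst (snd (pc x))) (snd (snd (pc x)))"
    unfolding bchoice_iff by blast
  define c where "c x = fst (pc x)" for x
  define dc where "dc x = fst (snd (pc x))" for x
  define B where "B x = snd (snd (pc x))" for x
  have P: "cutoff_piece (\<theta> x) (c x) (dc x) (B x)" if "x \<in> C" for x
    using pc[OF that] by (simp add: c_def dc_def B_def)
  have cC: "C1_on UNIV UNIV (c x m)" and dcc: "continuous_on UNIV (dc x m)"
    and cb: "0 \<le> c x m y" "c x m y \<le> 1" and cd: "(c x m has_derivative (\<lambda>h. dc x m y \<bullet> h)) (at y)"
    and csupp: "\<exists>K. compact K \<and> K \<subseteq> \<Omega> \<and> (\<forall>y\<in>\<Omega> - K. \<theta> x y * c x m y = 0)"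
    and clim: "y \<in> \<Omega> \<Longrightarrow> (\<lambda>m. \<theta> x y * c x m y) \<longlonglongrightarrow> \<theta> x y"
    and B0: "0 \<le> B x"
    and Vlim: "continuous_on cl V \<Longrightarrow> (\<lambda>m. LINT y:\<Omega>|lborel. V y \<bullet> (c x m y *\<^sub>R grad (\<theta> x) y + \<theta> x y *\<^sub>R dc x m y)) \<longlonglongrightarrow>
        (LINT y:\<Omega>|lborel. V y \<bullet> grad (\<theta> x) y) - (LINT y:bd|surf. \<theta> x y * (V y \<bullet> nrm y))"
    and Vbd: "continuous_on cl V \<Longrightarrow> 0 \<le> M \<Longrightarrow> (\<forall>x\<in>\<Omega>. norm (V x) \<le> M) \<Longrightarrow>
      \<bar>LINT y:\<Omega>|lborel. V y \<bullet> (c x m y *\<^sub>R grad (\<theta> x) y + \<theta> x y *\<^sub>R dc x m y)\<bar> \<le> B x * M"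
    if "x \<in> C" for x m y V M
    using P[OF that] unfolding cutoff_piece_def by blast+
  define X where "X m y = (\<Sum>x\<in>C. \<theta> x y * c x m y)" for m y
  define G where "G m y = (\<Sum>x\<in>C. c x m y *\<^sub>R grad (\<theta> x) y + \<theta> x y *\<^sub>R dc x m y)" for m y
  have \<theta>c: "continuous_on cl (\<theta> x)" and g\<theta>c: "continuous_on cl (grad (\<theta> x))"
    and \<theta>d: "y \<in> U \<Longrightarrow> (\<theta> x has_derivative (\<lambda>h. grad (\<theta> x) y \<bullet> h)) (at y)" for x y
    using C1_on_continuous[OF \<theta>C] C1_on_open_grad[OF \<theta>C] clU by (auto intro: continuous_on_subset)
  have cc: "continuous_on cl (c x m)" if "x \<in> C" for x m
    using C1_on_continuous[OF cC[OF that]] by (rule continuous_on_subset) simp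
  have dcc': "continuous_on cl (dc x m)" if "x \<in> C" for x m
    using dcc[OF that] by (rule continuous_on_subset) simp
  have gc: "continuous_on cl (\<lambda>y. c x m y *\<^sub>R grad (\<theta> x) y + \<theta> x y *\<^sub>R dc x m y)" if "x \<in> C" for x m
    by (intro continuous_on_add continuous_on_scaleR cc that dcc' \<theta>c g\<theta>c)
  have Gsum: "(LINT y:\<Omega>|lborel. V y \<bullet> G m y) =
      (\<Sum>x\<in>C. LINT y:\<Omega>|lborel. V y \<bullet> (c x m y *\<^sub>R grad (\<theta> x) y + \<theta> x y *\<^sub>R dc x m y))"
    if V: "continuous_on cl V" for V m
    unfolding G_def inner_sum_right
    by (rule set_integral_sum) (intro set_integrable_closure continuous_on_inner V gc)
  have "boundary_cutoff X G (\<Sum>x\<in>C. B x)"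
    unfolding boundary_cutoff_def
  proof (intro conjI allI ballI impI)
    show "C1_on \<Omega> \<Omega> (X m)" for m
      unfolding X_def using \<Omega>U by (intro C1_on_sum C1_on_mult C1_on_subset[OF \<theta>C] C1_on_subset[OF cC]) auto
    show "continuous_on cl (X m)" for m
      unfolding X_def by (intro continuous_on_sum continuous_on_mult cc \<theta>c)
    show "continuous_on cl (G m)" for m
      unfolding G_def by (intro continuous_on_sum gc)
    show "0 \<le> X m y" for m y unfolding X_def by (intro sum_nonneg mult_nonneg_nonneg \<theta>0 cb)
    show "X m y \<le> 1" if "y \<in> \<Omega>" for m y
    proof -
      have "X m y \<le> (\<Sum>x\<in>C. \<theta> x y)"
        unfolding X_def by (intro sum_mono) (simp add: mult_left_le \<theta>0 cb)
      then show ?thesis using \<theta>1[of y] \<Omega>U that by auto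
    qed
    show "(X m has_derivative (\<lambda>h. G m y \<bullet> h)) (at y)" if y: "y \<in> \<Omega>" for m y
    proof -
      have yU: "y \<in> U" using \<Omega>U y by auto
      have "((\<lambda>y. \<Sum>x\<in>C. \<theta> x y * c x m y) has_derivative
          (\<lambda>h. \<Sum>x\<in>C. \<theta> x y * (dc x m y \<bullet> h) + (grad (\<theta> x) y \<bullet> h) * c x m y)) (at y)"
        by (intro has_derivative_sum has_derivative_mult \<theta>d[OF yU] cd)
      then show ?thesis
        unfolding X_def G_def by (simp add: inner_sum_left inner_add_left algebra_simps)
    qed
    show "\<exists>K. compact K \<and> K \<subseteq> \<Omega> \<and> (\<forall>y\<in>\<Omega> - K. X m y = 0)" for m
    proof -
      have "\<forall>x\<in>C. \<exists>K. compact K \<and> K \<subseteq> \<Omega> \<and> (\<forall>y\<in>\<Omega> - K. \<theta> x y * c x m y = 0)" using csupp by blast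
      then obtain K where K: "\<And>x. x \<in> C \<Longrightarrow> compact (K x) \<and> K x \<subseteq> \<Omega> \<and> (\<forall>y\<in>\<Omega> - K x. \<theta> x y * c x m y = 0)"
        unfolding bchoice_iff by blast
      show ?thesis
      proof (intro exI[of _ "\<Union>x\<in>C. K x"] conjI ballI)
        show "compact (\<Union>x\<in>C. K x)" using C(2) K by (intro compact_UN) auto
        show "(\<Union>x\<in>C. K x) \<subseteq> \<Omega>" using K by blast
        show "X m y = 0" if "y \<in> \<Omega> - (\<Union>x\<in>C. K x)" for y
          unfolding X_def by (rule sum.neutral) (use K that in blast)
      qed
    qed
    show "(\<lambda>m. X m y) \<longlonglongrightarrow> 1" if y: "y \<in> \<Omega>" for y
    proof -
      have "(\<lambda>m. X m y) \<longlonglongrightarrow> (\<Sum>x\<in>C. \<theta> x y)"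
        unfolding X_def by (intro tendsto_sum clim y)
      then show ?thesis using \<theta>1[of y] \<Omega>U y by auto
    qed
    show "0 \<le> (\<Sum>x\<in>C. B x)" by (intro sum_nonneg B0)
    show "\<bar>LINT y:\<Omega>|lborel. V y \<bullet> G m y\<bar> \<le> (\<Sum>x\<in>C. B x) * M"
      if "continuous_on cl V" "0 \<le> M" "\<forall>x\<in>\<Omega>. norm (V x) \<le> M" for V M m
      unfolding Gsum[OF that(1)] sum_distrib_right
      by (rule order_trans[OF sum_abs]) (intro sum_mono Vbd that)
    show "(\<lambda>m. LINT y:\<Omega>|lborel. V y \<bullet> G m y) \<longlonglongrightarrow>
        - (LINT y:bd|surf. V y \<bullet> nrm y)"
      if V: "continuous_on cl V" for V
    proof -
      let ?n = "nrm"
      have lim: "(\<lambda>m. LINT y:\<Omega>|lborel. V y \<bullet> G m y) \<longlonglongrightarrow>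
        (\<Sum>x\<in>C. (LINT y:\<Omega>|lborel. V y \<bullet> grad (\<theta> x) y) - (LINT y:bd|surf. \<theta> x y * (V y \<bullet> ?n y)))"
        unfolding Gsum[OF V] by (intro tendsto_sum Vlim V)
      have "(\<Sum>x\<in>C. LINT y:\<Omega>|lborel. V y \<bullet> grad (\<theta> x) y) = (LINT y:\<Omega>|lborel. (\<Sum>x\<in>C. V y \<bullet> grad (\<theta> x) y))"
        by (rule set_integral_sum[symmetric]) (intro set_integrable_closure continuous_on_inner V g\<theta>c)
      also have "\<dots> = (LINT y:\<Omega>|lborel. 0)"
      proof (rule set_lebesgue_integral_cong)
        show "\<forall>y. y \<in> \<Omega> \<longrightarrow> (\<Sum>x\<in>C. V y \<bullet> grad (\<theta> x) y) = 0"
        proof (intro allI impI)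
          fix y assume "y \<in> \<Omega>"
          then have yU: "y \<in> U" using \<Omega>U by auto
          have "((\<lambda>y. \<Sum>x\<in>C. \<theta> x y) has_derivative (\<lambda>h. \<Sum>x\<in>C. grad (\<theta> x) y \<bullet> h)) (at y)"
            by (intro has_derivative_sum \<theta>d[OF yU])
          then have 1: "((\<lambda>y. \<Sum>x\<in>C. \<theta> x y) has_derivative (\<lambda>h. (\<Sum>x\<in>C. grad (\<theta> x) y) \<bullet> h)) (at y)"
            by (simp add: inner_sum_left)
          have 2: "((\<lambda>y. \<Sum>x\<in>C. \<theta> x y) has_derivative (\<lambda>h. 0 \<bullet> h)) (at y)"
            by (rule has_derivative_transform_within_open[of "\<lambda>_. 1" _ _ _ U]) (use yU Uo \<theta>1 in auto)
          \<comment> \<open>The partition sums to the constant 1 on an open set, so the volume terms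
            of the pieces cancel in the limit and only the surface integrals remain.\<close>
          have "(\<Sum>x\<in>C. grad (\<theta> x) y) = 0" using grad_unique[OF 1] grad_unique[OF 2] by simp
          then show "(\<Sum>x\<in>C. V y \<bullet> grad (\<theta> x) y) = 0" by (simp add: inner_sum_right[symmetric])
        qed
      qed (use open_\<Omega> in auto)
      also have "\<dots> = 0" by simp
      finally have z: "(\<Sum>x\<in>C. LINT y:\<Omega>|lborel. V y \<bullet> grad (\<theta> x) y) = 0" .
      have "(\<Sum>x\<in>C. LINT y:bd|surf. \<theta> x y * (V y \<bullet> ?n y)) =
        (LINT y:bd|surf. (\<Sum>x\<in>C. \<theta> x y * (V y \<bullet> ?n y)))"
        by (rule set_integral_sum[symmetric])
          (intro set_integrable_frontier continuous_on_mult continuous_on_inner continuous_outward_unit_normal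
            continuous_on_subset[OF \<theta>c frontier_subset_closure] continuous_on_subset[OF V frontier_subset_closure])
      also have "\<dots> = (LINT y:bd|surf. V y \<bullet> ?n y)"
      proof (rule set_lebesgue_integral_cong)
        show "\<forall>y. y \<in> bd \<longrightarrow> (\<Sum>x\<in>C. \<theta> x y * (V y \<bullet> ?n y)) = V y \<bullet> ?n y"
          using \<theta>1 clU frontier_subset_closure by (auto simp: sum_distrib_right[symmetric] subset_iff)
      qed auto
      finally show ?thesis using lim z by (simp add: sum_subtractf)
    qed
  qed
  then show ?thesis by blast
qed

end

section \<open>The weak Euler equation up to the boundary\<close>

text \<open>No bound for \<open>f\<close> on all of \<open>K \<times> J\<close> is available, since
  \<open>J\<close> may be open. A convergent sequence together with its limit is compact, though,
  and along it dominated convergence applies with a constant majorant.\<close>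

lemma continuous_on_set_integral_parameter:
  fixes f :: "'a::euclidean_space \<times> real \<Rightarrow> real"
  assumes f: "continuous_on (K \<times> J) f" and K: "compact K" "S \<subseteq> K"
    and M: "sets M = sets borel" "S \<in> sets borel" "emeasure M S < \<infinity>"
  shows "continuous_on J (\<lambda>t. LINT x:S|M. f (x, t))"
  unfolding continuous_on_sequentially
proof (intro allI ballI impI, elim conjE)
  fix \<tau> :: "nat \<Rightarrow> real" and t assume t: "t \<in> J" "\<forall>n. \<tau> n \<in> J" "\<tau> \<longlonglongrightarrow> t"
  have "compact (K \<times> insert t (range \<tau>))"
    by (intro compact_Times K compact_sequence_with_limit t)
  moreover have sub: "K \<times> insert t (range \<tau>) \<subseteq> K \<times> J" using t by auto
  ultimately have "bounded (f ` (K \<times> insert t (range \<tau>)))"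
    by (intro compact_imp_bounded compact_continuous_image continuous_on_subset[OF f])
  then obtain C where C: "\<And>q. q \<in> K \<times> insert t (range \<tau>) \<Longrightarrow> norm (f q) \<le> C"
    unfolding bounded_iff by blast
  have slice: "continuous_on S (\<lambda>x. f (x, s))" if "s \<in> J" for s
    by (rule continuous_on_compose2[OF f]) (use K that in \<open>auto intro!: continuous_intros\<close>)
  have meas: "(\<lambda>x. indicator S x *\<^sub>R f (x, s)) \<in> borel_measurable M" if "s \<in> J" for s
    unfolding measurable_cong_sets[OF M(1) refl]
    by (rule borel_measurable_continuous_on_indicator[OF M(2) slice[OF that]])
  have "(\<lambda>n. LINT x:S|M. f (x, \<tau> n)) \<longlonglongrightarrow> (LINT x:S|M. f (x, t))"
    unfolding set_lebesgue_integral_def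
  proof (rule integral_dominated_convergence[where w = "\<lambda>x. C * indicator S x"])
    show "integrable M (\<lambda>x. C * indicator S x)"
      using M by (intro integrable_mult_right integrable_real_indicator) auto
    show "AE x in M. (\<lambda>n. indicator S x *\<^sub>R f (x, \<tau> n)) \<longlonglongrightarrow> indicator S x *\<^sub>R f (x, t)"
    proof (rule AE_I2)
      fix x
      show "(\<lambda>n. indicator S x *\<^sub>R f (x, \<tau> n)) \<longlonglongrightarrow> indicator S x *\<^sub>R f (x, t)"
      proof (cases "x \<in> S")
        case True
        have "(\<lambda>n. f (x, \<tau> n)) \<longlonglongrightarrow> f (x, t)"
          by (rule continuous_on_tendsto_compose[OF f])
            (use True K t in \<open>auto intro!: tendsto_intros\<close>)
        then show ?thesis by (intro tendsto_intros)
      qed simp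
    qed
    show "AE x in M. norm (indicator S x *\<^sub>R f (x, \<tau> n)) \<le> C * indicator S x" for n
      using C K by (intro AE_I2) (auto simp: indicator_def)
  qed (use meas t in auto)
  then show "((\<lambda>t. LINT x:S|M. f (x, t)) \<circ> \<tau>) \<longlonglongrightarrow> (LINT x:S|M. f (x, t))" by (simp add: o_def)
qed

lemma set_integrable_compact_support:
  fixes a :: "real \<Rightarrow> real"
  assumes "continuous_on I a" "compact J" "J \<subseteq> I" "\<And>t. t \<in> I - J \<Longrightarrow> a t = 0"
  shows "set_integrable lborel I a"
proof -
  have "integrable lborel (\<lambda>t. indicator J t *\<^sub>R a t)"
    by (rule borel_integrable_compact[OF assms(2) continuous_on_subset[OF assms(1,3)]])
  moreover have "indicator J t *\<^sub>R a t = indicator I t *\<^sub>R a t" for t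
    using assms(3) assms(4)[of t] by (auto simp: indicator_def)
  ultimately show ?thesis by (simp only: set_integrable_def)
qed

text \<open>The fundamental lemma of the calculus of variations at one point. If \<open>h t0\<close>
  were nonzero, then \<open>h t * h t0\<close> would be positive near \<open>t0\<close>, whatever
  the sign, and so would its integral against a small bump.\<close>

lemma continuous_bump_orthogonal_zero:
  fixes h :: "real \<Rightarrow> real"
  assumes I: "open I" "t0 \<in> I" and h: "continuous_on I h"
    and orth: "\<And>r. 0 < r \<Longrightarrow> cball t0 r \<subseteq> I \<Longrightarrow> (LINT t:I|lborel. pos_sq (r\<^sup>2 - (norm (t - t0))\<^sup>2) * h t) = 0"
  shows "h t0 = 0"
proof (rule ccontr)
  assume ne: "h t0 \<noteq> 0"
  have "continuous_on I (\<lambda>t. h t * h t0)" by (intro continuous_intros h)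
  then have "open (I \<inter> (\<lambda>t. h t * h t0) -` {0<..})"
    using I(1) by (simp add: continuous_open_preimage)
  moreover have "t0 \<in> I \<inter> (\<lambda>t. h t * h t0) -` {0<..}" using I ne by (auto simp: zero_less_mult_iff)
  ultimately obtain r where r: "0 < r" "cball t0 r \<subseteq> I \<inter> (\<lambda>t. h t * h t0) -` {0<..}"
    unfolding open_contains_cball by blast
  define a where "a t = pos_sq (r\<^sup>2 - (norm (t - t0))\<^sup>2)" for t
  have ac: "continuous_on UNIV a" unfolding a_def by (rule C1_on_continuous[OF bump_C1(1)])
  have apos: "0 < a t \<longleftrightarrow> t \<in> ball t0 r" for t unfolding a_def by (rule bump_C1(2)[OF r(1)])
  have a0: "0 \<le> a t" for t by (simp add: a_def)
  have zero: "a t = 0" if "t \<notin> cball t0 r" for t using apos[of t] a0[of t] that by auto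
  have "set_integrable lborel I (\<lambda>t. a t * (h t * h t0))"
    by (rule set_integrable_compact_support[of _ _ "cball t0 r"])
      (use r zero in \<open>auto intro!: continuous_intros h continuous_on_subset[OF ac]\<close>)
  then have int: "integrable lborel (\<lambda>t. indicator I t *\<^sub>R (a t * (h t * h t0)))" by (simp add: set_integrable_def)
  have nn: "0 \<le> indicator I t *\<^sub>R (a t * (h t * h t0))" for t
    using zero[of t] a0[of t] r(2) by (cases "t \<in> cball t0 r") (auto simp: indicator_def less_imp_le)
  have "(LINT t:I|lborel. a t * h t) = 0"
    unfolding a_def by (rule orth) (use r in auto)
  then have "(LINT t:I|lborel. (a t * h t) * h t0) = 0" by simp
  then have "(LINT t|lborel. indicator I t *\<^sub>R (a t * (h t * h t0))) = 0"
    by (simp add: set_lebesgue_integral_def mult.assoc)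
  then have "AE t in lborel. indicator I t *\<^sub>R (a t * (h t * h t0)) = 0"
    using integral_nonneg_eq_0_iff_AE[OF int] nn by simp
  then have "AE t in lborel. t \<notin> ball t0 r"
  proof eventually_elim
    case (elim t)
    show ?case
    proof
      assume t: "t \<in> ball t0 r"
      then have "t \<in> cball t0 r" by simp
      then have "t \<in> I" "h t * h t0 > 0" using r(2) by blast+
      then show False using elim apos[of t] t by auto
    qed
  qed
  then have "emeasure lborel (ball t0 r) = 0"
    by (subst (asm) AE_iff_measurable[of "ball t0 r"]) auto
  moreover have "ball t0 r = {t0 - r<..<t0 + r}" by (auto simp: dist_real_def)
  ultimately show False using r(1) by simp
qed

text \<open>The Euler integrand as a linear expression in the total space-time derivative
  \<open>A\<close> of the test field: \<open>A (0, 1)\<close> is its time derivative and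
  \<open>A (axis i 1, 0)\<close> its \<open>i\<close>-th space derivative. The product rule can then
  be applied once to the whole integrand.\<close>

definition euler_density where
  "euler_density u p q A = (u q :: real^'n::finite) \<bullet> A (0::real^'n, 1::real) +
    (\<Sum>i\<in>UNIV. \<Sum>j\<in>UNIV. u q $ i * u q $ j * (A (axis i 1, 0) $ j)) +
    (p q :: real) * (\<Sum>i\<in>UNIV. A (axis i 1, 0) $ i)"

abbreviation euler_integrand ::
    "((real^'n::finite) \<times> real \<Rightarrow> real^'n) \<Rightarrow> ((real^'n) \<times> real \<Rightarrow> real) \<Rightarrow> ((real^'n) \<times> real \<Rightarrow> real^'n) \<Rightarrow> real^'n \<Rightarrow> real \<Rightarrow> real"
  where "euler_integrand u p \<psi> x t \<equiv> u (x, t) \<bullet> vector_derivative (\<lambda>s. \<psi> (x, s)) (at t)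
    + frob (tensor (u (x, t)) (u (x, t))) (grad_vec (\<lambda>y. \<psi> (y, t)) x)
    + p (x, t) * divergence (\<lambda>y. \<psi> (y, t)) x"

lemma euler_density_eq:
  fixes \<psi> :: "(real^'n::finite) \<times> real \<Rightarrow> real^'n"
  assumes "(\<psi> has_derivative A) (at (x, t))"
  shows "euler_integrand u p \<psi> x t = euler_density u p (x, t) A"
proof -
  have lin: "linear A" using assms by (rule has_derivative_linear)
  have "((\<lambda>s. \<psi> (x, s)) has_derivative (\<lambda>h. A (0, h))) (at t)"
    by (rule has_derivative_compose[of "\<lambda>s. (x, s)" "\<lambda>h. (0, h)" t UNIV \<psi> A, OF _ assms])
      (rule has_derivative_Pair[OF has_derivative_const has_derivative_ident])
  moreover have "(\<lambda>h. A (0, h)) = (\<lambda>h. h *\<^sub>R A (0, 1))"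
  proof
    show "A (0, h) = h *\<^sub>R A (0, 1)" for h
      using linear_cmul[OF lin, of h "(0, 1)"] by simp
  qed
  ultimately have "((\<lambda>s. \<psi> (x, s)) has_vector_derivative A (0, 1)) (at t)"
    by (simp only: has_vector_derivative_def)
  then have "vector_derivative (\<lambda>s. \<psi> (x, s)) (at t) = A (0, 1)"
    by (rule vector_derivative_at)
  moreover have "((\<lambda>y. \<psi> (y, t)) has_derivative (\<lambda>h. A (h, 0))) (at x)"
    by (rule has_derivative_compose[of "\<lambda>y. (y, t)" "\<lambda>h. (h, 0)" x UNIV \<psi> A, OF _ assms])
      (rule has_derivative_Pair[OF has_derivative_ident has_derivative_const])
  note fd = frechet_derivative_at[OF this]
  have "pderiv_at i (\<lambda>y. \<psi> (y, t)) x = A (axis i 1, 0)" for i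
    unfolding pderiv_at_def by (rule fun_cong[OF fd[symmetric]])
  ultimately show ?thesis
    by (simp add: euler_density_def frob_def tensor_def grad_vec_def divergence_def)
qed

text \<open>The density is linear in the derivative. The extra rank-one term comes from a cutoff
  that does not depend on time, so it has no time component and contributes only through the tensor
  and the pressure.\<close>

lemma euler_density_cutoff:
  fixes v g :: "real^'n::finite"
  assumes A: "\<And>h. A' h = c *\<^sub>R A h + (g \<bullet> fst h) *\<^sub>R v"
  shows "euler_density u p q A' = c * euler_density u p q A + ((u q \<bullet> v) *\<^sub>R u q + p q *\<^sub>R v) \<bullet> g"
proof -
  have 1: "(\<Sum>i\<in>UNIV. \<Sum>j\<in>UNIV. u q $ i * u q $ j * (g $ i * v $ j)) = (u q \<bullet> v) * (u q \<bullet> g)"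
  proof -
    have "(\<Sum>i\<in>UNIV. \<Sum>j\<in>UNIV. u q $ i * u q $ j * (g $ i * v $ j)) = (\<Sum>i\<in>UNIV. \<Sum>j\<in>UNIV. (u q $ i * g $ i) * (u q $ j * v $ j))"
      by (simp add: mult_ac)
    also have "\<dots> = (u q \<bullet> g) * (u q \<bullet> v)"
      unfolding inner_vec_def sum_product by simp
    finally show ?thesis by simp
  qed
  have 2: "(\<Sum>i\<in>UNIV. g $ i * v $ i) = v \<bullet> g" by (simp add: inner_vec_def mult.commute)
  have "euler_density u p q A' = c * euler_density u p q A +
      (\<Sum>i\<in>UNIV. \<Sum>j\<in>UNIV. u q $ i * u q $ j * (g $ i * v $ j)) + p q * (\<Sum>i\<in>UNIV. g $ i * v $ i)"
    by (simp add: euler_density_def A inner_axis distrib_left sum.distrib sum_distrib_left inner_add_right mult_ac)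
  then show ?thesis unfolding 1 2 by (simp add: inner_add_left)
qed

lemma continuous_euler_density:
  fixes D :: "(real^'n::finite) \<times> real \<Rightarrow> ((real^'n) \<times> real) \<Rightarrow>\<^sub>L (real^'n)"
  assumes "continuous_on S u" "continuous_on S p" "continuous_on S D"
  shows "continuous_on S (\<lambda>q. euler_density u p q (blinfun_apply (D q)))"
  unfolding euler_density_def by (intro continuous_intros assms)

context C2_domain begin

lemma boundary_cutoffD:
  assumes "boundary_cutoff X G B"
  shows "C1_on \<Omega> \<Omega> (X m)" "continuous_on cl (X m)" "continuous_on cl (G m)"
    "y \<in> \<Omega> \<Longrightarrow> 0 \<le> X m y" "y \<in> \<Omega> \<Longrightarrow> X m y \<le> 1" "y \<in> \<Omega> \<Longrightarrow> (X m has_derivative (\<lambda>h. G m y \<bullet> h)) (at y)"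
    "\<exists>K. compact K \<and> K \<subseteq> \<Omega> \<and> (\<forall>y\<in>\<Omega> - K. X m y = 0)"
    "y \<in> \<Omega> \<Longrightarrow> (\<lambda>m. X m y) \<longlonglongrightarrow> 1" "0 \<le> B"
    "continuous_on cl V \<Longrightarrow> (\<lambda>m. LINT y:\<Omega>|lborel. V y \<bullet> G m y) \<longlonglongrightarrow>
        - (LINT y:bd|surf. V y \<bullet> nrm y)"
    "continuous_on cl V \<Longrightarrow> 0 \<le> M \<Longrightarrow> (\<And>x. x \<in> \<Omega> \<Longrightarrow> norm (V x) \<le> M) \<Longrightarrow>
      \<bar>LINT y:\<Omega>|lborel. V y \<bullet> G m y\<bar> \<le> B * M"
  using assms unfolding boundary_cutoff_def by blast+

lemma finite_\<Omega>: "emeasure lborel \<Omega> < \<infinity>" by (rule emeasure_bounded_finite[OF bounded_\<Omega>])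

lemma \<Omega>_borel: "\<Omega> \<in> sets borel" using open_\<Omega> by simp

text \<open>Meant for one fixed time: the first claim gives the pointwise limit, the second the
  bound, free of \<open>m\<close>, that permits integrating this limit over time.\<close>

lemma cutoff_integral:
  fixes I :: "real^'n \<Rightarrow> real"
  assumes X: "boundary_cutoff X G B" and I: "continuous_on cl I" and V: "continuous_on cl V"
  shows "(\<lambda>m. LINT x:\<Omega>|lborel. X m x * I x + V x \<bullet> G m x) \<longlonglongrightarrow>
      (LINT x:\<Omega>|lborel. I x) - (LINT x:bd|surf. V x \<bullet> nrm x)"
    and "(\<And>x. x \<in> \<Omega> \<Longrightarrow> \<bar>I x\<bar> \<le> M1) \<Longrightarrow> 0 \<le> M2 \<Longrightarrow> (\<And>x. x \<in> \<Omega> \<Longrightarrow> norm (V x) \<le> M2) \<Longrightarrow>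
      \<bar>LINT x:\<Omega>|lborel. X m x * I x + V x \<bullet> G m x\<bar> \<le> M1 * measure lborel \<Omega> + B * M2"
proof -
  note Xd = boundary_cutoffD[OF X]
  have i1: "set_integrable lborel \<Omega> (\<lambda>x. X m x * I x)" for m
    by (intro set_integrable_closure continuous_on_mult Xd I)
  have i2: "set_integrable lborel \<Omega> (\<lambda>x. V x \<bullet> G m x)" for m
    by (intro set_integrable_closure continuous_on_inner Xd V)
  have split: "(LINT x:\<Omega>|lborel. X m x * I x + V x \<bullet> G m x) =
      (LINT x:\<Omega>|lborel. X m x * I x) + (LINT x:\<Omega>|lborel. V x \<bullet> G m x)" for m
    by (rule set_integral_add(2)[OF i1 i2])
  have "(\<lambda>m. LINT x:\<Omega>|lborel. X m x * I x) \<longlonglongrightarrow> (LINT x:\<Omega>|lborel. 1 * I x)"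
  proof (rule set_integral_cutoff_limit(2)[OF set_integrable_closure[OF I]])
    show "set_borel_measurable lborel \<Omega> (X m)" for m
      using C1_on_continuous[OF Xd(1)] \<Omega>_borel by (rule set_borel_measurable_continuous_lborel)
    show "set_borel_measurable lborel \<Omega> (\<lambda>_. 1::real)"
      using \<Omega>_borel by (intro set_borel_measurable_continuous_lborel) auto
    show "\<bar>X m x\<bar> \<le> 1" if "x \<in> \<Omega>" for m x using Xd(4,5)[OF that, of m] by simp
    show "(\<lambda>m. X m x * I x) \<longlonglongrightarrow> 1 * I x" if "x \<in> \<Omega>" for x
      by (intro tendsto_mult tendsto_const Xd(8) that)
  qed (use \<Omega>_borel in auto)
  from tendsto_add[OF this Xd(10)[OF V]]
  show "(\<lambda>m. LINT x:\<Omega>|lborel. X m x * I x + V x \<bullet> G m x) \<longlonglongrightarrow>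
      (LINT x:\<Omega>|lborel. I x) - (LINT x:bd|surf. V x \<bullet> nrm x)"
    unfolding split by (simp only: mult_1_left add_uminus_conv_diff)
  assume M1: "\<And>x. x \<in> \<Omega> \<Longrightarrow> \<bar>I x\<bar> \<le> M1" and M2: "0 \<le> M2" "\<And>x. x \<in> \<Omega> \<Longrightarrow> norm (V x) \<le> M2"
  have "\<bar>LINT x:\<Omega>|lborel. X m x * I x\<bar> \<le> (LINT x|lborel. M1 * indicator \<Omega> x)"
    unfolding set_lebesgue_integral_def
  proof (rule integral_abs_bound[THEN order_trans], rule integral_mono)
    show "integrable lborel (\<lambda>x. \<bar>indicator \<Omega> x *\<^sub>R (X m x * I x)\<bar>)"
      using i1[of m] by (intro integrable_abs) (simp only: set_integrable_def)
    show "integrable lborel (\<lambda>x. M1 * indicator \<Omega> x)"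
      using finite_\<Omega> \<Omega>_borel by (intro integrable_mult_right integrable_real_indicator) auto
    show "\<bar>indicator \<Omega> x *\<^sub>R (X m x * I x)\<bar> \<le> M1 * indicator \<Omega> x" for x
    proof (cases "x \<in> \<Omega>")
      case True
      have "\<bar>X m x\<bar> * \<bar>I x\<bar> \<le> 1 * M1"
        using Xd(4,5)[OF True, of m] M1[OF True] by (intro mult_mono) auto
      then show ?thesis using True by (simp add: abs_mult)
    qed simp
  qed
  also have "\<dots> = M1 * measure lborel \<Omega>" using \<Omega>_borel by simp
  finally show "\<bar>LINT x:\<Omega>|lborel. X m x * I x + V x \<bullet> G m x\<bar> \<le> M1 * measure lborel \<Omega> + B * M2"
    unfolding split using Xd(11)[OF V M2, of m] by linarith
qed

text \<open>The products \<open>X m * \<phi>\<close> are admissible in the weak divergence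
  condition. Their gradients produce in the limit the surface integral of \<phi> times the normal
  component of \<open>v\<close>, which is zero. \<open>F\<close> extends the gradient of \<phi> to
  the boundary.\<close>

lemma div_free_orthogonal_gradient:
  fixes v :: "real^'n \<Rightarrow> real^'n"
  assumes v: "continuous_on cl v" "weakly_div_free \<Omega> v"
    and tangent: "\<And>x. x \<in> bd \<Longrightarrow> v x \<bullet> nrm x = 0"
    and \<phi>: "C1_on \<Omega> cl \<phi>" and F: "continuous_on cl F"
      "\<And>x. x \<in> \<Omega> \<Longrightarrow> (\<phi> has_derivative (\<lambda>h. F x \<bullet> h)) (at x)"
  shows "(LINT x:\<Omega>|lborel. v x \<bullet> F x) = 0"
proof -
  obtain X G B where X: "boundary_cutoff X G B" using exists_boundary_cutoff by blast
  note Xd = boundary_cutoffD[OF X]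
  have \<phi>c: "continuous_on cl \<phi>" using \<phi> by (rule C1_on_continuous)
  have "(LINT x:\<Omega>|lborel. X m x * (v x \<bullet> F x) + (\<phi> x *\<^sub>R v x) \<bullet> G m x) = 0" for m
  proof -
    let ?\<eta> = "\<lambda>x. X m x * \<phi> x"
    obtain K where K: "compact K" "K \<subseteq> \<Omega>" "\<And>y. y \<in> \<Omega> - K \<Longrightarrow> X m y = 0" using Xd(7)[of m] by blast
    have sub: "{x \<in> \<Omega>. ?\<eta> x \<noteq> 0} \<subseteq> K" using K(3) by auto
    then have cl: "closure {x \<in> \<Omega>. ?\<eta> x \<noteq> 0} \<subseteq> K" using K(1) by (simp add: closure_minimal compact_imp_closed)
    have "compact (closure {x \<in> \<Omega>. ?\<eta> x \<noteq> 0})"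
      using compact_closure bounded_subset[OF compact_imp_bounded[OF K(1)] sub] by (simp add: compact_eq_bounded_closed bounded_closure)
    moreover have "C1_on \<Omega> \<Omega> ?\<eta>"
      by (intro C1_on_mult Xd(1) C1_on_subset[OF \<phi>]) (use closure_subset in auto)
    ultimately have "C1c_on \<Omega> \<Omega> ?\<eta>" unfolding C1c_on_def using cl K(2) by blast
    then have 0: "(LINT x:\<Omega>|lborel. v x \<bullet> grad ?\<eta> x) = 0" using v(2) by (simp add: weakly_div_free_def)
    have "(LINT x:\<Omega>|lborel. X m x * (v x \<bullet> F x) + (\<phi> x *\<^sub>R v x) \<bullet> G m x) = (LINT x:\<Omega>|lborel. v x \<bullet> grad ?\<eta> x)"
    proof (rule set_lebesgue_integral_cong)
      show "\<forall>x. x \<in> \<Omega> \<longrightarrow> X m x * (v x \<bullet> F x) + (\<phi> x *\<^sub>R v x) \<bullet> G m x = v x \<bullet> grad ?\<eta> x"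
      proof (intro allI impI)
        fix x assume x: "x \<in> \<Omega>"
        have "(?\<eta> has_derivative (\<lambda>h. X m x * (F x \<bullet> h) + (G m x \<bullet> h) * \<phi> x)) (at x)"
          by (rule has_derivative_mult[OF Xd(6)[OF x] F(2)[OF x]])
        then have "(?\<eta> has_derivative (\<lambda>h. (X m x *\<^sub>R F x + \<phi> x *\<^sub>R G m x) \<bullet> h)) (at x)"
          by (rule has_derivative_eq_rhs) (simp add: inner_add_left mult.commute)
        from grad_unique[OF this]
        show "X m x * (v x \<bullet> F x) + (\<phi> x *\<^sub>R v x) \<bullet> G m x = v x \<bullet> grad ?\<eta> x"
          by (simp add: inner_add_right)
      qed
    qed (use \<Omega>_borel in auto)
    then show ?thesis using 0 by simp
  qed
  moreover have "(\<lambda>m. LINT x:\<Omega>|lborel. X m x * (v x \<bullet> F x) + (\<phi> x *\<^sub>R v x) \<bullet> G m x) \<longlonglongrightarrow>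
      (LINT x:\<Omega>|lborel. v x \<bullet> F x) - (LINT x:bd|surf. (\<phi> x *\<^sub>R v x) \<bullet> nrm x)"
    by (intro cutoff_integral(1)[OF X] continuous_on_inner continuous_on_scaleR v F \<phi>c)
  ultimately have "(LINT x:\<Omega>|lborel. v x \<bullet> F x) = (LINT x:bd|surf. (\<phi> x *\<^sub>R v x) \<bullet> nrm x)"
    by (simp add: LIMSEQ_const_iff)
  also have "\<dots> = (LINT x:bd|surf. 0)"
    by (rule set_lebesgue_integral_cong) (use tangent in auto)
  finally show ?thesis by simp
qed

text \<open>The cutoffs act in space only, so the limit is taken at each time separately. For every
  \<open>m\<close> the time integral of \<open>a m\<close> vanishes, and dominated convergence
  transfers this to the limit \<open>a1 - a2\<close>.\<close>

lemma euler_integral_boundary: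
  fixes u \<psi> :: "(real^'n) \<times> real \<Rightarrow> real^'n" and p :: "(real^'n) \<times> real \<Rightarrow> real"
  assumes u: "continuous_on (cl \<times> {0<..<T}) u"
    and tangent: "\<forall>t\<in>{0<..<T}. \<forall>x\<in>bd. u (x, t) \<bullet> nrm x = 0"
    and p: "continuous_on (cl \<times> {0<..<T}) p"
    and euler: "\<forall>\<psi> :: (real^'n) \<times> real \<Rightarrow> real^'n.
      C1c_on (\<Omega> \<times> {0<..<T}) (\<Omega> \<times> {0<..<T}) \<psi> \<longrightarrow> euler_integral \<Omega> T u p \<psi> = 0"
    and \<psi>: "C1c_on (\<Omega> \<times> {0<..<T}) (cl \<times> {0<..<T}) \<psi>"
  shows "euler_integral \<Omega> T u p \<psi> =
    (LINT t:{0<..<T}|lborel. LINT x:bd|surf. p (x, t) * (\<psi> (x, t) \<bullet> nrm x))"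
proof -
  let ?I = "{0<..<T}" and ?n = "nrm"
  let ?Q = "\<Omega> \<times> ?I" and ?Qc = "cl \<times> ?I"
  have sub\<Omega>: "\<Omega> \<subseteq> cl" by (rule closure_subset)
  have Qo: "open ?Q" using open_\<Omega> by (intro open_Times) auto
  define K where "K = closure {q \<in> ?Qc. \<psi> q \<noteq> 0}"
  have K: "compact K" "K \<subseteq> ?Qc" and \<psi>C1: "C1_on ?Q ?Qc \<psi>" using \<psi> by (auto simp: C1c_on_def K_def)
  have \<psi>0: "\<psi> q = 0" if "q \<in> ?Qc - K" for q
    using that closure_subset[of "{q \<in> ?Qc. \<psi> q \<noteq> 0}"] by (auto simp: K_def)
  obtain D where D: "continuous_on ?Qc \<psi>" "continuous_on ?Qc D"
    "\<And>q. q \<in> ?Q \<Longrightarrow> (\<psi> has_derivative blinfun_apply (D q)) (at q)"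
    using \<psi>C1 by (rule C1_onE) blast
  \<comment> \<open>The times met by the support of the test field. \<open>u\<close> and
    \<open>p\<close> may be unbounded towards times 0 and \<open>T\<close>; over the compact set
    \<open>J\<close> they are bounded.\<close>
  define J where "J = snd ` K"
  have J: "compact J" "J \<subseteq> ?I"
    unfolding J_def using K by (auto intro!: compact_continuous_image continuous_intros)
  have offJ: "(x, t) \<notin> K" if "t \<notin> J" for x t using that by (force simp: J_def)
  \<comment> \<open>Vanishing of the test field on an open set makes its derivative vanish there
    too, so \<open>E\<close> is zero at all times outside \<open>J\<close>.\<close>
  have D0: "blinfun_apply (D q) = (\<lambda>_. 0)" if "q \<in> ?Q - K" for q
  proof (rule has_derivative_unique)
    show "(\<psi> has_derivative blinfun_apply (D q)) (at q)" using D(3) that by blast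
    show "(\<psi> has_derivative (\<lambda>_. 0)) (at q)"
    proof (rule has_derivative_transform_within_open[of "\<lambda>_. 0" _ _ _ "?Q - K"])
      show "open (?Q - K)" using Qo K(1) by (intro open_Diff compact_imp_closed)
      show "0 = \<psi> q" if "q \<in> ?Q - K" for q
        using \<psi>0[of q] that sub\<Omega> by auto
    qed (use that in auto)
  qed
  define E where "E q = euler_density u p q (blinfun_apply (D q))" for q
  define V where "V q = (u q \<bullet> \<psi> q) *\<^sub>R u q + p q *\<^sub>R \<psi> q" for q
  have Ec: "continuous_on ?Qc E" unfolding E_def by (rule continuous_euler_density[OF u p D(2)])
  have Vc: "continuous_on ?Qc V" unfolding V_def by (intro continuous_intros u p D(1))
  have E0: "E (x, t) = 0" if "x \<in> \<Omega>" "t \<in> ?I - J" for x t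
  proof -
    have "(x, t) \<in> ?Q - K" using that offJ[of t x] by auto
    from D0[OF this] show ?thesis by (simp add: E_def euler_density_def)
  qed
  have V0: "V (x, t) = 0" if "x \<in> cl" "t \<in> ?I - J" for x t
    using \<psi>0[of "(x, t)"] offJ[of t x] that by (auto simp: V_def)
  have Et: "continuous_on cl (\<lambda>x. E (x, t))" and Vt: "continuous_on cl (\<lambda>x. V (x, t))"
    if "t \<in> ?I" for t
    using that by (auto intro!: continuous_on_compose2[OF Ec] continuous_on_compose2[OF Vc] continuous_intros)
  have bd: "\<exists>M\<ge>0. \<forall>q\<in>cl \<times> J. norm (f q) \<le> M" if "continuous_on ?Qc f" for f :: "_ \<Rightarrow> 'b::real_normed_vector"
  proof -
    have "bounded (f ` (cl \<times> J))"
      using J by (intro compact_imp_bounded compact_continuous_image continuous_on_subset[OF that] compact_Times compact_closure) auto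
    then show ?thesis unfolding bounded_iff by (metis imageI norm_ge_zero order_trans linear)
  qed
  obtain M1 where M1: "0 \<le> M1" "\<And>q. q \<in> cl \<times> J \<Longrightarrow> norm (E q) \<le> M1" using bd[OF Ec] by blast
  obtain M2 where M2: "0 \<le> M2" "\<And>q. q \<in> cl \<times> J \<Longrightarrow> norm (V q) \<le> M2" using bd[OF Vc] by blast
  have E_int: "euler_integral \<Omega> T u p \<zeta> = (LINT t:?I|lborel. LINT x:\<Omega>|lborel. e (x, t))"
    if "\<And>q. q \<in> ?Q \<Longrightarrow> (\<zeta> has_derivative (A q)) (at q)" "\<And>q. q \<in> ?Q \<Longrightarrow> euler_density u p q (A q) = e q" for \<zeta> A e
    unfolding euler_integral_def
  proof (rule set_lebesgue_integral_cong)
    show "\<forall>t. t \<in> ?I \<longrightarrow> (LINT x:\<Omega>|lborel. euler_integrand u p \<zeta> x t) = (LINT x:\<Omega>|lborel. e (x, t))"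
    proof (intro allI impI set_lebesgue_integral_cong)
      fix t x assume "t \<in> ?I" "x \<in> \<Omega>"
      then have q: "(x, t) \<in> ?Q" by simp
      show "euler_integrand u p \<zeta> x t = e (x, t)"
        unfolding euler_density_eq[OF that(1)[OF q]] by (rule that(2)[OF q])
    qed (use \<Omega>_borel in auto)
  qed auto
  obtain X G B where X: "boundary_cutoff X G B" using exists_boundary_cutoff by blast
  note Xd = boundary_cutoffD[OF X]
  define a where "a m t = (LINT x:\<Omega>|lborel. X m x * E (x, t) + V (x, t) \<bullet> G m x)" for m t
  define a1 where "a1 t = (LINT x:\<Omega>|lborel. E (x, t))" for t
  define a2 where "a2 t = (LINT x:bd|surf. V (x, t) \<bullet> ?n x)" for t
  have azero: "(LINT t:?I|lborel. a m t) = 0" for m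
  proof -
    \<comment> \<open>Its support lies in the part of \<open>K\<close> over the compact set
      \<open>L\<close> inside \<Omega>, so the hypothesis for interior test fields applies.\<close>
    let ?\<zeta> = "\<lambda>q. X m (fst q) *\<^sub>R \<psi> q"
    obtain L where L: "compact L" "L \<subseteq> \<Omega>" "\<And>y. y \<in> \<Omega> - L \<Longrightarrow> X m y = 0" using Xd(7)[of m] by blast
    have LK: "compact ((L \<times> UNIV) \<inter> K)"
      by (rule closed_Int_compact[OF closed_Times[OF compact_imp_closed[OF L(1)] closed_UNIV] K(1)])
    have sub: "{q \<in> ?Q. ?\<zeta> q \<noteq> 0} \<subseteq> (L \<times> UNIV) \<inter> K" using L(3) \<psi>0 sub\<Omega> by force
    then have cl: "closure {q \<in> ?Q. ?\<zeta> q \<noteq> 0} \<subseteq> (L \<times> UNIV) \<inter> K"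
      using LK by (intro closure_minimal compact_imp_closed)
    have "compact (closure {q \<in> ?Q. ?\<zeta> q \<noteq> 0})"
      using bounded_subset[OF compact_imp_bounded[OF LK] sub] by (simp add: compact_eq_bounded_closed bounded_closure)
    moreover have "C1_on ?Q ?Q ?\<zeta>"
    proof (rule C1_on_scaleR)
      show "C1_on ?Q ?Q (\<lambda>q. X m (fst q))"
        by (rule C1_on_compose[OF C1_on_bounded_linear[OF bounded_linear_fst] Xd(1)]) auto
      show "C1_on ?Q ?Q \<psi>" using sub\<Omega> by (intro C1_on_subset[OF \<psi>C1]) auto
    qed
    moreover have "(L \<times> UNIV) \<inter> K \<subseteq> ?Q" using K(2) L(2) by auto
    ultimately have "C1c_on ?Q ?Q ?\<zeta>" unfolding C1c_on_def using cl by blast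
    then have "euler_integral \<Omega> T u p ?\<zeta> = 0" using euler by blast
    moreover have "euler_integral \<Omega> T u p ?\<zeta> = (LINT t:?I|lborel. LINT x:\<Omega>|lborel.
        (\<lambda>q. X m (fst q) * E q + V q \<bullet> G m (fst q)) (x, t))"
    proof (rule E_int)
      fix q assume q: "q \<in> ?Q"
      then have f: "fst q \<in> \<Omega>" by auto
      have "((\<lambda>q. X m (fst q)) has_derivative (\<lambda>h. G m (fst q) \<bullet> fst h)) (at q)"
        by (rule has_derivative_compose[of fst fst q UNIV "X m", OF _ Xd(6)[OF f]])
          (rule bounded_linear_imp_has_derivative[OF bounded_linear_fst])
      from has_derivative_scaleR[OF this D(3)[OF q]]
      show "(?\<zeta> has_derivative (\<lambda>h. X m (fst q) *\<^sub>R D q h + (G m (fst q) \<bullet> fst h) *\<^sub>R \<psi> q)) (at q)" .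
      show "euler_density u p q (\<lambda>h. X m (fst q) *\<^sub>R D q h + (G m (fst q) \<bullet> fst h) *\<^sub>R \<psi> q) =
          X m (fst q) * E q + V q \<bullet> G m (fst q)"
        unfolding E_def V_def by (rule euler_density_cutoff) simp
    qed
    ultimately show ?thesis by (simp add: a_def)
  qed
  have alim: "(\<lambda>m. a m t) \<longlonglongrightarrow> a1 t - a2 t" if "t \<in> ?I" for t
    unfolding a_def a1_def a2_def by (rule cutoff_integral(1)[OF X Et Vt]) (use that in auto)
  \<comment> \<open>Independent of \<open>m\<close> and \<open>t\<close>; on \<open>J\<close>, which
    has finite measure, it is the integrable majorant in time.\<close>
  define C where "C = M1 * measure lborel \<Omega> + B * M2"
  have abd: "\<bar>a m t\<bar> \<le> C" if t: "t \<in> J" for m t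
    unfolding a_def C_def
    by (rule cutoff_integral(2)[OF X Et Vt]) (use t J M1 M2 sub\<Omega> in auto)
  have a0: "a m t = 0" if t: "t \<in> ?I - J" for m t
  proof -
    have "a m t = (LINT x:\<Omega>|lborel. 0)"
      unfolding a_def by (rule set_lebesgue_integral_cong) (use \<Omega>_borel E0 V0 t sub\<Omega> in auto)
    then show ?thesis by simp
  qed
  have fin: "emeasure lborel \<Omega> < \<infinity>" by (rule finite_\<Omega>)
  have ac: "continuous_on ?I (a m)" for m
  proof -
    have "continuous_on ?I (\<lambda>t. LINT x:\<Omega>|lborel. (\<lambda>q. X m (fst q) * E q + V q \<bullet> G m (fst q)) (x, t))"
    proof (rule continuous_on_set_integral_parameter[OF _ compact_closure sub\<Omega> _ \<Omega>_borel fin])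
      show "continuous_on ?Qc (\<lambda>q. X m (fst q) * E q + V q \<bullet> G m (fst q))"
        by (intro continuous_intros Ec Vc continuous_on_compose2[OF Xd(2)] continuous_on_compose2[OF Xd(3)]) auto
    qed simp
    then show ?thesis by (simp add: a_def)
  qed
  have a1c: "continuous_on ?I a1"
    unfolding a1_def by (rule continuous_on_set_integral_parameter[OF Ec compact_closure sub\<Omega> _ \<Omega>_borel fin]) simp
  have a2c: "continuous_on ?I a2"
  proof -
    have "continuous_on ?I (\<lambda>t. LINT x:bd|surf. (\<lambda>q. V q \<bullet> ?n (fst q)) (x, t))"
    proof (rule continuous_on_set_integral_parameter[OF _ compact_frontier order_refl _ _ emeasure_surface_finite])
      show "continuous_on (bd \<times> ?I) (\<lambda>q. V q \<bullet> ?n (fst q))"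
        using frontier_subset_closure
        by (intro continuous_intros continuous_on_subset[OF Vc] continuous_on_compose2[OF continuous_outward_unit_normal]) auto
    qed auto
    then show ?thesis by (simp add: a2_def)
  qed
  have a10: "a1 t = 0" if t: "t \<in> ?I - J" for t
  proof -
    have "a1 t = (LINT x:\<Omega>|lborel. 0)"
      unfolding a1_def by (rule set_lebesgue_integral_cong) (use \<Omega>_borel E0 t in auto)
    then show ?thesis by simp
  qed
  have a20: "a2 t = 0" if t: "t \<in> ?I - J" for t
  proof -
    have "a2 t = (LINT x:bd|surf. 0)"
      unfolding a2_def by (rule set_lebesgue_integral_cong) (use V0 t frontier_subset_closure in auto)
    then show ?thesis by simp
  qed
  have int1: "set_integrable lborel ?I a1" by (rule set_integrable_compact_support[OF a1c J a10])
  have int2: "set_integrable lborel ?I a2" by (rule set_integrable_compact_support[OF a2c J a20])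
  have "(\<lambda>m. LINT t:?I|lborel. a m t) \<longlonglongrightarrow> (LINT t:?I|lborel. a1 t - a2 t)"
    unfolding set_lebesgue_integral_def
  proof (rule integral_dominated_convergence[where w = "\<lambda>t. C * indicator J t"])
    show "integrable lborel (\<lambda>t. C * indicator J t)"
      using emeasure_bounded_finite[OF compact_imp_bounded[OF J(1)]] J(1)
      by (intro integrable_mult_right integrable_real_indicator) (auto simp: compact_imp_closed)
    show "(\<lambda>t. indicator ?I t *\<^sub>R a m t) \<in> borel_measurable lborel" for m
      using borel_measurable_continuous_on_indicator[OF _ ac[of m]] by simp
    show "(\<lambda>t. indicator ?I t *\<^sub>R (a1 t - a2 t)) \<in> borel_measurable lborel"
      using borel_measurable_continuous_on_indicator[OF _ continuous_on_diff[OF a1c a2c]] by simp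
    show "AE t in lborel. (\<lambda>m. indicator ?I t *\<^sub>R a m t) \<longlonglongrightarrow> indicator ?I t *\<^sub>R (a1 t - a2 t)"
    proof (rule AE_I2)
      fix t
      show "(\<lambda>m. indicator ?I t *\<^sub>R a m t) \<longlonglongrightarrow> indicator ?I t *\<^sub>R (a1 t - a2 t)"
        using alim[of t] by (cases "t \<in> ?I") auto
    qed
    show "AE t in lborel. norm (indicator ?I t *\<^sub>R a m t) \<le> C * indicator J t" for m
    proof (rule AE_I2)
      fix t
      show "norm (indicator ?I t *\<^sub>R a m t) \<le> C * indicator J t"
        using abd[of t m] a0[of t m] J(2) by (cases "t \<in> J"; cases "t \<in> ?I") auto
    qed
  qed
  then have "(LINT t:?I|lborel. a1 t - a2 t) = 0" unfolding azero by (simp add: LIMSEQ_const_iff)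
  then have eq: "(LINT t:?I|lborel. a1 t) = (LINT t:?I|lborel. a2 t)"
    using set_integral_diff(2)[OF int1 int2] by simp
  have "euler_integral \<Omega> T u p \<psi> = (LINT t:?I|lborel. a1 t)"
    unfolding a1_def by (rule E_int[OF D(3)]) (auto simp: E_def)
  also note eq
  also have "(LINT t:?I|lborel. a2 t) = (LINT t:?I|lborel. LINT x:bd|surf. p (x, t) * (\<psi> (x, t) \<bullet> ?n x))"
  proof (rule set_lebesgue_integral_cong)
    show "\<forall>t. t \<in> ?I \<longrightarrow> a2 t = (LINT x:bd|surf. p (x, t) * (\<psi> (x, t) \<bullet> ?n x))"
      unfolding a2_def
      by (intro allI impI set_lebesgue_integral_cong) (use tangent in \<open>auto simp: V_def inner_add_left\<close>)
  qed auto
  finally show ?thesis .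
qed

text \<open>The test field is a time bump times the gradient of \<phi>, C1 because \<phi> is C2. Its
  space derivative gives the Hessian terms; the derivative of the bump multiplies the integral of
  \<open>u\<close> against a gradient, which is zero.\<close>

lemma pressure_identity:
  fixes u :: "(real^'n) \<times> real \<Rightarrow> real^'n" and p :: "(real^'n) \<times> real \<Rightarrow> real" and \<phi> :: "real^'n \<Rightarrow> real"
  assumes u: "continuous_on (cl \<times> {0<..<T}) u"
    and div: "\<forall>t\<in>{0<..<T}. weakly_div_free \<Omega> (\<lambda>x. u (x, t))"
    and tangent: "\<forall>t\<in>{0<..<T}. \<forall>x\<in>bd. u (x, t) \<bullet> nrm x = 0"
    and p: "continuous_on (cl \<times> {0<..<T}) p"
    and weak: "\<And>\<psi> :: (real^'n) \<times> real \<Rightarrow> real^'n.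
      C1c_on (\<Omega> \<times> {0<..<T}) (cl \<times> {0<..<T}) \<psi> \<Longrightarrow> euler_integral \<Omega> T u p \<psi> =
        (LINT t:{0<..<T}|lborel. LINT x:bd|surf. p (x, t) * (\<psi> (x, t) \<bullet> nrm x))"
    and t0: "t0 \<in> {0<..<T}" and \<phi>: "C2_on \<Omega> cl \<phi>"
  shows "- (LINT x:\<Omega>|lborel. p (x, t0) * laplacian \<phi> x)
        + (LINT x:bd|surf. p (x, t0) * normal_deriv \<Omega> \<phi> x)
        = (LINT x:\<Omega>|lborel. frob (tensor (u (x, t0)) (u (x, t0))) (hessian \<phi> x))"
proof -
  let ?I = "{0<..<T}" and ?n = "nrm"
  let ?Q = "\<Omega> \<times> ?I" and ?Qc = "cl \<times> ?I"
  have sub\<Omega>: "\<Omega> \<subseteq> cl" by (rule closure_subset)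
  obtain D where D: "C1_on \<Omega> cl D" "\<And>x. x \<in> \<Omega> \<Longrightarrow> (\<phi> has_derivative blinfun_apply (D x)) (at x)"
    using \<phi> unfolding C2_on_def by blast
  have \<phi>C1: "C1_on \<Omega> cl \<phi>"
    using \<phi> D by (intro C1_onI[of _ _ D]) (auto simp: C2_on_def intro: C1_on_continuous)
  \<comment> \<open>The gradient read off from \<open>D\<close>, which unlike
    \<open>grad \<phi>\<close> is meaningful up to the boundary.\<close>
  define \<Phi> where "\<Phi> x = (\<Sum>i\<in>UNIV. D x (axis i 1) *\<^sub>R (axis i 1 :: real^'n))" for x
  have \<Phi>i: "\<Phi> x $ i = D x (axis i 1)" for x i
    by (simp add: \<Phi>_def axis_def if_distrib cong: if_cong)
  have \<Phi>C1: "C1_on \<Omega> cl \<Phi>"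
  proof -
    have "C1_on UNIV UNIV (\<lambda>A. \<Sum>i\<in>UNIV. blinfun_apply A (axis i 1) *\<^sub>R (axis i 1 :: real^'n))"
      by (intro C1_on_bounded_linear bounded_linear_sum bounded_linear_scaleR_const blinfun.bounded_linear_left)
    from C1_on_compose[OF D(1) this] show ?thesis unfolding \<Phi>_def by simp
  qed
  have \<Phi>d: "(\<phi> has_derivative (\<lambda>h. \<Phi> x \<bullet> h)) (at x)" and g\<Phi>: "grad \<phi> x = \<Phi> x" if "x \<in> \<Omega>" for x
  proof -
    show g: "grad \<phi> x = \<Phi> x" using grad_eqI(3)[OF D(2)[OF that]] by (simp add: vec_eq_iff \<Phi>i)
    show "(\<phi> has_derivative (\<lambda>h. \<Phi> x \<bullet> h)) (at x)" using grad_has_derivative[OF D(2)[OF that]] by (simp add: g)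
  qed
  obtain H where H: "continuous_on cl \<Phi>" "continuous_on cl H"
    "\<And>x. x \<in> \<Omega> \<Longrightarrow> (\<Phi> has_derivative blinfun_apply (H x)) (at x)"
    using \<Phi>C1 by (rule C1_onE) blast
  have second: "pderiv_at i (pderiv_at j \<phi>) x = H x (axis i 1) $ j" if x: "x \<in> \<Omega>" for x i j
  proof -
    have "((\<lambda>y. \<Phi> y $ j) has_derivative (\<lambda>h. H x h $ j)) (at x)"
      by (rule bounded_linear.has_derivative[OF bounded_linear_vec_nth H(3)[OF x]])
    then have "(pderiv_at j \<phi> has_derivative (\<lambda>h. H x h $ j)) (at x)"
    proof (rule has_derivative_transform_within_open[OF _ open_\<Omega> x])
      show "\<Phi> y $ j = pderiv_at j \<phi> y" if "y \<in> \<Omega>" for y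
        using grad_eqI(2)[OF D(2)[OF that], of j] by (simp add: \<Phi>i)
    qed
    from grad_eqI(2)[OF this] show ?thesis .
  qed
  have nd: "normal_deriv \<Omega> \<phi> x = \<Phi> x \<bullet> ?n x" if x: "x \<in> bd" for x
  proof -
    have "x \<in> cl" "x \<notin> \<Omega>" using x frontier_subset_closure frontier_disjoint by auto
    \<comment> \<open>A boundary point is a limit of points of \<Omega> without belonging to it. The
      filter is thus nontrivial, and \<open>Lim\<close> in \<open>normal_deriv\<close> is an actual
      limit.\<close>
    then have nt: "at x within \<Omega> \<noteq> bot" by (simp add: trivial_limit_within closure_def)
    have "(\<Phi> \<longlongrightarrow> \<Phi> x) (at x within \<Omega>)"
      using H(1) \<open>x \<in> cl\<close> sub\<Omega> unfolding continuous_on_def by (blast intro: tendsto_within_subset)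
    moreover have "\<forall>\<^sub>F y in at x within \<Omega>. \<Phi> y = grad \<phi> y"
      by (simp add: eventually_at_topological) (use g\<Phi> in \<open>auto intro!: exI[of _ UNIV]\<close>)
    ultimately have "(grad \<phi> \<longlongrightarrow> \<Phi> x) (at x within \<Omega>)" by (rule Lim_transform_eventually)
    then have "Lim (at x within \<Omega>) (grad \<phi>) = \<Phi> x" by (intro tendsto_Lim nt)
    then show ?thesis by (simp add: normal_deriv_def)
  qed
  \<comment> \<open>This derivative acts on the space component only, so the time term of the
    density is \<open>H x 0\<close>, that is, zero.\<close>
  define e where "e q = euler_density u p q (\<lambda>h. H (fst q) (fst h))" for q
  define h1 where "h1 t = (LINT x:\<Omega>|lborel. e (x, t))" for t
  define h2 where "h2 t = (LINT x:bd|surf. p (x, t) * (\<Phi> x \<bullet> ?n x))" for t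
  have ec: "continuous_on ?Qc e"
  proof -
    have "continuous_on ?Qc (\<lambda>q. H (fst q) o\<^sub>L Blinfun fst)"
      by (intro bounded_bilinear.continuous_on[OF bounded_bilinear_blinfun_compose] continuous_on_compose2[OF H(2)]
          continuous_intros) auto
    from continuous_euler_density[OF u p this]
    show ?thesis unfolding e_def by (simp add: blinfun_compose.rep_eq o_def bounded_linear_Blinfun_apply[OF bounded_linear_fst])
  qed
  have h1c: "continuous_on ?I h1"
    unfolding h1_def by (rule continuous_on_set_integral_parameter[OF ec compact_closure sub\<Omega> _ \<Omega>_borel finite_\<Omega>]) simp
  have h2c: "continuous_on ?I h2"
  proof -
    have "continuous_on ?I (\<lambda>t. LINT x:bd|surf. (\<lambda>q. p q * (\<Phi> (fst q) \<bullet> ?n (fst q))) (x, t))"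
    proof (rule continuous_on_set_integral_parameter[OF _ compact_frontier order_refl _ _ emeasure_surface_finite])
      show "continuous_on (bd \<times> ?I) (\<lambda>q. p q * (\<Phi> (fst q) \<bullet> ?n (fst q)))"
        using frontier_subset_closure
        by (intro continuous_intros continuous_on_subset[OF p] continuous_on_compose2[OF H(1)]
            continuous_on_compose2[OF continuous_outward_unit_normal]) auto
    qed auto
    then show ?thesis by (simp add: h2_def)
  qed
  have orth: "(LINT x:\<Omega>|lborel. u (x, t) \<bullet> \<Phi> x) = 0" if t: "t \<in> ?I" for t
  proof (rule div_free_orthogonal_gradient[OF _ _ _ \<phi>C1 H(1) \<Phi>d])
    show "continuous_on cl (\<lambda>x. u (x, t))"
      using t by (auto intro!: continuous_on_compose2[OF u] continuous_intros)
  qed (use div tangent t in auto)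
  \<comment> \<open>Equality of the weighted time integrals alone would give the identity for almost
    every time; continuity of \<open>h1\<close> and \<open>h2\<close> gives it at \<open>t0\<close>
    itself.\<close>
  have "h1 t0 - h2 t0 = 0"
  proof (rule continuous_bump_orthogonal_zero[of ?I t0 "\<lambda>t. h1 t - h2 t"])
    fix r :: real assume r: "0 < r" "cball t0 r \<subseteq> ?I"
    define a where "a t = pos_sq (r\<^sup>2 - (norm (t - t0))\<^sup>2)" for t
    have aC1: "C1_on UNIV UNIV a" unfolding a_def by (rule bump_C1(1))
    have apos: "0 < a t \<longleftrightarrow> t \<in> ball t0 r" for t unfolding a_def by (rule bump_C1(2)[OF r(1)])
    have a0: "a t = 0" if "t \<notin> cball t0 r" for t
      using apos[of t] that by (auto simp: a_def less_le)
    obtain a' where a': "\<And>t. (a has_derivative blinfun_apply (a' t)) (at t)"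
      using aC1 by (auto simp: C1_on_def)
    let ?\<psi> = "\<lambda>q. a (snd q) *\<^sub>R \<Phi> (fst q)"
    have "C1_on ?Q ?Qc ?\<psi>"
    proof (rule C1_on_scaleR)
      show "C1_on ?Q ?Qc (\<lambda>q. a (snd q))"
        by (rule C1_on_compose[OF C1_on_bounded_linear[OF bounded_linear_snd] aC1]) auto
      show "C1_on ?Q ?Qc (\<lambda>q. \<Phi> (fst q))"
        by (rule C1_on_compose[OF C1_on_bounded_linear[OF bounded_linear_fst] \<Phi>C1]) auto
    qed
    moreover have sub: "{q \<in> ?Qc. ?\<psi> q \<noteq> 0} \<subseteq> cl \<times> cball t0 r" using a0 by force
    moreover have cK: "compact (cl \<times> cball t0 r)" by (intro compact_Times compact_closure compact_cball)
    moreover have "compact (closure {q \<in> ?Qc. ?\<psi> q \<noteq> 0})"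
      using bounded_subset[OF compact_imp_bounded[OF cK] sub] by (simp add: compact_eq_bounded_closed bounded_closure)
    moreover have "closure {q \<in> ?Qc. ?\<psi> q \<noteq> 0} \<subseteq> cl \<times> cball t0 r"
      using sub cK by (intro closure_minimal compact_imp_closed)
    moreover have "cl \<times> cball t0 r \<subseteq> ?Qc" using r(2) by auto
    ultimately have "C1c_on ?Q ?Qc ?\<psi>" unfolding C1c_on_def by blast
    note weak = weak[OF this]
    have "euler_integral \<Omega> T u p ?\<psi> = (LINT t:?I|lborel. a t * h1 t)"
      unfolding euler_integral_def
    proof (rule set_lebesgue_integral_cong)
      show "\<forall>t. t \<in> ?I \<longrightarrow> (LINT x:\<Omega>|lborel. euler_integrand u p ?\<psi> x t) = a t * h1 t"
      proof (intro allI impI)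
        fix t assume t: "t \<in> ?I"
        \<comment> \<open>The summand with \<open>a' t 1\<close> is the time derivative of the test
          field; \<open>orth\<close> removes it after integration over \<Omega>.\<close>
        have "(LINT x:\<Omega>|lborel. euler_integrand u p ?\<psi> x t) =
          (LINT x:\<Omega>|lborel. a t * e (x, t) + a' t 1 * (u (x, t) \<bullet> \<Phi> x))"
        proof (rule set_lebesgue_integral_cong)
          show "\<forall>x. x \<in> \<Omega> \<longrightarrow> euler_integrand u p ?\<psi> x t = a t * e (x, t) + a' t 1 * (u (x, t) \<bullet> \<Phi> x)"
          proof (intro allI impI)
            fix x assume x: "x \<in> \<Omega>"
            let ?A = "\<lambda>h. a t *\<^sub>R H x (fst h) + a' t (snd h) *\<^sub>R \<Phi> x"
            have 1: "((\<lambda>q. a (snd q)) has_derivative (\<lambda>h. a' t (snd h))) (at (x, t))"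
              by (rule has_derivative_compose[of snd snd "(x, t)" UNIV a])
                (auto intro: bounded_linear_imp_has_derivative bounded_linear_snd a')
            have 2: "((\<lambda>q. \<Phi> (fst q)) has_derivative (\<lambda>h. H x (fst h))) (at (x, t))"
              by (rule has_derivative_compose[of fst fst "(x, t)" UNIV \<Phi>])
                (auto intro: bounded_linear_imp_has_derivative bounded_linear_fst H(3) x)
            have "(?\<psi> has_derivative ?A) (at (x, t))"
              using has_derivative_scaleR[OF 1 2] by simp
            from euler_density_eq[OF this, of u p]
            show "euler_integrand u p ?\<psi> x t = a t * e (x, t) + a' t 1 * (u (x, t) \<bullet> \<Phi> x)"
              by (simp add: e_def euler_density_def sum_distrib_left distrib_left mult_ac)
          qed
        qed (use \<Omega>_borel in auto)
        also have "\<dots> = (LINT x:\<Omega>|lborel. a t * e (x, t)) + (LINT x:\<Omega>|lborel. a' t 1 * (u (x, t) \<bullet> \<Phi> x))"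
          using t by (intro set_integral_add set_integrable_closure continuous_intros H(1)
              continuous_on_compose2[OF ec] continuous_on_compose2[OF u]) auto
        also have "\<dots> = a t * h1 t" using orth[OF t] by (simp add: h1_def)
        finally show "(LINT x:\<Omega>|lborel. euler_integrand u p ?\<psi> x t) = a t * h1 t" .
      qed
    qed auto
    moreover have "(LINT t:?I|lborel. LINT x:bd|surf. p (x, t) * (?\<psi> (x, t) \<bullet> ?n x)) =
        (LINT t:?I|lborel. a t * h2 t)"
    proof -
      have "(LINT x:bd|surf. p (x, t) * (?\<psi> (x, t) \<bullet> ?n x)) = a t * h2 t" for t
        unfolding h2_def by (subst set_integral_mult_right[symmetric]) (simp add: mult_ac)
      then show ?thesis by simp
    qed
    ultimately have eq: "(LINT t:?I|lborel. a t * h1 t) = (LINT t:?I|lborel. a t * h2 t)" using weak by simp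
    have int: "set_integrable lborel ?I (\<lambda>t. a t * h t)" if "continuous_on ?I h" for h
      by (rule set_integrable_compact_support[of _ _ "cball t0 r"])
        (use r(2) a0 that in \<open>auto intro!: continuous_intros continuous_on_subset[OF C1_on_continuous[OF aC1]]\<close>)
    have "(LINT t:?I|lborel. a t * (h1 t - h2 t)) = (LINT t:?I|lborel. a t * h1 t) - (LINT t:?I|lborel. a t * h2 t)"
      unfolding right_diff_distrib by (rule set_integral_diff(2)[OF int[OF h1c] int[OF h2c]])
    then show "(LINT t:?I|lborel. pos_sq (r\<^sup>2 - (norm (t - t0))\<^sup>2) * (h1 t - h2 t)) = 0"
      using eq by (simp add: a_def)
  qed (use t0 h1c h2c in \<open>auto intro: continuous_on_diff\<close>)
  then have h12: "h1 t0 = h2 t0" by simp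
  let ?f = "\<lambda>x. \<Sum>i\<in>UNIV. \<Sum>j\<in>UNIV. u (x, t0) $ i * u (x, t0) $ j * (H x (axis i 1) $ j)"
  let ?g = "\<lambda>x. p (x, t0) * (\<Sum>i\<in>UNIV. H x (axis i 1) $ i)"
  have ut: "continuous_on cl (\<lambda>x. u (x, t0))" and pt: "continuous_on cl (\<lambda>x. p (x, t0))"
    using t0 by (auto intro!: continuous_on_compose2[OF u] continuous_on_compose2[OF p] continuous_intros)
  have "h1 t0 = (LINT x:\<Omega>|lborel. ?f x + ?g x)"
    by (simp add: h1_def e_def euler_density_def)
  also have "\<dots> = (LINT x:\<Omega>|lborel. ?f x) + (LINT x:\<Omega>|lborel. ?g x)"
    by (intro set_integral_add set_integrable_closure continuous_intros ut pt H(2))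
  also have "(LINT x:\<Omega>|lborel. ?f x) = (LINT x:\<Omega>|lborel. frob (tensor (u (x, t0)) (u (x, t0))) (hessian \<phi> x))"
    by (rule set_lebesgue_integral_cong) (use \<Omega>_borel second in \<open>auto simp: frob_def tensor_def hessian_def\<close>)
  also have "(LINT x:\<Omega>|lborel. ?g x) = (LINT x:\<Omega>|lborel. p (x, t0) * laplacian \<phi> x)"
    by (rule set_lebesgue_integral_cong) (use \<Omega>_borel second in \<open>auto simp: laplacian_def\<close>)
  also have "h1 t0 = (LINT x:bd|surf. p (x, t0) * normal_deriv \<Omega> \<phi> x)"
    unfolding h12 h2_def by (rule set_lebesgue_integral_cong) (use nd in auto)
  finally show ?thesis by simp
qed

end

theorem mainTheorem4:
  fixes \<Omega> :: "(real^'n::finite) set"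
    and T :: real
    and u :: "(real^'n) \<times> real \<Rightarrow> real^'n"
    and p :: "(real^'n) \<times> real \<Rightarrow> real"
  assumes dim: "CARD('n) \<ge> 2"
    and domain: "open \<Omega>" "connected \<Omega>" "\<Omega> \<noteq> {}"
    and bounded: "bounded \<Omega>"
    and simply_connected: "simply_connected \<Omega>"
    and C2: "C2_boundary \<Omega>"
    and T_pos: "T > 0"
    and u_cont: "continuous_on (closure \<Omega> \<times> {0<..<T}) u"
    and u_div: "\<forall>t\<in>{0<..<T}. weakly_div_free \<Omega> (\<lambda>x. u (x, t))"
    and u_bdry: "\<forall>t\<in>{0<..<T}. \<forall>x\<in>frontier \<Omega>. u (x, t) \<bullet> outward_unit_normal \<Omega> x = 0"
    and p_cont: "continuous_on (closure \<Omega> \<times> {0<..<T}) p"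
    and euler: "\<forall>\<psi> :: (real^'n) \<times> real \<Rightarrow> real^'n.
      C1c_on (\<Omega> \<times> {0<..<T}) (\<Omega> \<times> {0<..<T}) \<psi> \<longrightarrow> euler_integral \<Omega> T u p \<psi> = 0"
  shows "(\<forall>\<psi> :: (real^'n) \<times> real \<Rightarrow> real^'n.
        C1c_on (\<Omega> \<times> {0<..<T}) (closure \<Omega> \<times> {0<..<T}) \<psi> \<longrightarrow>
        euler_integral \<Omega> T u p \<psi> =
          (LINT t:{0<..<T}|lborel. LINT x:frontier \<Omega>|surface_measure \<Omega>.
             p (x, t) * (\<psi> (x, t) \<bullet> outward_unit_normal \<Omega> x)))
    \<and> (\<forall>t\<in>{0<..<T}. \<forall>\<phi> :: real^'n \<Rightarrow> real. C2_on \<Omega> (closure \<Omega>) \<phi> \<longrightarrow>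
        - (LINT x:\<Omega>|lborel. p (x, t) * laplacian \<phi> x)
        + (LINT x:frontier \<Omega>|surface_measure \<Omega>. p (x, t) * normal_deriv \<Omega> \<phi> x)
        = (LINT x:\<Omega>|lborel. frob (tensor (u (x, t)) (u (x, t))) (hessian \<phi> x)))"
proof -
  interpret C2_domain \<Omega> using domain(1) bounded C2 by unfold_locales
  have weak: "euler_integral \<Omega> T u p \<psi> =
      (LINT t:{0<..<T}|lborel. LINT x:frontier \<Omega>|surface_measure \<Omega>.
         p (x, t) * (\<psi> (x, t) \<bullet> outward_unit_normal \<Omega> x))"
    if "C1c_on (\<Omega> \<times> {0<..<T}) (closure \<Omega> \<times> {0<..<T}) \<psi>" for \<psi>
    by (rule euler_integral_boundary[OF u_cont u_bdry p_cont euler that])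
  show ?thesis
    using weak pressure_identity[OF u_cont u_div u_bdry p_cont weak] by blast
qed

end
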